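(* Let $\mathfrak{b}(z,w)=(1-z\overline{w})^{-2}$ denote the Bergman kernel on the unit disc $\mathbb{D}=\{z\in\mathbb{C}:|z|<1\}$. There exist $0<r<1$ and a one-parameter family of complete Pick kernels $\{s_\lambda\}_{\lambda\in\Lambda}$ on the disc $r\mathbb{D}$ with the following properties: (i) for every $\lambda\in\Lambda$ there exists a kernel $h_\lambda$ on $r\mathbb{D}$ such that $\mathfrak{b}=(1-h_\lambda)s_\lambda$ on $r\mathbb{D}$; (ii) there does not exist a complete Pick kernel $s$ on $r\mathbb{D}$ such that $\mathfrak{b}=(1-h)s$ for some kernel $h$ on $r\mathbb{D}$ and with the property that, for every $\lambda\in\Lambda$, there exists a kernel $g_\lambda$ on $r\mathbb{D}$ such that $s_\lambda=sg_\lambda$. In particular, $(\mathfrak{b},s_\lambda)$, $\lambda\in\Lambda$, is a family of complete Pick pairs over $r\mathbb{D}$, but there does not exist a kernel $s$ that serves simultaneously as a strong Shimorin certificate for each pair.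
   Context: A kernel on a non-empty set $X$ is a function $k:X\times X\to\mathbb{C}$ such that $[k(z_i,z_j)]_{i,j=1}^n$ is positive semi-definite for all finite choices of points; $\mathcal{H}_k$ is the reproducing kernel Hilbert space. $\mathrm{Mult}(\mathcal{H}_k\otimes\mathbb{C}^N,\mathcal{H}_\ell\otimes\mathbb{C}^N)$ is the set of $\Phi:X\to\mathbb{M}_N$ (complex $N\times N$ matrices) with $\Phi f\in\mathcal{H}_\ell\otimes\mathbb{C}^N$ for all $f\in\mathcal{H}_k\otimes\mathbb{C}^N$, normed by the operator norm of $f\mapsto\Phi f$. $(k,\ell)$ is a complete Pick pair on $X$ if for all $n,N\ge1$, all $z_1,\dots,z_n\in X$ and all $W_1,\dots,W_n\in\mathbb{M}_N$ with $[\ell(z_i,z_j)I_{N\times N}-k(z_i,z_j)W_iW_j^*]_{i,j=1}^n$ positive semi-definite, there is $\Phi\in\mathrm{Mult}(\mathcal{H}_k\otimes\mathbb{C}^N,\mathcal{H}_\ell\otimes\mathbb{C}^N)$ of norm at most one with $\Phi(z_i)=W_i$ for all $i$. A kernel $s$ is a complete Pick kernel if $(s,s)$ is a complete Pick pair. A strong Shimorin certificate for a pair $(k,\ell)$ of kernels on $X$ is a complete Pick kernel $s$ on $X$ for which there exist kernels $h,g$ on $X$ with $k=(1-h)s$ and $\ell=sg$. *)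

theory Defs
  imports
    "HOL-Analysis.Topology_Euclidean_Space"
    "HOL-Library.Extended_Real"
    "Jordan_Normal_Form.Schur_Decomposition"
begin

text \<open>The order on \<^typ>\<open>complex\<close> is that of HOL-Library.Complex_Order: \<open>0 \<le> c\<close> says that \<open>c\<close> is
  real and nonnegative. Over the complex numbers this forces a positive semi-definite matrix to be
  Hermitian.\<close>

definition pos_semidef :: "complex mat \<Rightarrow> bool" where
  "pos_semidef A \<longleftrightarrow>
     square_mat A \<and> (\<forall>v \<in> carrier_vec (dim_row A). 0 \<le> (A *\<^sub>v v) \<bullet>c v)"

text \<open>A kernel on \<open>X\<close> is given by a function on the whole type; its values outside \<open>X \<times> X\<close> play no
  role anywhere below.\<close>

definition kernel_on :: "'a set \<Rightarrow> ('a \<Rightarrow> 'a \<Rightarrow> complex) \<Rightarrow> bool" where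
  "kernel_on X k \<longleftrightarrow> X \<noteq> {} \<and>
     (\<forall>n\<ge>1. \<forall>z :: nat \<Rightarrow> 'a. (\<forall>i<n. z i \<in> X) \<longrightarrow>
        pos_semidef (mat n n (\<lambda>(i, j). k (z i) (z j))))"

text \<open>A function \<open>X \<rightarrow> \<complex>\<close> is represented by the function on the whole type that vanishes outside \<open>X\<close>.\<close>

definition zero_ext :: "'a set \<Rightarrow> ('a \<Rightarrow> complex) \<Rightarrow> 'a \<Rightarrow> complex" where
  "zero_ext X f = (\<lambda>x. if x \<in> X then f x else 0)"

definition inner_product_on ::
  "('a \<Rightarrow> complex) set \<Rightarrow> (('a \<Rightarrow> complex) \<Rightarrow> ('a \<Rightarrow> complex) \<Rightarrow> complex) \<Rightarrow> bool" where
  "inner_product_on H ip \<longleftrightarrow>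
     (\<lambda>x. 0) \<in> H \<and>
     (\<forall>f\<in>H. \<forall>g\<in>H. (\<lambda>x. f x + g x) \<in> H) \<and>
     (\<forall>c. \<forall>f\<in>H. (\<lambda>x. c * f x) \<in> H) \<and>
     (\<forall>f\<in>H. \<forall>g\<in>H. \<forall>h\<in>H. ip (\<lambda>x. f x + g x) h = ip f h + ip g h) \<and>
     (\<forall>c. \<forall>f\<in>H. \<forall>g\<in>H. ip (\<lambda>x. c * f x) g = c * ip f g) \<and>
     (\<forall>f\<in>H. \<forall>g\<in>H. ip g f = cnj (ip f g)) \<and>
     (\<forall>f\<in>H. 0 \<le> ip f f) \<and>
     (\<forall>f\<in>H. ip f f = 0 \<longrightarrow> f = (\<lambda>x. 0))"

definition norm_of ::
  "(('a \<Rightarrow> complex) \<Rightarrow> ('a \<Rightarrow> complex) \<Rightarrow> complex) \<Rightarrow> ('a \<Rightarrow> complex) \<Rightarrow> real" where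
  "norm_of ip f = sqrt (Re (ip f f))"

definition hilbert_space_on ::
  "('a \<Rightarrow> complex) set \<Rightarrow> (('a \<Rightarrow> complex) \<Rightarrow> ('a \<Rightarrow> complex) \<Rightarrow> complex) \<Rightarrow> bool" where
  "hilbert_space_on H ip \<longleftrightarrow> inner_product_on H ip \<and>
     (\<forall>\<sigma> :: nat \<Rightarrow> 'a \<Rightarrow> complex.
        (\<forall>n. \<sigma> n \<in> H) \<and>
        (\<forall>e>0. \<exists>M. \<forall>m\<ge>M. \<forall>n\<ge>M. norm_of ip (\<lambda>x. \<sigma> m x - \<sigma> n x) < e) \<longrightarrow>
        (\<exists>f\<in>H. (\<lambda>n. norm_of ip (\<lambda>x. \<sigma> n x - f x)) \<longlonglongrightarrow> 0))"

definition is_rkhs ::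
  "'a set \<Rightarrow> ('a \<Rightarrow> 'a \<Rightarrow> complex) \<Rightarrow>
   ('a \<Rightarrow> complex) set \<Rightarrow> (('a \<Rightarrow> complex) \<Rightarrow> ('a \<Rightarrow> complex) \<Rightarrow> complex) \<Rightarrow> bool" where
  "is_rkhs X k H ip \<longleftrightarrow>
     hilbert_space_on H ip \<and>
     (\<forall>f\<in>H. \<forall>x. x \<notin> X \<longrightarrow> f x = 0) \<and>
     (\<forall>w\<in>X. zero_ext X (\<lambda>z. k z w) \<in> H \<and> (\<forall>f\<in>H. f w = ip f (zero_ext X (\<lambda>z. k z w))))"

text \<open>By the Moore--Aronszajn theorem a kernel on \<open>X\<close> has exactly one reproducing kernel Hilbert space
  of functions on \<open>X\<close>, and its inner product is determined on that space (not outside it, hence the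
  \<open>SOME\<close>; it is only ever evaluated on the space).\<close>

definition rkhs :: "'a set \<Rightarrow> ('a \<Rightarrow> 'a \<Rightarrow> complex) \<Rightarrow> ('a \<Rightarrow> complex) set" where
  "rkhs X k = (THE H. \<exists>ip. is_rkhs X k H ip)"

definition rkhs_inner ::
  "'a set \<Rightarrow> ('a \<Rightarrow> 'a \<Rightarrow> complex) \<Rightarrow> ('a \<Rightarrow> complex) \<Rightarrow> ('a \<Rightarrow> complex) \<Rightarrow> complex" where
  "rkhs_inner X k = (SOME ip. is_rkhs X k (rkhs X k) ip)"

text \<open>The Hilbert space tensor product of the reproducing kernel Hilbert space with \<open>\<complex>\<^sup>N\<close>: vector-valued
  functions all of whose \<open>N\<close> components lie in the space, with the Euclidean sum of the component
  norms.\<close>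

definition component :: "'a set \<Rightarrow> ('a \<Rightarrow> complex vec) \<Rightarrow> nat \<Rightarrow> 'a \<Rightarrow> complex" where
  "component X F i = zero_ext X (\<lambda>x. vec_index (F x) i)"

definition rkhs_vec :: "'a set \<Rightarrow> ('a \<Rightarrow> 'a \<Rightarrow> complex) \<Rightarrow> nat \<Rightarrow> ('a \<Rightarrow> complex vec) set" where
  "rkhs_vec X k N =
     {F. (\<forall>x\<in>X. F x \<in> carrier_vec N) \<and> (\<forall>i<N. component X F i \<in> rkhs X k)}"

definition rkhs_vec_norm ::
  "'a set \<Rightarrow> ('a \<Rightarrow> 'a \<Rightarrow> complex) \<Rightarrow> nat \<Rightarrow> ('a \<Rightarrow> complex vec) \<Rightarrow> real" where
  "rkhs_vec_norm X k N F = sqrt (\<Sum>i<N. (norm_of (rkhs_inner X k) (component X F i))\<^sup>2)"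

definition mult_apply :: "('a \<Rightarrow> complex mat) \<Rightarrow> ('a \<Rightarrow> complex vec) \<Rightarrow> 'a \<Rightarrow> complex vec" where
  "mult_apply \<Phi> F = (\<lambda>x. \<Phi> x *\<^sub>v F x)"

definition Mult ::
  "'a set \<Rightarrow> ('a \<Rightarrow> 'a \<Rightarrow> complex) \<Rightarrow> ('a \<Rightarrow> 'a \<Rightarrow> complex) \<Rightarrow> nat \<Rightarrow> ('a \<Rightarrow> complex mat) set" where
  "Mult X k l N =
     {\<Phi>. (\<forall>x\<in>X. \<Phi> x \<in> carrier_mat N N) \<and>
          (\<forall>F \<in> rkhs_vec X k N. mult_apply \<Phi> F \<in> rkhs_vec X l N)}"

text \<open>The operator norm takes values in the extended reals, so that no boundedness has to be known in
  order for the supremum to be meaningful.\<close>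

definition mult_norm ::
  "'a set \<Rightarrow> ('a \<Rightarrow> 'a \<Rightarrow> complex) \<Rightarrow> ('a \<Rightarrow> 'a \<Rightarrow> complex) \<Rightarrow> nat \<Rightarrow> ('a \<Rightarrow> complex mat) \<Rightarrow> ereal"
  where
  "mult_norm X k l N \<Phi> =
     (SUP F \<in> {F \<in> rkhs_vec X k N. rkhs_vec_norm X k N F \<le> 1}.
        ereal (rkhs_vec_norm X l N (mult_apply \<Phi> F)))"

text \<open>The \<open>n \<times> n\<close> block matrix with \<open>N \<times> N\<close> blocks, flattened: row \<open>p\<close> is row \<open>p mod N\<close> of block row
  \<open>p div N\<close>, and likewise for columns.\<close>

definition pick_matrix ::
  "('a \<Rightarrow> 'a \<Rightarrow> complex) \<Rightarrow> ('a \<Rightarrow> 'a \<Rightarrow> complex) \<Rightarrow> nat \<Rightarrow> nat \<Rightarrow>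
   (nat \<Rightarrow> 'a) \<Rightarrow> (nat \<Rightarrow> complex mat) \<Rightarrow> complex mat" where
  "pick_matrix k l n N z W =
     mat (n * N) (n * N) (\<lambda>(p, q).
       let i = p div N; j = q div N in
       (l (z i) (z j) \<cdot>\<^sub>m 1\<^sub>m N - k (z i) (z j) \<cdot>\<^sub>m (W i * mat_adjoint (W j)))
         $$ (p mod N, q mod N))"

text \<open>The points need not be distinct. If \<open>k\<close> has no zero on the diagonal this makes no difference,
  because positivity of the Pick matrix then forces equal targets at equal points.\<close>

definition complete_pick_pair ::
  "'a set \<Rightarrow> ('a \<Rightarrow> 'a \<Rightarrow> complex) \<Rightarrow> ('a \<Rightarrow> 'a \<Rightarrow> complex) \<Rightarrow> bool" where
  "complete_pick_pair X k l \<longleftrightarrow> kernel_on X k \<and> kernel_on X l \<and>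
     (\<forall>n\<ge>1. \<forall>N\<ge>1. \<forall>(z :: nat \<Rightarrow> 'a) (W :: nat \<Rightarrow> complex mat).
        (\<forall>i<n. z i \<in> X \<and> W i \<in> carrier_mat N N) \<and> pos_semidef (pick_matrix k l n N z W) \<longrightarrow>
        (\<exists>\<Phi> \<in> Mult X k l N. mult_norm X k l N \<Phi> \<le> 1 \<and> (\<forall>i<n. \<Phi> (z i) = W i)))"

definition complete_pick_kernel :: "'a set \<Rightarrow> ('a \<Rightarrow> 'a \<Rightarrow> complex) \<Rightarrow> bool" where
  "complete_pick_kernel X s \<longleftrightarrow> complete_pick_pair X s s"

definition strong_shimorin_certificate ::
  "'a set \<Rightarrow> ('a \<Rightarrow> 'a \<Rightarrow> complex) \<Rightarrow> ('a \<Rightarrow> 'a \<Rightarrow> complex) \<Rightarrow> ('a \<Rightarrow> 'a \<Rightarrow> complex) \<Rightarrow> bool" where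
  "strong_shimorin_certificate X k l s \<longleftrightarrow> complete_pick_kernel X s \<and>
     (\<exists>h g. kernel_on X h \<and> kernel_on X g \<and>
        (\<forall>z\<in>X. \<forall>w\<in>X. k z w = (1 - h z w) * s z w) \<and>
        (\<forall>z\<in>X. \<forall>w\<in>X. l z w = s z w * g z w))"

definition bergman :: "complex \<Rightarrow> complex \<Rightarrow> complex" where
  "bergman z w = 1 / (1 - z * cnj w)\<^sup>2"

end

theory Submission
  imports Defs
begin

text \<open>
  Write \<open>x = z cnj w\<close> and \<open>\<bb> = (1 - x)\<^sup>-\<^sup>2\<close>. Let \<open>s = 1 / (1 - f)\<close> with a positive kernel \<open>f\<close> whose diagonal is less than
  one. Then \<open>\<bb> = (1 - h) s\<close> holds for \<open>h = \<bb> (f - 2 x + x\<^sup>2)\<close>, and \<open>h\<close> is positive as soon as \<open>f\<close> dominates \<open>2 x - x\<^sup>2\<close>. On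
  the span of \<open>z\<close> and \<open>z\<^sup>2\<close> this asks for a Hermitian matrix that lies above both \<open>0\<close> and \<open>diag (2, -1)\<close>. Hermitian
  matrices do not form a lattice: there are many minimal common upper bounds, among them those for which the
  matrix itself and its difference with \<open>diag (2, -1)\<close> have rank one. Such are \<open>\<psi> \<psi>*\<close> for
  \<open>\<psi> = sqrt (2 (1 + c\<^sup>2)) z + c z\<^sup>2\<close>, and the kernels \<open>1 / (1 - \<psi> \<psi>*)\<close> with \<open>c \<in> [0, 1]\<close> are the family.

  A common certificate, normalised at \<open>0\<close>, is \<open>t = 1 / (1 - f)\<close> for some function \<open>f\<close>. The factorization of \<open>\<bb>\<close> bounds
  \<open>f\<close> from below by \<open>2 x - x\<^sup>2\<close> on the diagonal, the member \<open>c = 0\<close> of the family bounds it from above by \<open>2 x\<close>, and the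
  complete Pick property of \<open>t\<close> makes \<open>f\<close> positive. Together they pin the second order part of \<open>f\<close> down to
  \<open>diag (2, 0)\<close>. For small \<open>c > 0\<close> this matrix is not below that of \<open>\<psi> \<psi>*\<close> in the way that \<open>s = t g\<close> requires
  (\<open>no_common_certificate\<close>).

  Two facts connect this with multipliers. If \<open>s = 1 / (1 - p)\<close> and \<open>k = (1 - h) s\<close> with positive \<open>p\<close> and \<open>h\<close> whose diagonals are less than one, then \<open>(k, s)\<close> is
  a complete Pick pair (\<open>complete_pick_pairI\<close>); this is a lurking isometry argument, carried out as a finite
  linear system at each new point. Conversely \<open>1 - 1/t\<close> is positive at pairs of points for a
  nonvanishing normalised complete Pick kernel \<open>t\<close> (\<open>complete_pick_kernel_necessary\<close>). Both read the contractivity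
  of a multiplier \<open>\<Phi>\<close> from \<open>k\<close> to \<open>l\<close> as positivity of \<open>l - k \<Phi> \<Phi>*\<close>, which rests on the construction and uniqueness
  of the reproducing kernel Hilbert space (\<open>is_rkhs_rkhs\<close>).
\<close>

unbundle no vec_syntax

section \<open>Positive semi-definite kernels\<close>

text \<open>The coefficients are those of a linear combination, so that the quadratic form of a Gram kernel
  \<open>k x y = \<langle>v x, v y\<rangle>\<close> is \<open>\<parallel>\<Sum> c x v x\<parallel>\<^sup>2\<close>. Finite sets of points and no repetitions make sums easy to
  handle; repeated points come back through reindexing.\<close>

definition psd :: "'a set \<Rightarrow> ('a \<Rightarrow> 'a \<Rightarrow> complex) \<Rightarrow> bool" where
  "psd S k \<longleftrightarrow>
     (\<forall>F c. finite F \<and> F \<subseteq> S \<longrightarrow> 0 \<le> (\<Sum>x\<in>F. \<Sum>y\<in>F. c x * cnj (c y) * k x y))"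

lemma psdI:
  assumes "\<And>F c. finite F \<Longrightarrow> F \<subseteq> S \<Longrightarrow> 0 \<le> (\<Sum>x\<in>F. \<Sum>y\<in>F. c x * cnj (c y) * k x y)"
  shows "psd S k"
  using assms unfolding psd_def by blast

lemma psdD:
  assumes "psd S k" "finite F" "F \<subseteq> S"
  shows "0 \<le> (\<Sum>x\<in>F. \<Sum>y\<in>F. c x * cnj (c y) * k x y)"
  using assms unfolding psd_def by blast

lemma psd_subset: "psd S k \<Longrightarrow> T \<subseteq> S \<Longrightarrow> psd T k"
  unfolding psd_def by blast

lemma psd_cong_imp:
  assumes "psd S l" "\<And>x y. x \<in> S \<Longrightarrow> y \<in> S \<Longrightarrow> k x y = l x y"
  shows "psd S k"
proof (rule psdI)
  fix F c assume F: "finite F" "F \<subseteq> S"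
  have "(\<Sum>x\<in>F. \<Sum>y\<in>F. c x * cnj (c y) * k x y) = (\<Sum>x\<in>F. \<Sum>y\<in>F. c x * cnj (c y) * l x y)"
    using F(2) assms(2) by (intro sum.cong refl) auto
  then show "0 \<le> (\<Sum>x\<in>F. \<Sum>y\<in>F. c x * cnj (c y) * k x y)"
    using psdD[OF assms(1) F] by simp
qed

lemma psd_cong:
  assumes "\<And>x y. x \<in> S \<Longrightarrow> y \<in> S \<Longrightarrow> k x y = l x y"
  shows "psd S k \<longleftrightarrow> psd S l"
  using assms psd_cong_imp[of S l k] psd_cong_imp[of S k l] by auto

lemma quadratic_form_sum_over_larger_set:
  assumes "finite G" "F \<subseteq> G"
  shows "(\<Sum>x\<in>F. \<Sum>y\<in>F. c x * cnj (c y) * (k x y :: complex)) =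
         (\<Sum>x\<in>G. \<Sum>y\<in>G. (if x \<in> F then c x else 0) * cnj (if y \<in> F then c y else 0) * k x y)"
proof -
  let ?d = "\<lambda>x. if x \<in> F then c x else 0"
  have "(\<Sum>x\<in>F. \<Sum>y\<in>F. c x * cnj (c y) * k x y) = (\<Sum>x\<in>F. \<Sum>y\<in>F. ?d x * cnj (?d y) * k x y)"
    by (intro sum.cong refl) auto
  also have "\<dots> = (\<Sum>x\<in>F. \<Sum>y\<in>G. ?d x * cnj (?d y) * k x y)"
    by (intro sum.cong refl sum.mono_neutral_left assms) auto
  also have "\<dots> = (\<Sum>x\<in>G. \<Sum>y\<in>G. ?d x * cnj (?d y) * k x y)"
    by (intro sum.mono_neutral_left assms) auto
  finally show ?thesis .
qed

text \<open>Coefficients may vanish, so it is enough to test finite sets that are large enough, for example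
  product sets.\<close>

lemma psd_cofinalI:
  assumes "\<And>F. finite F \<Longrightarrow> F \<subseteq> S \<Longrightarrow>
     \<exists>G. finite G \<and> F \<subseteq> G \<and> (\<forall>c. 0 \<le> (\<Sum>x\<in>G. \<Sum>y\<in>G. c x * cnj (c y) * k x y))"
  shows "psd S k"
proof (rule psdI)
  fix F :: "'a set" and c :: "'a \<Rightarrow> complex" assume F: "finite F" "F \<subseteq> S"
  obtain G where G: "finite G" "F \<subseteq> G" "\<And>c. 0 \<le> (\<Sum>x\<in>G. \<Sum>y\<in>G. c x * cnj (c y) * k x y)"
    using assms[OF F] by blast
  show "0 \<le> (\<Sum>x\<in>F. \<Sum>y\<in>F. c x * cnj (c y) * k x y)"
    unfolding quadratic_form_sum_over_larger_set[OF G(1,2)] by (rule G(3))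
qed

text \<open>Points that coincide under \<open>g\<close> pool their coefficients, which is why a kernel stays positive
  after repeating points.\<close>

lemma psd_reindex:
  fixes g :: "'b \<Rightarrow> 'a"
  assumes k: "psd S k" and g: "g ` T \<subseteq> S"
  shows "psd T (\<lambda>s t. k (g s) (g t))"
proof (rule psdI)
  fix F and c :: "'b \<Rightarrow> complex" assume F: "finite F" "F \<subseteq> T"
  define d where "d x = (\<Sum>s\<in>{s\<in>F. g s = x}. c s)" for x
  have inner: "(\<Sum>t\<in>F. cnj (c t) * k x (g t)) = (\<Sum>y\<in>g ` F. cnj (d y) * k x y)" for x
  proof -
    have "(\<Sum>t\<in>F. cnj (c t) * k x (g t)) =
        (\<Sum>y\<in>g ` F. \<Sum>t\<in>{t\<in>F. g t = y}. cnj (c t) * k x (g t))"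
      using F by (intro sum.group[symmetric]) auto
    also have "\<dots> = (\<Sum>y\<in>g ` F. cnj (d y) * k x y)"
      unfolding d_def cnj_sum sum_distrib_right by (intro sum.cong refl) auto
    finally show ?thesis .
  qed
  have "(\<Sum>s\<in>F. \<Sum>t\<in>F. c s * cnj (c t) * k (g s) (g t)) =
      (\<Sum>s\<in>F. c s * (\<Sum>t\<in>F. cnj (c t) * k (g s) (g t)))"
    by (simp add: sum_distrib_left mult.assoc)
  also have "\<dots> = (\<Sum>s\<in>F. c s * (\<Sum>y\<in>g ` F. cnj (d y) * k (g s) y))"
    by (simp add: inner)
  also have "\<dots> = (\<Sum>x\<in>g ` F. \<Sum>s\<in>{s\<in>F. g s = x}. c s * (\<Sum>y\<in>g ` F. cnj (d y) * k (g s) y))"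
    using F by (intro sum.group[symmetric]) auto
  also have "\<dots> = (\<Sum>x\<in>g ` F. d x * (\<Sum>y\<in>g ` F. cnj (d y) * k x y))"
    unfolding d_def sum_distrib_right by (intro sum.cong refl) auto
  also have "\<dots> = (\<Sum>x\<in>g ` F. \<Sum>y\<in>g ` F. d x * cnj (d y) * k x y)"
    by (simp add: sum_distrib_left mult.assoc)
  also have "0 \<le> \<dots>" using F g by (intro psdD[OF k]) auto
  finally show "0 \<le> (\<Sum>s\<in>F. \<Sum>t\<in>F. c s * cnj (c t) * k (g s) (g t))" .
qed

lemma psd_add:
  assumes "psd S k" "psd S l" shows "psd S (\<lambda>x y. k x y + l x y)"
proof (rule psdI)
  fix F c assume F: "finite F" "F \<subseteq> S"
  have "(\<Sum>x\<in>F. \<Sum>y\<in>F. c x * cnj (c y) * (k x y + l x y)) =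
    (\<Sum>x\<in>F. \<Sum>y\<in>F. c x * cnj (c y) * k x y) + (\<Sum>x\<in>F. \<Sum>y\<in>F. c x * cnj (c y) * l x y)"
    by (simp add: algebra_simps sum.distrib)
  also have "0 \<le> \<dots>" by (intro add_nonneg_nonneg psdD[OF assms(1) F] psdD[OF assms(2) F])
  finally show "0 \<le> (\<Sum>x\<in>F. \<Sum>y\<in>F. c x * cnj (c y) * (k x y + l x y))" .
qed

lemma psd_zero: "psd S (\<lambda>x y. 0)"
  by (rule psdI) simp

lemma psd_sum:
  assumes "\<And>i. i \<in> I \<Longrightarrow> psd S (k i)" shows "psd S (\<lambda>x y. \<Sum>i\<in>I. k i x y)"
proof (cases "finite I")
  case True
  then show ?thesis using assms
    by (induction I rule: finite_induct) (auto simp: psd_zero intro!: psd_add)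
qed (simp add: psd_zero)

lemma psd_rescale:
  assumes k: "psd S k" shows "psd S (\<lambda>x y. f x * cnj (f y) * k x y)"
proof (rule psdI)
  fix F c assume F: "finite F" "F \<subseteq> S"
  have "(\<Sum>x\<in>F. \<Sum>y\<in>F. c x * cnj (c y) * (f x * cnj (f y) * k x y)) =
    (\<Sum>x\<in>F. \<Sum>y\<in>F. (c x * f x) * cnj (c y * f y) * k x y)"
    by (intro sum.cong refl) (simp add: algebra_simps)
  also have "0 \<le> \<dots>" using psdD[OF k F, of "\<lambda>x. c x * f x"] .
  finally show "0 \<le> (\<Sum>x\<in>F. \<Sum>y\<in>F. c x * cnj (c y) * (f x * cnj (f y) * k x y))" .
qed

lemma complex_mult_cnj_nonneg: "0 \<le> z * cnj z" for z :: complex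
  by (simp add: complex_mult_cnj less_eq_complex_def)

lemma quadratic_form_minus_rank_one:
  "(\<Sum>x\<in>F. \<Sum>y\<in>F. c x * cnj (c y) * (a * k x y - f x * cnj (f y))) =
   a * (\<Sum>x\<in>F. \<Sum>y\<in>F. c x * cnj (c y) * k x y) - of_real ((cmod (\<Sum>x\<in>F. c x * f x))\<^sup>2)"
proof -
  have sq: "(\<Sum>x\<in>F. \<Sum>y\<in>F. (c x * f x) * cnj (c y * f y)) = of_real ((cmod (\<Sum>x\<in>F. c x * f x))\<^sup>2)"
    unfolding complex_norm_square cnj_sum by (rule sum_product[symmetric])
  have "(\<Sum>x\<in>F. \<Sum>y\<in>F. c x * cnj (c y) * (a * k x y - f x * cnj (f y))) =
    (\<Sum>x\<in>F. \<Sum>y\<in>F. a * (c x * cnj (c y) * k x y) - (c x * f x) * cnj (c y * f y))"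
    by (intro sum.cong refl) (simp add: algebra_simps)
  then show ?thesis unfolding sum_subtractf sq sum_distrib_left .
qed

lemma psd_const: assumes "0 \<le> a" shows "psd S (\<lambda>x y. a)"
proof (rule psdI)
  fix F :: "'a set" and c
  have "(\<Sum>x\<in>F. \<Sum>y\<in>F. c x * cnj (c y) * a) = (\<Sum>x\<in>F. c x) * cnj (\<Sum>x\<in>F. c x) * a"
    unfolding cnj_sum sum_product unfolding sum_distrib_right ..
  also have "0 \<le> \<dots>" by (intro mult_nonneg_nonneg assms complex_mult_cnj_nonneg)
  finally show "0 \<le> (\<Sum>x\<in>F. \<Sum>y\<in>F. c x * cnj (c y) * a)" .
qed

lemma psd_rank_one: "psd S (\<lambda>x y. f x * cnj (f y))"
  using psd_rescale[OF psd_const[of 1 S], of f] by (simp add: less_eq_complex_def)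

lemma psd_scale:
  assumes "psd S k" "0 \<le> (a::real)" shows "psd S (\<lambda>x y. of_real a * k x y)"
proof -
  have "of_real (sqrt a) * cnj (of_real (sqrt a)) = (of_real a :: complex)"
    using assms(2) by (simp flip: of_real_mult)
  then show ?thesis using psd_rescale[OF assms(1), of "\<lambda>_. of_real (sqrt a)"] by simp
qed

lemma complex_nonneg_limit:
  fixes f :: "nat \<Rightarrow> complex"
  assumes "f \<longlonglongrightarrow> l" "\<And>n. 0 \<le> f n" shows "0 \<le> l"
proof -
  have "(\<lambda>n. Im (f n)) \<longlonglongrightarrow> Im l" "(\<lambda>n. Im (f n)) = (\<lambda>n. 0)"
    using tendsto_Im[OF assms(1)] assms(2) by (auto simp: less_eq_complex_def)
  moreover have "0 \<le> Re l"
    using tendsto_Re[OF assms(1)] by (rule LIMSEQ_le_const) (use assms(2) in \<open>auto simp: less_eq_complex_def\<close>)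
  ultimately show ?thesis by (simp add: less_eq_complex_def LIMSEQ_const_iff)
qed

lemma psd_limit:
  assumes "\<And>n. psd S (k n)" and lim: "\<And>x y. x \<in> S \<Longrightarrow> y \<in> S \<Longrightarrow> (\<lambda>n. k n x y) \<longlonglongrightarrow> l x y"
  shows "psd S l"
proof (rule psdI)
  fix F c assume F: "finite F" "F \<subseteq> S"
  let ?q = "\<lambda>k. \<Sum>x\<in>F. \<Sum>y\<in>F. c x * cnj (c y) * (k x y :: complex)"
  have l: "(\<lambda>n. ?q (k n)) \<longlonglongrightarrow> ?q l"
    using F by (intro tendsto_sum tendsto_mult tendsto_const lim) auto
  have q: "0 \<le> ?q (k n)" for n by (rule psdD[OF assms(1) F])
  show "0 \<le> ?q l" using l q by (rule complex_nonneg_limit)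
qed

text \<open>The kernel of a family of finite linear combinations of the vectors behind \<open>k\<close>: the \<open>s\<close>-th
  combination has coefficients \<open>A s i\<close> on the vectors at \<open>g s i\<close>.\<close>

lemma psd_combination:
  assumes k: "psd S k" and I: "finite I" and g: "\<And>s i. s \<in> T \<Longrightarrow> i \<in> I \<Longrightarrow> g s i \<in> S"
  shows "psd T (\<lambda>s t. \<Sum>i\<in>I. \<Sum>j\<in>I. A s i * cnj (A t j) * k (g s i) (g t j))"
proof (rule psdI)
  fix F c assume F: "finite F" "F \<subseteq> T"
  have k': "psd (F \<times> I) (\<lambda>p q. k (g (fst p) (snd p)) (g (fst q) (snd q)))"
    using F g by (intro psd_reindex[OF k]) auto
  have "(\<Sum>s\<in>F. \<Sum>t\<in>F. c s * cnj (c t) *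
            (\<Sum>i\<in>I. \<Sum>j\<in>I. A s i * cnj (A t j) * k (g s i) (g t j))) =
    (\<Sum>s\<in>F. \<Sum>t\<in>F. \<Sum>i\<in>I. \<Sum>j\<in>I. (c s * A s i) * cnj (c t * A t j) * k (g s i) (g t j))"
    unfolding sum_distrib_left by (intro sum.cong refl) (simp add: algebra_simps)
  also have "\<dots> = (\<Sum>s\<in>F. \<Sum>i\<in>I. \<Sum>t\<in>F. \<Sum>j\<in>I.
      (c s * A s i) * cnj (c t * A t j) * k (g s i) (g t j))"
    by (intro sum.cong refl sum.swap)
  also have "\<dots> = (\<Sum>p\<in>F\<times>I. \<Sum>q\<in>F\<times>I. (c (fst p) * A (fst p) (snd p)) *
      cnj (c (fst q) * A (fst q) (snd q)) * k (g (fst p) (snd p)) (g (fst q) (snd q)))"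
    unfolding sum.cartesian_product' by (simp only: fst_conv snd_conv)
  also have "0 \<le> \<dots>"
    using F I psdD[OF k', of "F \<times> I" "\<lambda>p. c (fst p) * A (fst p) (snd p)"] by simp
  finally show "0 \<le> (\<Sum>s\<in>F. \<Sum>t\<in>F. c s * cnj (c t) *
            (\<Sum>i\<in>I. \<Sum>j\<in>I. A s i * cnj (A t j) * k (g s i) (g t j)))" .
qed

lemma psd_diagonal_nonneg:
  assumes "psd S k" "x \<in> S" shows "0 \<le> k x x"
  using psdD[OF assms(1), of "{x}" "\<lambda>_. 1"] assms(2) by simp

lemma psd_diagonal_real:
  assumes "psd S k" "x \<in> S" shows "k x x = of_real (Re (k x x))" "0 \<le> Re (k x x)"
  using psd_diagonal_nonneg[OF assms] by (auto simp: less_eq_complex_def complex_eq_iff)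

lemma psd_two_points:
  assumes "psd S k" "x \<in> S" "y \<in> S"
  shows "0 \<le> a * cnj a * k x x + a * cnj b * k x y + b * cnj a * k y x + b * cnj b * k y y"
proof -
  let ?z = "\<lambda>i::bool. if i then x else y" and ?c = "\<lambda>i. if i then a else b"
  have "psd UNIV (\<lambda>i j. k (?z i) (?z j))"
    by (rule psd_reindex[OF assms(1)]) (use assms in auto)
  from psdD[OF this, of UNIV ?c] show ?thesis
    by (simp add: UNIV_bool algebra_simps)
qed

lemma psd_hermitian:
  assumes "psd S k" "x \<in> S" "y \<in> S"
  shows "k y x = cnj (k x y)"
proof -
  note d = psd_diagonal_nonneg[OF assms(1,2)] psd_diagonal_nonneg[OF assms(1,3)]
  have "Im (k x y + k y x) = 0"
    using psd_two_points[OF assms, of 1 1] d by (auto simp: less_eq_complex_def)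
  moreover have "Re (k y x) = Re (k x y)"
    using psd_two_points[OF assms, of \<i> 1] d by (auto simp: less_eq_complex_def)
  ultimately show ?thesis by (auto simp: complex_eq_iff)
qed

text \<open>The discriminant argument for the quadratic form at \<open>-t cnj (k x y)\<close> and \<open>1\<close> with \<open>t\<close> real.\<close>

lemma psd_Cauchy_Schwarz:
  assumes "psd S k" "x \<in> S" "y \<in> S"
  shows "(cmod (k x y))\<^sup>2 \<le> Re (k x x) * Re (k y y)"
proof -
  define A where "A = Re (k x x)"
  define D where "D = Re (k y y)"
  define z where "z = k x y"
  have h: "k y x = cnj z" "k x x = of_real A" "k y y = of_real D" "0 \<le> A" "0 \<le> D"
    using psd_hermitian[OF assms] psd_diagonal_real[OF assms(1)] assms
    by (auto simp: z_def A_def D_def)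
  have zz': "z * cnj z = (of_real (cmod z))\<^sup>2" by (metis complex_norm_square of_real_power)
  have form: "0 \<le> t\<^sup>2 * (cmod z)\<^sup>2 * A - 2 * t * (cmod z)\<^sup>2 + D" for t :: real
  proof -
    have "0 \<le> (of_real (-t) * cnj z) * cnj (of_real (-t) * cnj z) * of_real A +
       (of_real (-t) * cnj z) * cnj 1 * z + 1 * cnj (of_real (-t) * cnj z) * cnj z + 1 * cnj 1 * of_real D"
      using psd_two_points[OF assms, of "of_real (-t) * cnj z" 1] unfolding h z_def[symmetric] .
    also have "\<dots> = of_real (t\<^sup>2 * (cmod z)\<^sup>2 * A - 2 * t * (cmod z)\<^sup>2 + D)"
      unfolding of_real_add of_real_diff of_real_mult of_real_power zz'[symmetric] of_real_numeral
      by (simp add: power2_eq_square algebra_simps)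
    finally show ?thesis by (simp add: less_eq_complex_def)
  qed
  show ?thesis
  proof (cases "A = 0")
    case True
    have "z = 0"
    proof (rule ccontr)
      assume "z \<noteq> 0"
      then have "0 < (cmod z)\<^sup>2" by simp
      then show False
        using form[of "(D + 1) / (2 * (cmod z)\<^sup>2)"] True by simp
    qed
    then show ?thesis using h(4,5) by (simp add: z_def[symmetric] A_def[symmetric] D_def[symmetric])
  next
    case False
    then have "0 < A" using h(4) by simp
    then show ?thesis using form[of "1 / A"]
      by (simp add: z_def[symmetric] A_def[symmetric] D_def[symmetric] field_simps power2_eq_square)
  qed
qed

text \<open>The Gram kernel of the vectors projected onto the orthogonal complement of the vector at \<open>a\<close>.\<close>

lemma psd_Schur_complement:
  assumes k: "psd S k" and a: "a \<in> S" "k a a \<noteq> 0"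
  shows "psd S (\<lambda>x y. k x y - k x a * k a y / k a a)"
proof -
  define d where "d = k a a"
  have dr: "cnj d = d" "d \<noteq> 0" using psd_hermitian[OF k a(1) a(1)] a(2) by (auto simp: d_def)
  define A where "A x i = (if i then 1 else - k x a / d)" for x i
  have "psd S (\<lambda>x y. \<Sum>i\<in>UNIV. \<Sum>j\<in>UNIV. A x i * cnj (A y j) * k (if i then x else a) (if j then y else a))"
    using a by (intro psd_combination[OF k]) auto
  also have "?this \<longleftrightarrow> ?thesis"
  proof (rule psd_cong)
    fix x y assume xy: "x \<in> S" "y \<in> S"
    have e: "cnj (k y a) = k a y" using psd_hermitian[OF k xy(2) a(1)] by simp
    have "k a a * (k x a * k a y) / (d * d) = k x a * k a y / d" using dr by (simp add: d_def)
    then show "(\<Sum>i\<in>UNIV. \<Sum>j\<in>UNIV. A x i * cnj (A y j) * k (if i then x else a) (if j then y else a)) =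
       k x y - k x a * k a y / k a a"
      using dr(2) unfolding A_def UNIV_bool
      by (simp add: e dr(1) d_def[symmetric] algebra_simps)
  qed
  finally show ?thesis .
qed

text \<open>Cholesky decomposition: splitting off the rank one kernel of one point leaves its Schur complement,
  which lives on the remaining points.\<close>

lemma psd_finite_Gram:
  assumes "finite F" "psd F k"
  shows "\<exists>(m::nat) v. \<forall>x\<in>F. \<forall>y\<in>F. k x y = (\<Sum>i<m. v i x * cnj (v i y))"
  using assms
proof (induction F arbitrary: k rule: finite_induct)
  case empty
  then show ?case by auto
next
  case (insert a F)
  let ?S = "insert a F"
  define u where "u x = k x a / of_real (sqrt (Re (k a a)))" for x
  define l where "l x y = k x y - u x * cnj (u y)" for x y
  have aS: "a \<in> ?S" by simp
  note dr = psd_diagonal_real[OF insert.prems aS]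
  have "psd ?S l \<and> (\<forall>x\<in>?S. l x a = 0 \<and> l a x = 0)"
  proof (cases "k a a = 0")
    case True
    have "k x a = 0" if "x \<in> ?S" for x
      using psd_Cauchy_Schwarz[OF insert.prems that aS] True by simp
    moreover from this have "k a x = 0" if "x \<in> ?S" for x
      using psd_hermitian[OF insert.prems that aS] that by simp
    moreover have "l = k" by (auto simp: l_def u_def True fun_eq_iff)
    ultimately show ?thesis using insert.prems by auto
  next
    case False
    have e: "u x * cnj (u y) = k x a * k a y / k a a" if "x \<in> ?S" "y \<in> ?S" for x y
    proof -
      have "complex_of_real (sqrt (Re (k a a))) * of_real (sqrt (Re (k a a))) = k a a"
        using dr by (simp flip: of_real_mult)
      then show ?thesis
        using psd_hermitian[OF insert.prems that(2) aS] by (simp add: u_def)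
    qed
    have "psd ?S l \<longleftrightarrow> psd ?S (\<lambda>x y. k x y - k x a * k a y / k a a)"
      by (intro psd_cong) (simp add: l_def e)
    then have "psd ?S l" using psd_Schur_complement[OF insert.prems aS False] by simp
    moreover have "l x a = 0 \<and> l a x = 0" if "x \<in> ?S" for x
      using that aS False by (simp only: l_def e) simp
    ultimately show ?thesis by blast
  qed
  then have l: "psd ?S l" "\<And>x. x \<in> ?S \<Longrightarrow> l x a = 0" "\<And>x. x \<in> ?S \<Longrightarrow> l a x = 0" by blast+
  obtain m :: nat and v where mv: "\<And>x y. x \<in> F \<Longrightarrow> y \<in> F \<Longrightarrow> l x y = (\<Sum>i<m. v i x * cnj (v i y))"
    using insert.IH[OF psd_subset[OF l(1) subset_insertI]] by blast
  define w where "w i x = (if i = m then u x else if x = a then 0 else v i x)" for i x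
  have "k x y = (\<Sum>i<Suc m. w i x * cnj (w i y))" if xy: "x \<in> ?S" "y \<in> ?S" for x y
  proof -
    have "l x y = (\<Sum>i<m. w i x * cnj (w i y))"
    proof (cases "x = a \<or> y = a")
      case True
      then have "l x y = 0" using l(2)[OF xy(1)] l(3)[OF xy(2)] by metis
      moreover have "(\<Sum>i<m. w i x * cnj (w i y)) = 0"
        using True by (intro sum.neutral) (auto simp: w_def)
      ultimately show ?thesis by simp
    next
      case False
      then have "l x y = (\<Sum>i<m. v i x * cnj (v i y))" using xy by (intro mv) auto
      also have "\<dots> = (\<Sum>i<m. w i x * cnj (w i y))"
        using False by (intro sum.cong refl) (auto simp: w_def)
      finally show ?thesis .
    qed
    moreover have "k x y = l x y + w m x * cnj (w m y)" by (simp add: l_def w_def)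
    ultimately show ?thesis by simp
  qed
  then show ?case by blast
qed

text \<open>The Schur product theorem: a finite Gram decomposition of one factor exhibits the product as a sum of
  rescalings of the other.\<close>

lemma psd_mult:
  assumes k: "psd S k" and l: "psd S l"
  shows "psd S (\<lambda>x y. k x y * l x y)"
proof (rule psdI)
  fix F c assume F: "finite F" "F \<subseteq> S"
  obtain m v where mv: "\<And>x y. x \<in> F \<Longrightarrow> y \<in> F \<Longrightarrow> k x y = (\<Sum>i<(m::nat). v i x * cnj (v i y))"
    using psd_finite_Gram[OF F(1) psd_subset[OF k F(2)]] by blast
  have "psd F (\<lambda>x y. \<Sum>i<m. v i x * cnj (v i y) * l x y)"
    by (intro psd_sum psd_rescale psd_subset[OF l F(2)])
  moreover have "k x y * l x y = (\<Sum>i<m. v i x * cnj (v i y) * l x y)" if "x \<in> F" "y \<in> F" for x y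
    unfolding mv[OF that] sum_distrib_right ..
  ultimately have "psd F (\<lambda>x y. k x y * l x y)"
    using psd_cong[of F "\<lambda>x y. k x y * l x y"] by simp
  from psdD[OF this F(1)] show "0 \<le> (\<Sum>x\<in>F. \<Sum>y\<in>F. c x * cnj (c y) * (k x y * l x y))" by simp
qed

lemma psd_power: "psd S k \<Longrightarrow> psd S (\<lambda>x y. k x y ^ n)"
  by (induction n) (auto intro: psd_mult psd_const[of 1] simp: less_eq_complex_def)

lemma psd_less_one:
  assumes "psd S k" "\<And>x. x \<in> S \<Longrightarrow> Re (k x x) < 1" "x \<in> S" "y \<in> S"
  shows "cmod (k x y) < 1"
proof -
  have "(cmod (k x y))\<^sup>2 \<le> Re (k x x) * Re (k y y)" by (rule psd_Cauchy_Schwarz[OF assms(1,3,4)])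
  also have "\<dots> \<le> Re (k x x) * 1"
    using assms(2)[OF assms(4)] psd_diagonal_real(2)[OF assms(1,3)] by (intro mult_left_mono) auto
  also have "\<dots> < 1" using assms(2)[OF assms(3)] by simp
  finally show ?thesis by (simp add: power_less_one_iff)
qed

lemma psd_geometric:
  assumes "psd S k" "\<And>x. x \<in> S \<Longrightarrow> Re (k x x) < 1"
  shows "psd S (\<lambda>x y. 1 / (1 - k x y))"
proof (rule psd_limit)
  show "psd S (\<lambda>x y. \<Sum>i<n. k x y ^ i)" for n
    by (intro psd_sum psd_power assms)
  show "(\<lambda>n. \<Sum>i<n. k x y ^ i) \<longlonglongrightarrow> 1 / (1 - k x y)" if "x \<in> S" "y \<in> S" for x y
    using geometric_sums[OF psd_less_one[OF assms that]] by (simp add: sums_def)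
qed

lemma mat_quadratic_form:
  assumes "v \<in> carrier_vec n"
  shows "(mat n n f *\<^sub>v v) \<bullet>c v = (\<Sum>i<n. \<Sum>j<n. cnj (v $ i) * (v $ j) * f (i, j))"
proof -
  have "(mat n n f *\<^sub>v v) \<bullet>c v = (\<Sum>i<n. (\<Sum>j<n. f (i, j) * v $ j) * cnj (v $ i))"
    using assms by (auto simp: scalar_prod_def lessThan_atLeast0 intro!: sum.cong)
  also have "\<dots> = (\<Sum>i<n. \<Sum>j<n. cnj (v $ i) * (v $ j) * f (i, j))"
    by (simp add: sum_distrib_right sum_distrib_left algebra_simps)
  finally show ?thesis .
qed

lemma pos_semidef_iff_psd: "pos_semidef (mat n n f) \<longleftrightarrow> psd {..<n} (\<lambda>i j. f (i, j))"
proof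
  assume A: "pos_semidef (mat n n f)"
  show "psd {..<n} (\<lambda>i j. f (i, j))"
  proof (rule psd_cofinalI)
    fix F :: "nat set" assume "finite F" "F \<subseteq> {..<n}"
    moreover have "0 \<le> (\<Sum>x<n. \<Sum>y<n. c x * cnj (c y) * f (x, y))" for c
    proof -
      have v: "vec n (\<lambda>i. cnj (c i)) \<in> carrier_vec n" by simp
      then have "0 \<le> (mat n n f *\<^sub>v vec n (\<lambda>i. cnj (c i))) \<bullet>c vec n (\<lambda>i. cnj (c i))"
        using A unfolding pos_semidef_def by auto
      also have "\<dots> = (\<Sum>x<n. \<Sum>y<n. c x * cnj (c y) * f (x, y))"
        unfolding mat_quadratic_form[OF v] by (intro sum.cong refl) simp
      finally show ?thesis .
    qed
    ultimately show "\<exists>G. finite G \<and> F \<subseteq> G \<and>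
        (\<forall>c. 0 \<le> (\<Sum>x\<in>G. \<Sum>y\<in>G. c x * cnj (c y) * f (x, y)))"
      by blast
  qed
next
  assume A: "psd {..<n} (\<lambda>i j. f (i, j))"
  have "0 \<le> (mat n n f *\<^sub>v v) \<bullet>c v" if "v \<in> carrier_vec n" for v
    using psdD[OF A, of "{..<n}" "\<lambda>i. cnj (v $ i)"] unfolding mat_quadratic_form[OF that] by simp
  then show "pos_semidef (mat n n f)" unfolding pos_semidef_def by auto
qed

lemma kernel_on_iff_psd: "kernel_on X k \<longleftrightarrow> X \<noteq> {} \<and> psd X k"
proof
  assume k: "kernel_on X k"
  have "psd X k"
  proof (rule psdI)
    fix F c assume F: "finite F" "F \<subseteq> X"
    show "0 \<le> (\<Sum>x\<in>F. \<Sum>y\<in>F. c x * cnj (c y) * k x y)"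
    proof (cases "F = {}")
      case False
      obtain z where z: "bij_betw z {..<card F} F"
        using ex_bij_betw_nat_finite[OF F(1)] by (auto simp: lessThan_atLeast0)
      have "1 \<le> card F" using F False by (simp add: Suc_le_eq card_gt_0_iff)
      moreover have "\<forall>i<card F. z i \<in> X" using z F by (auto simp: bij_betw_def)
      ultimately have "psd {..<card F} (\<lambda>i j. k (z i) (z j))"
        using k unfolding kernel_on_def pos_semidef_iff_psd by auto
      from psdD[OF this, of "{..<card F}" "\<lambda>i. c (z i)"]
      have "0 \<le> (\<Sum>i<card F. \<Sum>j<card F. c (z i) * cnj (c (z j)) * k (z i) (z j))" by simp
      also have "\<dots> = (\<Sum>i<card F. \<Sum>y\<in>F. c (z i) * cnj (c y) * k (z i) y)"
        by (intro sum.cong refl sum.reindex_bij_betw[OF z])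
      also have "\<dots> = (\<Sum>x\<in>F. \<Sum>y\<in>F. c x * cnj (c y) * k x y)"
        by (rule sum.reindex_bij_betw[OF z])
      finally show ?thesis .
    qed simp
  qed
  then show "X \<noteq> {} \<and> psd X k" using k by (auto simp: kernel_on_def)
next
  assume A: "X \<noteq> {} \<and> psd X k"
  have "psd {..<n} (\<lambda>i j. k (z i) (z j))" if "\<forall>i<n. z i \<in> X" for n :: nat and z
    using psd_reindex[of X k z "{..<n}"] A that by auto
  then show "kernel_on X k" using A unfolding kernel_on_def pos_semidef_iff_psd by simp
qed

section \<open>Semi-inner products on spaces of functions\<close>

lemma tendsto_zero_norm_le:
  fixes f :: "nat \<Rightarrow> 'b::real_normed_vector"
  assumes "\<And>n. norm (f n) \<le> g n" "g \<longlonglongrightarrow> (0::real)"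
  shows "f \<longlonglongrightarrow> 0"
  using assms by (intro Lim_null_comparison[OF _ assms(2)] always_eventually) auto

text \<open>Definiteness is left out: the pairing on finite combinations of kernel functions is first known only
  to be nonnegative, and its definiteness is a consequence of the Cauchy--Schwarz inequality.\<close>

locale semi_inner_product =
  fixes H :: "('a \<Rightarrow> complex) set" and ip :: "('a \<Rightarrow> complex) \<Rightarrow> ('a \<Rightarrow> complex) \<Rightarrow> complex"
  assumes zero_mem: "(\<lambda>x. 0) \<in> H"
    and add_mem: "f \<in> H \<Longrightarrow> g \<in> H \<Longrightarrow> (\<lambda>x. f x + g x) \<in> H"
    and scale_mem: "f \<in> H \<Longrightarrow> (\<lambda>x. a * f x) \<in> H"
    and add_left: "f \<in> H \<Longrightarrow> g \<in> H \<Longrightarrow> h \<in> H \<Longrightarrow> ip (\<lambda>x. f x + g x) h = ip f h + ip g h"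
    and scale_left: "f \<in> H \<Longrightarrow> g \<in> H \<Longrightarrow> ip (\<lambda>x. a * f x) g = a * ip f g"
    and commute: "f \<in> H \<Longrightarrow> g \<in> H \<Longrightarrow> ip g f = cnj (ip f g)"
    and nonneg: "f \<in> H \<Longrightarrow> 0 \<le> ip f f"
begin

abbreviation nm where "nm \<equiv> norm_of ip"

lemma add_right:
  assumes "f \<in> H" "g \<in> H" "h \<in> H" shows "ip h (\<lambda>x. f x + g x) = ip h f + ip h g"
proof -
  have "ip h (\<lambda>x. f x + g x) = cnj (ip (\<lambda>x. f x + g x) h)"
    using assms by (intro commute add_mem)
  also have "\<dots> = cnj (ip f h) + cnj (ip g h)" using assms by (simp add: add_left)
  also have "\<dots> = ip h f + ip h g" using assms commute by metis
  finally show ?thesis .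
qed

lemma scale_right:
  assumes "f \<in> H" "g \<in> H" shows "ip g (\<lambda>x. a * f x) = cnj a * ip g f"
proof -
  have "ip g (\<lambda>x. a * f x) = cnj (ip (\<lambda>x. a * f x) g)" using assms by (intro commute scale_mem)
  also have "\<dots> = cnj a * cnj (ip f g)" using assms by (simp add: scale_left)
  also have "\<dots> = cnj a * ip g f" using assms commute[of f g] by simp
  finally show ?thesis .
qed

lemma diff_mem:
  assumes "f \<in> H" "g \<in> H" shows "(\<lambda>x. f x - g x) \<in> H"
  using add_mem[OF assms(1) scale_mem[OF assms(2), of "-1"]] by simp

lemma diff_left:
  assumes "f \<in> H" "g \<in> H" "h \<in> H" shows "ip (\<lambda>x. f x - g x) h = ip f h - ip g h"
  using add_left[OF assms(1) scale_mem[OF assms(2), of "-1"] assms(3)]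
    scale_left[OF assms(2,3), of "-1"] by simp

lemma diff_right:
  assumes "f \<in> H" "g \<in> H" "h \<in> H" shows "ip h (\<lambda>x. f x - g x) = ip h f - ip h g"
  using add_right[OF assms(1) scale_mem[OF assms(2), of "-1"] assms(3)]
    scale_right[OF assms(2,3), of "-1"] by simp

lemma sum_mem:
  assumes "\<And>i. i \<in> I \<Longrightarrow> f i \<in> H" shows "(\<lambda>x. \<Sum>i\<in>I. f i x) \<in> H"
proof (cases "finite I")
  case True then show ?thesis using assms
    by (induction I rule: finite_induct) (auto simp: zero_mem intro!: add_mem)
qed (simp add: zero_mem)

lemma zero_left: "g \<in> H \<Longrightarrow> ip (\<lambda>x. 0) g = 0"
  using scale_left[OF zero_mem, of g 0] by simp

lemma sum_left:
  assumes "\<And>i. i \<in> I \<Longrightarrow> f i \<in> H" "g \<in> H"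
  shows "ip (\<lambda>x. \<Sum>i\<in>I. f i x) g = (\<Sum>i\<in>I. ip (f i) g)"
proof (cases "finite I")
  case True then show ?thesis using assms(1)
  proof (induction I rule: finite_induct)
    case (insert i I)
    have "ip (\<lambda>x. f i x + (\<Sum>i\<in>I. f i x)) g = ip (f i) g + ip (\<lambda>x. \<Sum>i\<in>I. f i x) g"
      using insert.prems assms(2) by (intro add_left sum_mem) auto
    then show ?case using insert by simp
  qed (simp add: zero_left assms)
qed (simp add: zero_left assms)

lemma sum_right:
  assumes "\<And>i. i \<in> I \<Longrightarrow> f i \<in> H" "g \<in> H"
  shows "ip g (\<lambda>x. \<Sum>i\<in>I. f i x) = (\<Sum>i\<in>I. ip g (f i))"
proof -
  have "ip g (\<lambda>x. \<Sum>i\<in>I. f i x) = cnj (ip (\<lambda>x. \<Sum>i\<in>I. f i x) g)"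
    using assms by (intro commute sum_mem)
  also have "\<dots> = (\<Sum>i\<in>I. cnj (ip (f i) g))"
    by (simp add: sum_left[of I f g, OF assms])
  also have "\<dots> = (\<Sum>i\<in>I. ip g (f i))" using assms commute[of _ g] by (intro sum.cong refl) auto
  finally show ?thesis .
qed

lemma psd_ip: "psd H ip"
proof (rule psdI)
  fix F c assume F: "finite F" "F \<subseteq> H"
  define v where "v = (\<lambda>x. \<Sum>f\<in>F. c f * f x)"
  have m: "(\<lambda>x. c f * f x) \<in> H" if "f \<in> F" for f using F that by (intro scale_mem) auto
  have v: "v \<in> H" unfolding v_def by (intro sum_mem m)
  have "ip v v = (\<Sum>f\<in>F. ip (\<lambda>x. c f * f x) v)"
    using sum_left[of F "\<lambda>f x. c f * f x" v] m v by (simp add: v_def)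
  also have "\<dots> = (\<Sum>f\<in>F. c f * ip f v)"
    using F v by (intro sum.cong refl scale_left) auto
  also have "\<dots> = (\<Sum>f\<in>F. c f * (\<Sum>g\<in>F. cnj (c g) * ip f g))"
  proof (intro sum.cong refl, goal_cases)
    case (1 f)
    have "ip f v = (\<Sum>g\<in>F. ip f (\<lambda>x. c g * g x))"
      using sum_right[of F "\<lambda>f x. c f * f x" f] m F 1 by (auto simp: v_def)
    also have "\<dots> = (\<Sum>g\<in>F. cnj (c g) * ip f g)"
      using F 1 by (intro sum.cong refl scale_right) auto
    finally show ?case by simp
  qed
  also have "\<dots> = (\<Sum>f\<in>F. \<Sum>g\<in>F. c f * cnj (c g) * ip f g)"
    by (simp add: sum_distrib_left mult.assoc)
  finally show "0 \<le> (\<Sum>f\<in>F. \<Sum>g\<in>F. c f * cnj (c g) * ip f g)" using nonneg[OF v] by simp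
qed

lemma ip_self: assumes "f \<in> H" shows "ip f f = of_real ((nm f)\<^sup>2)" "Re (ip f f) = (nm f)\<^sup>2"
  using nonneg[OF assms] by (auto simp: norm_of_def less_eq_complex_def complex_eq_iff)

lemma nm_nonneg: "f \<in> H \<Longrightarrow> 0 \<le> nm f"
  using nonneg by (simp add: norm_of_def less_eq_complex_def)

lemma Cauchy_Schwarz:
  assumes "f \<in> H" "g \<in> H" shows "cmod (ip f g) \<le> nm f * nm g"
proof (rule power2_le_imp_le)
  show "(cmod (ip f g))\<^sup>2 \<le> (nm f * nm g)\<^sup>2"
    using psd_Cauchy_Schwarz[OF psd_ip assms] by (simp add: ip_self assms power_mult_distrib)
qed (simp add: nm_nonneg assms)

lemma nm_add_square:
  assumes "f \<in> H" "g \<in> H"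
  shows "(nm (\<lambda>x. f x + g x))\<^sup>2 = (nm f)\<^sup>2 + 2 * Re (ip f g) + (nm g)\<^sup>2"
proof -
  have "ip (\<lambda>x. f x + g x) (\<lambda>x. f x + g x) = ip f f + ip f g + ip g f + ip g g"
    unfolding add_left[OF assms add_mem[OF assms]] add_right[OF assms assms(1)] add_right[OF assms assms(2)]
    by (simp only: add.assoc)
  moreover have "Re (ip g f) = Re (ip f g)" using commute[OF assms] by simp
  ultimately show ?thesis
    unfolding ip_self(2)[OF assms(1), symmetric] ip_self(2)[OF assms(2), symmetric]
      ip_self(2)[OF add_mem[OF assms], symmetric] by simp
qed

lemma triangle:
  assumes "f \<in> H" "g \<in> H" shows "nm (\<lambda>x. f x + g x) \<le> nm f + nm g"
proof (rule power2_le_imp_le)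
  have "(nm (\<lambda>x. f x + g x))\<^sup>2 \<le> (nm f)\<^sup>2 + 2 * (nm f * nm g) + (nm g)\<^sup>2"
    using nm_add_square[OF assms] Cauchy_Schwarz[OF assms] complex_Re_le_cmod[of "ip f g"] by linarith
  also have "\<dots> = (nm f + nm g)\<^sup>2" by (simp add: power2_eq_square algebra_simps)
  finally show "(nm (\<lambda>x. f x + g x))\<^sup>2 \<le> (nm f + nm g)\<^sup>2" .
qed (simp add: nm_nonneg assms)

lemma nm_scale: assumes "f \<in> H" shows "nm (\<lambda>x. a * f x) = cmod a * nm f"
proof -
  have "(nm (\<lambda>x. a * f x))\<^sup>2 = Re ((a * cnj a) * ip f f)"
    using assms by (simp add: ip_self(2)[symmetric] scale_mem scale_left scale_right mult.assoc)
  also have "\<dots> = Re (of_real ((cmod a)\<^sup>2 * (nm f)\<^sup>2))"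
    by (simp only: complex_norm_square[symmetric] ip_self(1)[OF assms] of_real_mult of_real_power)
  also have "\<dots> = (cmod a * nm f)\<^sup>2" by (simp add: power_mult_distrib)
  finally show ?thesis using nm_nonneg[OF scale_mem[OF assms]] nm_nonneg[OF assms]
    by (meson power2_eq_imp_eq mult_nonneg_nonneg norm_ge_zero)
qed

lemma nm_diff_square:
  assumes "f \<in> H" "g \<in> H"
  shows "(nm (\<lambda>x. f x - g x))\<^sup>2 = (nm f)\<^sup>2 - 2 * Re (ip f g) + (nm g)\<^sup>2"
  using nm_add_square[OF assms(1) scale_mem[OF assms(2), of "-1"]]
    nm_scale[OF assms(2), of "-1"] scale_right[OF assms(2,1), of "-1"] by simp

lemma nm_diff_commute:
  assumes "f \<in> H" "g \<in> H" shows "nm (\<lambda>x. f x - g x) = nm (\<lambda>x. g x - f x)"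
  using nm_scale[OF diff_mem[OF assms], of "-1"] by simp

lemma triangle_diff:
  assumes "f \<in> H" "g \<in> H" "h \<in> H"
  shows "nm (\<lambda>x. f x - h x) \<le> nm (\<lambda>x. f x - g x) + nm (\<lambda>x. g x - h x)"
  using triangle[OF diff_mem[OF assms(1,2)] diff_mem[OF assms(2,3)]] by simp

lemma nm_le_diff:
  assumes "f \<in> H" "g \<in> H" shows "nm f \<le> nm (\<lambda>x. f x - g x) + nm g"
  using triangle[OF diff_mem[OF assms] assms(2)] by simp

definition cauchy :: "(nat \<Rightarrow> 'a \<Rightarrow> complex) \<Rightarrow> bool" where
  "cauchy \<sigma> \<longleftrightarrow> (\<forall>n. \<sigma> n \<in> H) \<and>
     (\<forall>e>0. \<exists>M. \<forall>m\<ge>M. \<forall>n\<ge>M. nm (\<lambda>x. \<sigma> m x - \<sigma> n x) < e)"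

lemma cauchy_mem: "cauchy \<sigma> \<Longrightarrow> \<sigma> n \<in> H"
  unfolding cauchy_def by blast

lemma cauchyE:
  assumes "cauchy \<sigma>" "0 < e"
  obtains M where "\<And>m n. m \<ge> M \<Longrightarrow> n \<ge> M \<Longrightarrow> nm (\<lambda>x. \<sigma> m x - \<sigma> n x) < e"
  using assms unfolding cauchy_def by blast

lemma cauchy_bounded:
  assumes "cauchy \<sigma>" shows "\<exists>K>0. \<forall>n. nm (\<sigma> n) \<le> K"
proof -
  obtain M where M: "\<And>m n. m \<ge> M \<Longrightarrow> n \<ge> M \<Longrightarrow> nm (\<lambda>x. \<sigma> m x - \<sigma> n x) < 1"
    using cauchyE[OF assms, of 1] by auto
  define K where "K = 1 + (\<Sum>n\<le>M. nm (\<sigma> n))"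
  have s: "nm (\<sigma> n) \<le> (\<Sum>n\<le>M. nm (\<sigma> n))" if "n \<le> M" for n
    using that by (intro member_le_sum) (auto intro: nm_nonneg cauchy_mem[OF assms])
  have "nm (\<sigma> n) \<le> K" for n
  proof (cases "n \<le> M")
    case True then show ?thesis using s by (fastforce simp: K_def)
  next
    case False
    then show ?thesis
      using nm_le_diff[OF cauchy_mem[OF assms, of n] cauchy_mem[OF assms, of M]] M[of n M] s[of M]
      by (simp add: K_def)
  qed
  moreover have "0 < K"
    unfolding K_def by (intro add_pos_nonneg sum_nonneg nm_nonneg cauchy_mem assms) auto
  ultimately show ?thesis by blast
qed

lemma cauchy_add:
  assumes "cauchy \<sigma>" "cauchy \<tau>" shows "cauchy (\<lambda>n x. \<sigma> n x + \<tau> n x)"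
  unfolding cauchy_def
proof (intro conjI allI impI)
  fix e :: real assume "0 < e"
  then have e: "0 < e / 2" by simp
  obtain M N where MN: "\<And>m n. m \<ge> M \<Longrightarrow> n \<ge> M \<Longrightarrow> nm (\<lambda>x. \<sigma> m x - \<sigma> n x) < e / 2"
    "\<And>m n. m \<ge> N \<Longrightarrow> n \<ge> N \<Longrightarrow> nm (\<lambda>x. \<tau> m x - \<tau> n x) < e / 2"
    using cauchyE[OF assms(1) e] cauchyE[OF assms(2) e] by metis
  have "nm (\<lambda>x. (\<sigma> m x + \<tau> m x) - (\<sigma> n x + \<tau> n x)) < e" if "m \<ge> max M N" "n \<ge> max M N" for m n
    using triangle[OF diff_mem[OF cauchy_mem[OF assms(1), of m] cauchy_mem[OF assms(1), of n]]
        diff_mem[OF cauchy_mem[OF assms(2), of m] cauchy_mem[OF assms(2), of n]]]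
      MN(1)[of m n] MN(2)[of m n] that by (simp add: algebra_simps)
  then show "\<exists>M. \<forall>m\<ge>M. \<forall>n\<ge>M. nm (\<lambda>x. (\<sigma> m x + \<tau> m x) - (\<sigma> n x + \<tau> n x)) < e" by blast
qed (intro add_mem cauchy_mem assms)

lemma cauchy_scale:
  assumes "cauchy \<sigma>" shows "cauchy (\<lambda>n x. a * \<sigma> n x)"
  unfolding cauchy_def
proof (intro conjI allI impI)
  fix e :: real assume e: "0 < e"
  then have "0 < e / (cmod a + 1)" by (simp add: add_nonneg_pos)
  then obtain M where M: "\<And>m n. m \<ge> M \<Longrightarrow> n \<ge> M \<Longrightarrow> nm (\<lambda>x. \<sigma> m x - \<sigma> n x) < e / (cmod a + 1)"
    using cauchyE[OF assms] by metis
  have "nm (\<lambda>x. a * \<sigma> m x - a * \<sigma> n x) < e" if "m \<ge> M" "n \<ge> M" for m n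
  proof -
    let ?d = "\<lambda>x. \<sigma> m x - \<sigma> n x"
    have d: "?d \<in> H" by (intro diff_mem cauchy_mem assms)
    have "nm (\<lambda>x. a * \<sigma> m x - a * \<sigma> n x) = cmod a * nm ?d"
      using nm_scale[OF d, of a] by (simp add: algebra_simps)
    also have "\<dots> \<le> (cmod a + 1) * nm ?d" using nm_nonneg[OF d] by (simp add: algebra_simps)
    also have "\<dots> < e" using M[OF that] by (simp add: pos_less_divide_eq add_nonneg_pos mult.commute)
    finally show ?thesis .
  qed
  then show "\<exists>M. \<forall>m\<ge>M. \<forall>n\<ge>M. nm (\<lambda>x. a * \<sigma> m x - a * \<sigma> n x) < e" by blast
qed (intro scale_mem cauchy_mem assms)

lemma cauchy_diff:
  assumes "cauchy \<sigma>" "cauchy \<tau>" shows "cauchy (\<lambda>n x. \<sigma> n x - \<tau> n x)"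
  using cauchy_add[OF assms(1) cauchy_scale[OF assms(2), of "-1"]] by simp

lemma cauchy_const: assumes "f \<in> H" shows "cauchy (\<lambda>n. f)"
  using assms zero_left[OF zero_mem] by (simp add: cauchy_def norm_of_def)

lemma ip_difference_bound:
  assumes "f \<in> H" "g \<in> H" "f' \<in> H" "g' \<in> H"
  shows "cmod (ip f g - ip f' g') \<le> nm (\<lambda>x. f x - f' x) * nm g + nm f' * nm (\<lambda>x. g x - g' x)"
proof -
  have "ip f g - ip f' g' = ip (\<lambda>x. f x - f' x) g + ip f' (\<lambda>x. g x - g' x)"
    using assms by (simp add: diff_left diff_right)
  then show ?thesis
    using norm_triangle_le[OF add_mono[OF Cauchy_Schwarz[OF diff_mem[OF assms(1,3)] assms(2)]
        Cauchy_Schwarz[OF assms(3) diff_mem[OF assms(2,4)]]]] by simp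
qed

lemma cauchy_ip_convergent:
  assumes "cauchy \<sigma>" "cauchy \<tau>" shows "convergent (\<lambda>n. ip (\<sigma> n) (\<tau> n))"
proof -
  obtain K where K: "K > 0" "\<And>n. nm (\<tau> n) \<le> K" using cauchy_bounded[OF assms(2)] by blast
  obtain L where L: "L > 0" "\<And>n. nm (\<sigma> n) \<le> L" using cauchy_bounded[OF assms(1)] by blast
  have "Cauchy (\<lambda>n. ip (\<sigma> n) (\<tau> n))"
  proof (rule metric_CauchyI)
    fix e :: real assume e: "0 < e"
    obtain M where M: "\<And>m n. m \<ge> M \<Longrightarrow> n \<ge> M \<Longrightarrow> nm (\<lambda>x. \<sigma> m x - \<sigma> n x) < e / (2 * K)"
      using cauchyE[OF assms(1), of "e / (2 * K)"] e K(1) by auto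
    obtain N where N: "\<And>m n. m \<ge> N \<Longrightarrow> n \<ge> N \<Longrightarrow> nm (\<lambda>x. \<tau> m x - \<tau> n x) < e / (2 * L)"
      using cauchyE[OF assms(2), of "e / (2 * L)"] e L(1) by auto
    have "dist (ip (\<sigma> m) (\<tau> m)) (ip (\<sigma> n) (\<tau> n)) < e" if "m \<ge> max M N" "n \<ge> max M N" for m n
    proof -
      have mem: "\<sigma> m \<in> H" "\<tau> m \<in> H" "\<sigma> n \<in> H" "\<tau> n \<in> H" by (intro cauchy_mem assms)+
      have "dist (ip (\<sigma> m) (\<tau> m)) (ip (\<sigma> n) (\<tau> n)) \<le>
          nm (\<lambda>x. \<sigma> m x - \<sigma> n x) * nm (\<tau> m) + nm (\<sigma> n) * nm (\<lambda>x. \<tau> m x - \<tau> n x)"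
        unfolding dist_norm using ip_difference_bound[OF mem] .
      also have "\<dots> \<le> nm (\<lambda>x. \<sigma> m x - \<sigma> n x) * K + L * nm (\<lambda>x. \<tau> m x - \<tau> n x)"
        by (intro add_mono mult_left_mono mult_right_mono K L nm_nonneg diff_mem mem)
      also have "\<dots> < e / (2 * K) * K + L * (e / (2 * L))"
        using M[of m n] N[of m n] that K(1) L(1)
        by (intro add_strict_mono mult_strict_left_mono mult_strict_right_mono) auto
      also have "\<dots> = e" using K(1) L(1) by simp
      finally show ?thesis .
    qed
    then show "\<exists>M. \<forall>m\<ge>M. \<forall>n\<ge>M. dist (ip (\<sigma> m) (\<tau> m)) (ip (\<sigma> n) (\<tau> n)) < e" by blast
  qed
  then show ?thesis by (rule Cauchy_convergent)
qed

lemma ip_tendsto_zero: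
  assumes "\<And>n. \<sigma> n \<in> H" "(\<lambda>n. nm (\<sigma> n)) \<longlonglongrightarrow> 0" "cauchy \<tau>"
  shows "(\<lambda>n. ip (\<sigma> n) (\<tau> n)) \<longlonglongrightarrow> 0"
proof -
  obtain K where K: "K > 0" "\<And>n. nm (\<tau> n) \<le> K" using cauchy_bounded[OF assms(3)] by blast
  have "cmod (ip (\<sigma> n) (\<tau> n)) \<le> nm (\<sigma> n) * K" for n
    using Cauchy_Schwarz[OF assms(1) cauchy_mem[OF assms(3)], of n n]
      mult_left_mono[OF K(2)[of n] nm_nonneg[OF assms(1)], of n] by linarith
  moreover have "(\<lambda>n. nm (\<sigma> n) * K) \<longlonglongrightarrow> 0"
    using tendsto_mult_right[OF assms(2), of K] by simp
  ultimately show ?thesis by (rule tendsto_zero_norm_le)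
qed

lemma ip_tendsto:
  assumes "\<And>n. \<sigma> n \<in> H" "f \<in> H" "(\<lambda>n. nm (\<lambda>x. \<sigma> n x - f x)) \<longlonglongrightarrow> 0" "g \<in> H"
  shows "(\<lambda>n. ip (\<sigma> n) g) \<longlonglongrightarrow> ip f g"
proof -
  have "(\<lambda>n. ip (\<lambda>x. \<sigma> n x - f x) g) \<longlonglongrightarrow> 0"
    using assms by (intro ip_tendsto_zero[where \<tau> = "\<lambda>_. g"] diff_mem cauchy_const)
  moreover have "ip (\<lambda>x. \<sigma> n x - f x) g = ip (\<sigma> n) g - ip f g" for n
    using assms by (intro diff_left)
  ultimately show ?thesis using LIM_zero_cancel by fastforce
qed

lemma nm_tendsto:
  assumes "\<And>n. \<sigma> n \<in> H" "f \<in> H" "(\<lambda>n. nm (\<lambda>x. \<sigma> n x - f x)) \<longlonglongrightarrow> 0"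
  shows "(\<lambda>n. nm (\<sigma> n)) \<longlonglongrightarrow> nm f"
proof -
  have "\<bar>nm (\<sigma> n) - nm f\<bar> \<le> nm (\<lambda>x. \<sigma> n x - f x)" for n
    using nm_le_diff[OF assms(1)[of n] assms(2)] nm_le_diff[OF assms(2) assms(1)[of n]]
      nm_diff_commute[OF assms(2) assms(1)[of n]] by linarith
  then have "(\<lambda>n. nm (\<sigma> n) - nm f) \<longlonglongrightarrow> 0"
    using tendsto_zero_norm_le[OF _ assms(3), of "\<lambda>n. nm (\<sigma> n) - nm f"] by simp
  then show ?thesis by (rule LIM_zero_cancel)
qed

end

lemma inner_product_on_semi: "inner_product_on H ip \<Longrightarrow> semi_inner_product H ip"
  unfolding inner_product_on_def by unfold_locales blast+

section \<open>The reproducing kernel Hilbert space of a kernel\<close>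

definition kernel_combination ::
  "'a set \<Rightarrow> ('a \<Rightarrow> 'a \<Rightarrow> complex) \<Rightarrow> 'a set \<Rightarrow> ('a \<Rightarrow> complex) \<Rightarrow> 'a \<Rightarrow> complex" where
  "kernel_combination X k S c = zero_ext X (\<lambda>z. \<Sum>y\<in>S. c y * k z y)"

definition kernel_span :: "'a set \<Rightarrow> ('a \<Rightarrow> 'a \<Rightarrow> complex) \<Rightarrow> ('a \<Rightarrow> complex) set" where
  "kernel_span X k = {kernel_combination X k S c | S c. finite S \<and> S \<subseteq> X}"

text \<open>The value of \<open>\<langle>f, g\<rangle>\<close> dictated by the reproducing property when \<open>g\<close> is a finite combination of kernel
  functions. It does not depend on the chosen representation of \<open>g\<close> when \<open>f\<close>
  is dominated by the kernel.\<close>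

definition span_pairing ::
  "'a set \<Rightarrow> ('a \<Rightarrow> 'a \<Rightarrow> complex) \<Rightarrow> ('a \<Rightarrow> complex) \<Rightarrow> ('a \<Rightarrow> complex) \<Rightarrow> complex" where
  "span_pairing X k f g = (case (SOME (S, c). finite S \<and> S \<subseteq> X \<and> g = kernel_combination X k S c) of
     (S, c) \<Rightarrow> \<Sum>y\<in>S. cnj (c y) * f y)"

text \<open>The functions in the closed ball of radius \<open>C\<close>, described without reference to any inner
  product.\<close>

definition dominated_by_kernel :: "'a set \<Rightarrow> ('a \<Rightarrow> 'a \<Rightarrow> complex) \<Rightarrow> real \<Rightarrow> ('a \<Rightarrow> complex) \<Rightarrow> bool" where
  "dominated_by_kernel X k C f \<longleftrightarrow> (\<forall>x. x \<notin> X \<longrightarrow> f x = 0) \<and>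
     psd X (\<lambda>x y. of_real (C\<^sup>2) * k x y - f x * cnj (f y))"

lemma kernel_combination_at: "x \<in> X \<Longrightarrow> kernel_combination X k S c x = (\<Sum>y\<in>S. c y * k x y)"
  by (simp add: kernel_combination_def zero_ext_def)

lemma kernel_combination_outside: "x \<notin> X \<Longrightarrow> kernel_combination X k S c x = 0"
  by (simp add: kernel_combination_def zero_ext_def)

lemma kernel_combination_enlarge:
  assumes "finite T" "S \<subseteq> T"
  shows "kernel_combination X k S c = kernel_combination X k T (\<lambda>y. if y \<in> S then c y else 0)"
proof -
  have "(\<Sum>y\<in>S. c y * k z y) = (\<Sum>y\<in>T. (if y \<in> S then c y else 0) * k z y)" for z
    using assms by (intro sum.mono_neutral_cong_left) auto
  then show ?thesis unfolding kernel_combination_def by simp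
qed

lemma kernel_combination_add:
  "(\<lambda>x. kernel_combination X k S c x + kernel_combination X k S d x) =
   kernel_combination X k S (\<lambda>y. c y + d y)"
  by (rule ext) (simp add: kernel_combination_def zero_ext_def distrib_right sum.distrib)

lemma kernel_combination_scale:
  "(\<lambda>x. a * kernel_combination X k S c x) = kernel_combination X k S (\<lambda>y. a * c y)"
  by (rule ext) (simp add: kernel_combination_def zero_ext_def mult.assoc sum_distrib_left)

lemma kernel_spanE2:
  assumes "f \<in> kernel_span X k" "g \<in> kernel_span X k"
  obtains S c d where "finite S" "S \<subseteq> X" "f = kernel_combination X k S c" "g = kernel_combination X k S d"
proof -
  obtain S c T d where "finite S" "S \<subseteq> X" "f = kernel_combination X k S c"
    "finite T" "T \<subseteq> X" "g = kernel_combination X k T d"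
    using assms unfolding kernel_span_def by blast
  then show ?thesis
    using that[of "S \<union> T"] kernel_combination_enlarge[of "S \<union> T" S X k c]
      kernel_combination_enlarge[of "S \<union> T" T X k d] by auto
qed

lemma kernel_combination_in_span:
  "finite S \<Longrightarrow> S \<subseteq> X \<Longrightarrow> kernel_combination X k S c \<in> kernel_span X k"
  unfolding kernel_span_def by blast

lemma span_pairing_rep:
  assumes "g \<in> kernel_span X k"
  obtains S c where "finite S" "S \<subseteq> X" "g = kernel_combination X k S c"
    "span_pairing X k f g = (\<Sum>y\<in>S. cnj (c y) * f y)"
proof -
  let ?P = "\<lambda>(S, c). finite S \<and> S \<subseteq> X \<and> g = kernel_combination X k S c"
  obtain S c where Sc: "(SOME p. ?P p) = (S, c)" by fastforce
  have "\<exists>p. ?P p" using assms unfolding kernel_span_def by auto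
  then have "?P (SOME p. ?P p)" by (rule someI_ex)
  then show ?thesis using that[of S c] unfolding span_pairing_def Sc by auto
qed

locale psd_kernel =
  fixes X :: "'a set" and k :: "'a \<Rightarrow> 'a \<Rightarrow> complex"
  assumes psd: "psd X k"
begin

abbreviation "comb \<equiv> kernel_combination X k"
abbreviation "Sp \<equiv> kernel_span X k"
abbreviation "pair \<equiv> span_pairing X k"

lemma hermitian: "x \<in> X \<Longrightarrow> y \<in> X \<Longrightarrow> cnj (k x y) = k y x"
  using psd_hermitian[OF psd] by metis

lemma pairing_symmetric:
  assumes "finite S" "S \<subseteq> X" "finite T" "T \<subseteq> X"
  shows "(\<Sum>y\<in>S. cnj (c y) * comb T d y) =
    cnj (\<Sum>x\<in>T. cnj (d x) * comb S c x)"
proof -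
  have "(\<Sum>y\<in>S. cnj (c y) * comb T d y) = (\<Sum>y\<in>S. \<Sum>x\<in>T. cnj (c y) * (d x * k y x))"
    using assms(2) by (intro sum.cong refl) (auto simp: kernel_combination_at sum_distrib_left)
  also have "\<dots> = (\<Sum>x\<in>T. \<Sum>y\<in>S. d x * (cnj (c y) * cnj (k x y)))"
    unfolding sum.swap[of _ T] using assms hermitian
    by (intro sum.cong refl) (auto simp: subset_iff mult.left_commute)
  also have "\<dots> = cnj (\<Sum>x\<in>T. cnj (d x) * comb S c x)"
    using assms(4) unfolding cnj_sum
    by (intro sum.cong refl) (auto simp: kernel_combination_at sum_distrib_left)
  finally show ?thesis .
qed

text \<open>By Hermitian symmetry the sum over a representation of the second argument is also a sum over a
  representation of the first, so it cannot depend on either.\<close>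

lemma pairing_span:
  assumes "f \<in> Sp" "finite S" "S \<subseteq> X"
  shows "pair f (comb S c) = (\<Sum>y\<in>S. cnj (c y) * f y)"
proof -
  obtain T d where T: "finite T" "T \<subseteq> X" "f = comb T d"
    using assms(1) unfolding kernel_span_def by blast
  obtain S' c' where S': "finite S'" "S' \<subseteq> X"
    "comb S c = comb S' c'"
    "pair f (comb S c) = (\<Sum>y\<in>S'. cnj (c' y) * f y)"
    using span_pairing_rep[OF kernel_combination_in_span[OF assms(2,3)]] by metis
  have "(\<Sum>y\<in>S'. cnj (c' y) * f y) = cnj (\<Sum>x\<in>T. cnj (d x) * comb S' c' x)"
    unfolding T(3) by (rule pairing_symmetric[OF S'(1,2) T(1,2)])
  also have "\<dots> = (\<Sum>y\<in>S. cnj (c y) * f y)"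
    unfolding T(3) S'(3)[symmetric] by (rule pairing_symmetric[OF assms(2,3) T(1,2), symmetric])
  finally show ?thesis unfolding S'(4) .
qed

lemma semi_inner_product_span: "semi_inner_product (Sp) (pair)"
proof
  let ?H = "Sp" and ?ip = "pair"
  have "(\<lambda>x. 0) = comb {} (\<lambda>x. 0)"
    by (auto simp: kernel_combination_def zero_ext_def)
  then show "(\<lambda>x. 0) \<in> ?H" using kernel_combination_in_span[of "{}" X k "\<lambda>x. 0"] by simp
  show add: "(\<lambda>x. f x + g x) \<in> ?H" if "f \<in> ?H" "g \<in> ?H" for f g
    by (rule kernel_spanE2[OF that]) (simp add: kernel_combination_add kernel_combination_in_span)
  show scale: "(\<lambda>x. a * f x) \<in> ?H" if "f \<in> ?H" for f a
    by (rule kernel_spanE2[OF that that]) (simp add: kernel_combination_scale kernel_combination_in_span)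
  show "?ip (\<lambda>x. f x + g x) h = ?ip f h + ?ip g h" if fgh: "f \<in> ?H" "g \<in> ?H" "h \<in> ?H" for f g h
  proof -
    obtain S c where h: "finite S" "S \<subseteq> X" "h = comb S c"
      using fgh(3) unfolding kernel_span_def by blast
    show ?thesis unfolding h(3) pairing_span[OF fgh(1) h(1,2)] pairing_span[OF fgh(2) h(1,2)]
        pairing_span[OF add[OF fgh(1,2)] h(1,2)]
      by (simp add: algebra_simps sum.distrib)
  qed
  show "?ip (\<lambda>x. a * f x) g = a * ?ip f g" if fg: "f \<in> ?H" "g \<in> ?H" for f g a
  proof -
    obtain S c where h: "finite S" "S \<subseteq> X" "g = comb S c"
      using fg(2) unfolding kernel_span_def by blast
    show ?thesis unfolding h(3) pairing_span[OF fg(1) h(1,2)] pairing_span[OF scale[OF fg(1)] h(1,2)]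
      by (simp add: algebra_simps sum_distrib_left)
  qed
  show "?ip g f = cnj (?ip f g)" if fg: "f \<in> ?H" "g \<in> ?H" for f g
  proof -
    obtain S c d where *: "finite S" "S \<subseteq> X" "f = comb S c" "g = comb S d"
      using kernel_spanE2[OF fg] .
    show ?thesis
      using pairing_span[OF fg(2) *(1,2), of c] pairing_span[OF fg(1) *(1,2), of d]
        pairing_symmetric[OF *(1,2,1,2), of c d] *(3,4) by simp
  qed
  show "0 \<le> ?ip f f" if f: "f \<in> ?H" for f
  proof -
    obtain S c where h: "finite S" "S \<subseteq> X" "f = comb S c"
      using f unfolding kernel_span_def by blast
    have "?ip f f = (\<Sum>y\<in>S. cnj (c y) * f y)" using pairing_span[OF f h(1,2)] h(3) by simp
    also have "\<dots> = (\<Sum>x\<in>S. \<Sum>y\<in>S. cnj (c x) * cnj (cnj (c y)) * k x y)"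
      unfolding h(3) using h(2)
      by (intro sum.cong refl) (auto simp: kernel_combination_at sum_distrib_left mult.assoc)
    also have "0 \<le> \<dots>" using h by (intro psdD[OF psd, of S "\<lambda>x. cnj (c x)"])
    finally show ?thesis .
  qed
qed

sublocale span: semi_inner_product "Sp" "pair"
  by (rule semi_inner_product_span)

lemma kernel_function_in_span: "w \<in> X \<Longrightarrow> zero_ext X (\<lambda>z. k z w) \<in> Sp"
  using kernel_combination_in_span[of "{w}" X k "\<lambda>_. 1"] by (simp add: kernel_combination_def)

lemma span_reproducing:
  assumes "f \<in> Sp" "w \<in> X"
  shows "pair f (zero_ext X (\<lambda>z. k z w)) = f w"
  using pairing_span[OF assms(1), of "{w}" "\<lambda>_. 1"] assms(2) by (simp add: kernel_combination_def)

lemma span_outside: "f \<in> Sp \<Longrightarrow> x \<notin> X \<Longrightarrow> f x = 0"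
  unfolding kernel_span_def by (auto simp: kernel_combination_outside)

lemma span_point_bound:
  shows "\<exists>K\<ge>0. \<forall>f\<in>Sp. cmod (f x) \<le> span.nm f * K"
proof (cases "x \<in> X")
  case True
  let ?e = "zero_ext X (\<lambda>z. k z x)"
  have "cmod (f x) \<le> span.nm f * span.nm ?e" if "f \<in> Sp" for f
    using span.Cauchy_Schwarz[OF that kernel_function_in_span[OF True]] span_reproducing[OF that True]
    by simp
  then show ?thesis using span.nm_nonneg[OF kernel_function_in_span[OF True]] by blast
next
  case False
  then have "cmod (f x) \<le> span.nm f * 0" if "f \<in> Sp" for f
    using span_outside[OF that] by simp
  then show ?thesis by blast
qed

text \<open>The analytic point in the construction of the completion: a Cauchy sequence of functions that
  tends to zero pointwise tends to zero in norm, because against a fixed combination of kernel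
  functions the pairing only sees finitely many values.\<close>

lemma cauchy_pointwise_zero:
  assumes "span.cauchy \<sigma>" "\<And>x. x \<in> X \<Longrightarrow> (\<lambda>n. \<sigma> n x) \<longlonglongrightarrow> 0"
  shows "(\<lambda>n. span.nm (\<sigma> n)) \<longlonglongrightarrow> 0"
proof (rule LIMSEQ_I)
  fix e :: real assume e: "0 < e"
  note mem = span.cauchy_mem[OF assms(1)]
  obtain K where K: "K > 0" "\<And>n. span.nm (\<sigma> n) \<le> K" using span.cauchy_bounded[OF assms(1)] by blast
  have "0 < e\<^sup>2 / (2 * K)" using e K(1) by simp
  then obtain M where M: "\<And>m n. m \<ge> M \<Longrightarrow> n \<ge> M \<Longrightarrow> span.nm (\<lambda>x. \<sigma> m x - \<sigma> n x) < e\<^sup>2 / (2 * K)"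
    using span.cauchyE[OF assms(1)] by metis
  obtain S c where S: "finite S" "S \<subseteq> X" "\<sigma> M = comb S c"
    using mem[of M] unfolding kernel_span_def by blast
  have "(\<lambda>n. pair (\<sigma> n) (\<sigma> M)) \<longlonglongrightarrow> (\<Sum>y\<in>S. cnj (c y) * 0)"
    unfolding S(3) pairing_span[OF mem S(1,2)]
    using S(2) by (intro tendsto_sum tendsto_mult tendsto_const assms(2)) auto
  then have "(\<lambda>n. pair (\<sigma> n) (\<sigma> M)) \<longlonglongrightarrow> 0" by simp
  then obtain N where N: "\<And>n. n \<ge> N \<Longrightarrow> cmod (pair (\<sigma> n) (\<sigma> M)) < e\<^sup>2 / 2"
    using LIMSEQ_D[of _ 0 "e\<^sup>2 / 2"] e by (metis diff_zero half_gt_zero zero_less_power)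
  have "norm (span.nm (\<sigma> n) - 0) < e" if n: "n \<ge> max M N" for n
  proof -
    have "(span.nm (\<sigma> n))\<^sup>2 = cmod (pair (\<sigma> n) (\<sigma> n))"
      by (simp add: span.ip_self(1)[OF mem] norm_power span.nm_nonneg[OF mem])
    also have "pair (\<sigma> n) (\<sigma> n) =
        pair (\<sigma> n) (\<sigma> M) + pair (\<sigma> n) (\<lambda>x. \<sigma> n x - \<sigma> M x)"
      by (simp add: span.diff_right[OF mem mem mem])
    also have "cmod \<dots> \<le> cmod (pair (\<sigma> n) (\<sigma> M)) +
        cmod (pair (\<sigma> n) (\<lambda>x. \<sigma> n x - \<sigma> M x))"
      by (rule norm_triangle_ineq)
    also have "cmod (pair (\<sigma> n) (\<lambda>x. \<sigma> n x - \<sigma> M x)) \<le> K * (e\<^sup>2 / (2 * K))"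
      using span.Cauchy_Schwarz[OF mem span.diff_mem[OF mem mem], of n n M]
        mult_mono[OF K(2)[of n] less_imp_le[OF M[of n M]]] n K(1)
        span.nm_nonneg[OF span.diff_mem[OF mem mem]] by fastforce
    also have "K * (e\<^sup>2 / (2 * K)) = e\<^sup>2 / 2" using K(1) by simp
    also have "cmod (pair (\<sigma> n) (\<sigma> M)) + e\<^sup>2 / 2 < e\<^sup>2" using N[of n] n by simp
    finally have "(span.nm (\<sigma> n))\<^sup>2 < e\<^sup>2" by simp
    then have "span.nm (\<sigma> n) < e" by (rule power2_less_imp_less) (use e in simp)
    then show ?thesis using span.nm_nonneg[OF mem] by simp
  qed
  then show "\<exists>N. \<forall>n\<ge>N. norm (span.nm (\<sigma> n) - 0) < e" by (intro exI allI impI)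
qed

definition approximates :: "(nat \<Rightarrow> 'a \<Rightarrow> complex) \<Rightarrow> ('a \<Rightarrow> complex) \<Rightarrow> bool" where
  "approximates \<sigma> f \<longleftrightarrow> span.cauchy \<sigma> \<and> (\<forall>x. (\<lambda>n. \<sigma> n x) \<longlonglongrightarrow> f x)"

text \<open>Cauchy sequences of combinations of kernel functions converge pointwise, and by
  \<open>cauchy_pointwise_zero\<close> their pointwise limit determines them up to sequences of norm zero. The
  completion can therefore be realised as a space of functions.\<close>

definition completion :: "('a \<Rightarrow> complex) set" where
  "completion = {f. \<exists>\<sigma>. approximates \<sigma> f}"

definition approximants :: "('a \<Rightarrow> complex) \<Rightarrow> nat \<Rightarrow> 'a \<Rightarrow> complex" where
  "approximants f = (SOME \<sigma>. approximates \<sigma> f)"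

definition completion_inner :: "('a \<Rightarrow> complex) \<Rightarrow> ('a \<Rightarrow> complex) \<Rightarrow> complex" where
  "completion_inner f g = lim (\<lambda>n. pair (approximants f n) (approximants g n))"

lemma approximants: "f \<in> completion \<Longrightarrow> approximates (approximants f) f"
  unfolding completion_def approximants_def by (metis (mono_tags) mem_Collect_eq someI_ex)

lemma completion_inner_tendsto:
  assumes \<sigma>: "approximates \<sigma> f" and \<tau>: "approximates \<tau> g"
  shows "(\<lambda>n. pair (\<sigma> n) (\<tau> n)) \<longlonglongrightarrow> completion_inner f g"
proof -
  let ?s = "approximants f" and ?t = "approximants g"
  have s: "approximates ?s f" and t: "approximates ?t g"
    using assms approximants by (auto simp: completion_def)
  have c: "span.cauchy \<sigma>" "span.cauchy \<tau>" "span.cauchy ?s" "span.cauchy ?t"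
    using assms s t by (auto simp: approximates_def)
  note m = c[THEN span.cauchy_mem]
  have d: "(\<lambda>n. span.nm (\<lambda>x. \<sigma> n x - ?s n x)) \<longlonglongrightarrow> 0" "(\<lambda>n. span.nm (\<lambda>x. \<tau> n x - ?t n x)) \<longlonglongrightarrow> 0"
    using assms s t tendsto_diff[of "\<lambda>n. \<sigma> n x" "f x" sequentially "\<lambda>n. ?s n x" "f x" for x]
      tendsto_diff[of "\<lambda>n. \<tau> n x" "g x" sequentially "\<lambda>n. ?t n x" "g x" for x]
    by (auto intro!: cauchy_pointwise_zero span.cauchy_diff simp: approximates_def)
  have 1: "(\<lambda>n. pair (\<lambda>x. \<sigma> n x - ?s n x) (\<tau> n)) \<longlonglongrightarrow> 0"
    using d(1) c by (intro span.ip_tendsto_zero span.diff_mem m)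
  have "(\<lambda>n. pair (\<lambda>x. \<tau> n x - ?t n x) (?s n)) \<longlonglongrightarrow> 0"
    using d(2) c by (intro span.ip_tendsto_zero span.diff_mem m)
  then have "(\<lambda>n. cnj (pair (\<lambda>x. \<tau> n x - ?t n x) (?s n))) \<longlonglongrightarrow> 0"
    using tendsto_cnj by fastforce
  then have 2: "(\<lambda>n. pair (?s n) (\<lambda>x. \<tau> n x - ?t n x)) \<longlonglongrightarrow> 0"
    using span.commute[OF span.diff_mem[OF m(2) m(4)] m(3)] by simp
  have 3: "(\<lambda>n. pair (?s n) (?t n)) \<longlonglongrightarrow> completion_inner f g"
    using span.cauchy_ip_convergent[OF c(3,4)] unfolding completion_inner_def
    by (simp add: convergent_LIMSEQ_iff)
  have "pair (\<sigma> n) (\<tau> n) = pair (\<lambda>x. \<sigma> n x - ?s n x) (\<tau> n) +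
      pair (?s n) (\<lambda>x. \<tau> n x - ?t n x) + pair (?s n) (?t n)" for n
    using span.diff_left[OF m(1)[of n] m(3)[of n] m(2)[of n]] span.diff_right[OF m(2)[of n] m(4)[of n] m(3)[of n]]
    by simp
  then show ?thesis using tendsto_add[OF tendsto_add[OF 1 2] 3] by simp
qed

lemma approximates_add:
  "approximates \<sigma> f \<Longrightarrow> approximates \<tau> g \<Longrightarrow> approximates (\<lambda>n x. \<sigma> n x + \<tau> n x) (\<lambda>x. f x + g x)"
  unfolding approximates_def by (auto intro: span.cauchy_add tendsto_add)

lemma approximates_scale:
  "approximates \<sigma> f \<Longrightarrow> approximates (\<lambda>n x. a * \<sigma> n x) (\<lambda>x. a * f x)"
  unfolding approximates_def by (auto intro: span.cauchy_scale tendsto_mult)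

lemma approximates_const: "f \<in> Sp \<Longrightarrow> approximates (\<lambda>n. f) f"
  unfolding approximates_def by (auto intro: span.cauchy_const)

lemma completion_inner_span:
  assumes "approximates \<sigma> f" "g \<in> Sp"
  shows "(\<lambda>n. pair (\<sigma> n) g) \<longlonglongrightarrow> completion_inner f g"
  using completion_inner_tendsto[OF assms(1) approximates_const[OF assms(2)]] .

lemma completion_reproducing:
  assumes "f \<in> completion" "w \<in> X"
  shows "f w = completion_inner f (zero_ext X (\<lambda>z. k z w))"
proof (rule LIMSEQ_unique)
  note a = approximants[OF assms(1)]
  show "(\<lambda>n. approximants f n w) \<longlonglongrightarrow> f w" using a by (simp add: approximates_def)
  have "pair (approximants f n) (zero_ext X (\<lambda>z. k z w)) = approximants f n w" for n
    using a by (intro span_reproducing assms(2) span.cauchy_mem) (simp add: approximates_def)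
  then show "(\<lambda>n. approximants f n w) \<longlonglongrightarrow> completion_inner f (zero_ext X (\<lambda>z. k z w))"
    using completion_inner_span[OF a kernel_function_in_span[OF assms(2)]] by simp
qed

lemma completion_outside: assumes "f \<in> completion" "x \<notin> X" shows "f x = 0"
proof -
  note a = approximants[OF assms(1)]
  then have "approximants f n x = 0" for n
    using span_outside[OF span.cauchy_mem assms(2)] by (simp add: approximates_def)
  moreover have "(\<lambda>n. approximants f n x) \<longlonglongrightarrow> f x" using a by (simp add: approximates_def)
  ultimately show ?thesis by (simp add: LIMSEQ_const_iff)
qed

lemma semi_inner_product_completion: "semi_inner_product completion completion_inner"
proof
  note ap = approximants
  have mem: "f \<in> completion" if "approximates \<sigma> f" for \<sigma> f using that by (auto simp: completion_def)
  have spanm: "approximants f n \<in> Sp" if "f \<in> completion" for f n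
    using ap[OF that] by (intro span.cauchy_mem) (simp add: approximates_def)
  show "(\<lambda>x. 0) \<in> completion" by (rule mem[OF approximates_const[OF span.zero_mem]])
  show "(\<lambda>x. f x + g x) \<in> completion" if "f \<in> completion" "g \<in> completion" for f g
    by (rule mem[OF approximates_add[OF ap[OF that(1)] ap[OF that(2)]]])
  show "(\<lambda>x. a * f x) \<in> completion" if "f \<in> completion" for f a
    by (rule mem[OF approximates_scale[OF ap[OF that]]])
  show "completion_inner (\<lambda>x. f x + g x) h = completion_inner f h + completion_inner g h"
    if "f \<in> completion" "g \<in> completion" "h \<in> completion" for f g h
  proof (rule LIMSEQ_unique)
    show "(\<lambda>n. pair (\<lambda>x. approximants f n x + approximants g n x) (approximants h n))
        \<longlonglongrightarrow> completion_inner (\<lambda>x. f x + g x) h"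
      by (intro completion_inner_tendsto approximates_add ap that)
    show "(\<lambda>n. pair (\<lambda>x. approximants f n x + approximants g n x) (approximants h n))
        \<longlonglongrightarrow> completion_inner f h + completion_inner g h"
      unfolding span.add_left[OF spanm[OF that(1)] spanm[OF that(2)] spanm[OF that(3)]]
      by (intro tendsto_add completion_inner_tendsto ap that)
  qed
  show "completion_inner (\<lambda>x. a * f x) g = a * completion_inner f g"
    if "f \<in> completion" "g \<in> completion" for f g a
  proof (rule LIMSEQ_unique)
    show "(\<lambda>n. pair (\<lambda>x. a * approximants f n x) (approximants g n))
        \<longlonglongrightarrow> completion_inner (\<lambda>x. a * f x) g"
      by (intro completion_inner_tendsto approximates_scale ap that)
    show "(\<lambda>n. pair (\<lambda>x. a * approximants f n x) (approximants g n))
        \<longlonglongrightarrow> a * completion_inner f g"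
      unfolding span.scale_left[OF spanm[OF that(1)] spanm[OF that(2)]]
      by (intro tendsto_mult tendsto_const completion_inner_tendsto ap that)
  qed
  show "completion_inner g f = cnj (completion_inner f g)"
    if "f \<in> completion" "g \<in> completion" for f g
  proof (rule LIMSEQ_unique)
    show "(\<lambda>n. pair (approximants g n) (approximants f n)) \<longlonglongrightarrow> completion_inner g f"
      by (intro completion_inner_tendsto ap that)
    show "(\<lambda>n. pair (approximants g n) (approximants f n)) \<longlonglongrightarrow> cnj (completion_inner f g)"
      unfolding span.commute[OF spanm[OF that(1)] spanm[OF that(2)]]
      by (intro tendsto_cnj completion_inner_tendsto ap that)
  qed
  show "0 \<le> completion_inner f f" if "f \<in> completion" for f
    using completion_inner_tendsto[OF ap[OF that] ap[OF that]]
    by (rule complex_nonneg_limit) (rule span.nonneg[OF spanm[OF that]])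
qed

sublocale completion: semi_inner_product completion completion_inner
  by (rule semi_inner_product_completion)

lemma span_subset_completion: "Sp \<subseteq> completion"
  using approximates_const by (auto simp: completion_def)

lemma completion_inner_on_span:
  assumes "f \<in> Sp" "g \<in> Sp"
  shows "completion_inner f g = pair f g"
  using completion_inner_span[OF approximates_const[OF assms(1)] assms(2)]
  by (simp add: LIMSEQ_const_iff)

lemma completion_norm_on_span: "f \<in> Sp \<Longrightarrow> completion.nm f = span.nm f"
  by (simp add: norm_of_def completion_inner_on_span)

lemma approximates_in_norm:
  assumes "approximates \<sigma> f" shows "(\<lambda>n. completion.nm (\<lambda>x. \<sigma> n x - f x)) \<longlonglongrightarrow> 0"
proof (rule LIMSEQ_I)
  fix e :: real assume e: "0 < e"
  have c: "span.cauchy \<sigma>" using assms by (simp add: approximates_def)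
  note m = span.cauchy_mem[OF c]
  have fm: "f \<in> completion" using assms by (auto simp: completion_def)
  obtain M where M: "\<And>m n. m \<ge> M \<Longrightarrow> n \<ge> M \<Longrightarrow> span.nm (\<lambda>x. \<sigma> m x - \<sigma> n x) < e / 2"
    using span.cauchyE[OF c, of "e / 2"] e by auto
  have "norm (completion.nm (\<lambda>x. \<sigma> n x - f x) - 0) < e" if n: "n \<ge> M" for n
  proof -
    have a: "approximates (\<lambda>j x. \<sigma> n x - \<sigma> j x) (\<lambda>x. \<sigma> n x - f x)"
      using approximates_add[OF approximates_const[OF m[of n]] approximates_scale[OF assms, of "-1"]] by simp
    have nn: "0 \<le> completion.nm (\<lambda>x. \<sigma> n x - f x)"
      using a by (intro completion.nm_nonneg) (auto simp: completion_def)
    have "Re (completion_inner (\<lambda>x. \<sigma> n x - f x) (\<lambda>x. \<sigma> n x - f x)) \<le> (e / 2)\<^sup>2"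
    proof (rule LIMSEQ_le_const2)
      show "(\<lambda>j. Re (pair (\<lambda>x. \<sigma> n x - \<sigma> j x) (\<lambda>x. \<sigma> n x - \<sigma> j x))) \<longlonglongrightarrow>
          Re (completion_inner (\<lambda>x. \<sigma> n x - f x) (\<lambda>x. \<sigma> n x - f x))"
        by (intro tendsto_Re completion_inner_tendsto a)
      have "Re (pair (\<lambda>x. \<sigma> n x - \<sigma> j x) (\<lambda>x. \<sigma> n x - \<sigma> j x)) \<le> (e / 2)\<^sup>2" if "j \<ge> M" for j
        unfolding span.ip_self(2)[OF span.diff_mem[OF m m]] using M[OF n that]
        by (intro power_mono span.nm_nonneg span.diff_mem m) auto
      then show "\<exists>N. \<forall>j\<ge>N. Re (pair (\<lambda>x. \<sigma> n x - \<sigma> j x) (\<lambda>x. \<sigma> n x - \<sigma> j x)) \<le> (e / 2)\<^sup>2"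
        by blast
    qed
    then have "completion.nm (\<lambda>x. \<sigma> n x - f x) \<le> e / 2"
      unfolding norm_of_def using e by (intro real_le_lsqrt) auto
    then show ?thesis using e nn by simp
  qed
  then show "\<exists>N. \<forall>n\<ge>N. norm (completion.nm (\<lambda>x. \<sigma> n x - f x) - 0) < e" by blast
qed

lemma inner_product_on_completion: "inner_product_on completion completion_inner"
proof -
  have definite: "f = (\<lambda>x. 0)" if "f \<in> completion" "completion_inner f f = 0" for f
  proof
    fix x
    show "f x = 0"
    proof (cases "x \<in> X")
      case True
      let ?e = "zero_ext X (\<lambda>z. k z x)"
      have e: "?e \<in> completion" using kernel_function_in_span[OF True] span_subset_completion by blast
      have "cmod (f x) \<le> completion.nm f * completion.nm ?e"
        using completion.Cauchy_Schwarz[OF that(1) e] completion_reproducing[OF that(1) True] by simp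
      also have "completion.nm f = 0" using that by (simp add: norm_of_def)
      finally show ?thesis by simp
    qed (rule completion_outside[OF that(1)])
  qed
  show ?thesis unfolding inner_product_on_def
    by (intro conjI ballI allI impI; rule completion.zero_mem completion.add_mem completion.scale_mem
        completion.add_left completion.scale_left completion.commute completion.nonneg definite; assumption)
qed

lemma completion_complete:
  assumes "completion.cauchy \<sigma>"
  shows "\<exists>f\<in>completion. (\<lambda>n. completion.nm (\<lambda>x. \<sigma> n x - f x)) \<longlonglongrightarrow> 0"
proof -
  note m = completion.cauchy_mem[OF assms]
  have "\<exists>v\<in>Sp. completion.nm (\<lambda>x. \<sigma> n x - v x) < 1 / (real n + 1)" for n
  proof -
    note a = approximants[OF m[of n]]
    have am: "approximants (\<sigma> n) j \<in> Sp" for j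
      using a by (intro span.cauchy_mem) (simp add: approximates_def)
    obtain j where "completion.nm (\<lambda>x. approximants (\<sigma> n) j x - \<sigma> n x) < 1 / (real n + 1)"
      using order_tendstoD(2)[OF approximates_in_norm[OF a], of "1 / (real n + 1)"]
      by (auto simp: eventually_sequentially)
    then show ?thesis
      using completion.nm_diff_commute[OF m[of n], of "approximants (\<sigma> n) j"] am[of j]
        span_subset_completion by force
  qed
  then obtain v where v: "\<And>n. v n \<in> Sp"
    "\<And>n. completion.nm (\<lambda>x. \<sigma> n x - v n x) < 1 / (real n + 1)" by metis
  have vm: "v n \<in> completion" for n using v(1) span_subset_completion by blast
  have lim: "(\<lambda>n. completion.nm (\<lambda>x. \<sigma> n x - v n x)) \<longlonglongrightarrow> 0"
  proof (rule tendsto_zero_norm_le)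
    show "norm (completion.nm (\<lambda>x. \<sigma> n x - v n x)) \<le> 1 / (real n + 1)" for n
      using v(2)[of n] completion.nm_nonneg[OF completion.diff_mem[OF m[of n] vm[of n]]] by simp
    show "(\<lambda>n. 1 / (real n + 1)) \<longlonglongrightarrow> 0" using LIMSEQ_inverse_real_of_nat by (simp add: inverse_eq_divide add.commute)
  qed
  have vc: "span.cauchy v"
    unfolding span.cauchy_def
  proof (intro conjI allI impI v(1))
    fix e :: real assume e: "0 < e"
    then have e3: "0 < e / 3" by simp
    obtain M where M: "\<And>m n. m \<ge> M \<Longrightarrow> n \<ge> M \<Longrightarrow> completion.nm (\<lambda>x. \<sigma> m x - \<sigma> n x) < e / 3"
      using completion.cauchyE[OF assms e3] by blast
    obtain N where N: "\<And>n. n \<ge> N \<Longrightarrow> completion.nm (\<lambda>x. \<sigma> n x - v n x) < e / 3"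
      using order_tendstoD(2)[OF lim e3] by (auto simp: eventually_sequentially)
    have "span.nm (\<lambda>x. v i x - v j x) < e" if "i \<ge> max M N" "j \<ge> max M N" for i j
    proof -
      have "span.nm (\<lambda>x. v i x - v j x) = completion.nm (\<lambda>x. v i x - v j x)"
        by (intro completion_norm_on_span[symmetric] span.diff_mem v)
      also have "\<dots> < e"
        using completion.triangle_diff[OF vm[of i] m[of i] vm[of j]]
          completion.triangle_diff[OF m[of i] m[of j] vm[of j]]
          completion.nm_diff_commute[OF m[of i] vm[of i]] M[of i j] N[of i] N[of j] that by linarith
      finally show ?thesis .
    qed
    then show "\<exists>M. \<forall>i\<ge>M. \<forall>j\<ge>M. span.nm (\<lambda>x. v i x - v j x) < e" by blast
  qed
  have "\<exists>l. (\<lambda>n. v n x) \<longlonglongrightarrow> l" for x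
  proof -
    obtain K where K: "K \<ge> 0" "\<And>f. f \<in> Sp \<Longrightarrow> cmod (f x) \<le> span.nm f * K"
      using span_point_bound[of x] by blast
    have "Cauchy (\<lambda>n. v n x)"
    proof (rule metric_CauchyI)
      fix e :: real assume "0 < e"
      then have e: "0 < e / (K + 1)" using K(1) by simp
      obtain M where M: "\<And>m n. m \<ge> M \<Longrightarrow> n \<ge> M \<Longrightarrow> span.nm (\<lambda>x. v m x - v n x) < e / (K + 1)"
        using span.cauchyE[OF vc e] by blast
      have "dist (v i x) (v j x) < e" if "i \<ge> M" "j \<ge> M" for i j
      proof -
        have d: "(\<lambda>x. v i x - v j x) \<in> Sp" by (intro span.diff_mem v)
        have "dist (v i x) (v j x) \<le> span.nm (\<lambda>x. v i x - v j x) * K"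
          using K(2)[OF d] by (simp add: dist_norm)
        also have "\<dots> \<le> span.nm (\<lambda>x. v i x - v j x) * (K + 1)"
          using span.nm_nonneg[OF d] by (intro mult_left_mono) auto
        also have "\<dots> < e" using M[OF that] K(1) by (simp add: pos_less_divide_eq)
        finally show ?thesis .
      qed
      then show "\<exists>M. \<forall>i\<ge>M. \<forall>j\<ge>M. dist (v i x) (v j x) < e" by blast
    qed
    then show ?thesis using Cauchy_convergent convergent_def by blast
  qed
  then obtain f where "\<And>x. (\<lambda>n. v n x) \<longlonglongrightarrow> f x" by metis
  then have f: "approximates v f" using vc by (simp add: approximates_def)
  have fm: "f \<in> completion" using f by (auto simp: completion_def)
  have "(\<lambda>n. completion.nm (\<lambda>x. \<sigma> n x - f x)) \<longlonglongrightarrow> 0"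
  proof (rule tendsto_zero_norm_le)
    show "norm (completion.nm (\<lambda>x. \<sigma> n x - f x)) \<le>
        completion.nm (\<lambda>x. \<sigma> n x - v n x) + completion.nm (\<lambda>x. v n x - f x)" for n
      using completion.triangle_diff[OF m vm fm, of n n] completion.nm_nonneg[OF completion.diff_mem[OF m fm]]
      by simp
    show "(\<lambda>n. completion.nm (\<lambda>x. \<sigma> n x - v n x) + completion.nm (\<lambda>x. v n x - f x)) \<longlonglongrightarrow> 0"
      using tendsto_add[OF lim approximates_in_norm[OF f]] by simp
  qed
  then show ?thesis using fm by blast
qed

lemma is_rkhs_completion: "is_rkhs X k completion completion_inner"
  unfolding is_rkhs_def hilbert_space_on_def
proof (intro conjI allI impI ballI)
  show "\<exists>f\<in>completion. (\<lambda>n. completion.nm (\<lambda>x. \<sigma> n x - f x)) \<longlonglongrightarrow> 0"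
    if "(\<forall>n. \<sigma> n \<in> completion) \<and>
      (\<forall>e>0. \<exists>M. \<forall>m\<ge>M. \<forall>n\<ge>M. completion.nm (\<lambda>x. \<sigma> m x - \<sigma> n x) < e)" for \<sigma>
    using that by (intro completion_complete) (simp add: completion.cauchy_def)
  show "zero_ext X (\<lambda>z. k z w) \<in> completion" if "w \<in> X" for w
    using kernel_function_in_span[OF that] span_subset_completion by blast
qed (fact inner_product_on_completion, erule (1) completion_outside, erule (1) completion_reproducing)

end

lemma is_rkhs_semi_inner_product: "is_rkhs X k H ip \<Longrightarrow> semi_inner_product H ip"
  unfolding is_rkhs_def hilbert_space_on_def by (elim conjE) (rule inner_product_on_semi)

context psd_kernel
begin

lemma dominated_bound:
  assumes f: "dominated_by_kernel X k C f" and S: "finite S" "S \<subseteq> X"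
  shows "(cmod (\<Sum>y\<in>S. cnj (c y) * f y))\<^sup>2 \<le> C\<^sup>2 * (span.nm (comb S c))\<^sup>2"
proof -
  define L where "L = (\<Sum>y\<in>S. cnj (c y) * f y)"
  let ?v = "comb S c"
  have vm: "?v \<in> Sp" using S by (rule kernel_combination_in_span)
  have "pair ?v ?v = (\<Sum>x\<in>S. cnj (c x) * ?v x)" by (rule pairing_span[OF vm S])
  also have "\<dots> = (\<Sum>x\<in>S. \<Sum>y\<in>S. cnj (c x) * (c y * k x y))"
    using S by (intro sum.cong refl) (auto simp: kernel_combination_at sum_distrib_left)
  finally have v: "pair ?v ?v = (\<Sum>x\<in>S. \<Sum>y\<in>S. cnj (c x) * (c y * k x y))" .
  have "(\<Sum>x\<in>S. \<Sum>y\<in>S. cnj (c x) * cnj (cnj (c y)) * (of_real (C\<^sup>2) * k x y - f x * cnj (f y))) =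
    of_real (C\<^sup>2) * pair ?v ?v - of_real ((cmod L)\<^sup>2)"
    unfolding quadratic_form_minus_rank_one v L_def by (simp add: mult.assoc)
  also have "\<dots> = of_real (C\<^sup>2 * (span.nm ?v)\<^sup>2 - (cmod L)\<^sup>2)"
    by (simp only: span.ip_self(1)[OF vm] of_real_diff of_real_mult of_real_power)
  finally have "0 \<le> complex_of_real (C\<^sup>2 * (span.nm ?v)\<^sup>2 - (cmod L)\<^sup>2)"
    using psdD[of X "\<lambda>x y. of_real (C\<^sup>2) * k x y - f x * cnj (f y)" S "\<lambda>x. cnj (c x)"] f S
    unfolding dominated_by_kernel_def by simp
  then show ?thesis unfolding L_def[symmetric] less_eq_complex_def by simp
qed

text \<open>Two representations of the same function differ by a combination of norm zero, on which a dominated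
  function pairs to zero.\<close>

lemma dominated_pairing:
  assumes f: "dominated_by_kernel X k C f" and S: "finite S" "S \<subseteq> X"
  shows "pair f (comb S c) = (\<Sum>y\<in>S. cnj (c y) * f y)"
proof -
  obtain S' c' where S': "finite S'" "S' \<subseteq> X"
    "comb S c = comb S' c'"
    "pair f (comb S c) = (\<Sum>y\<in>S'. cnj (c' y) * f y)"
    using span_pairing_rep[OF kernel_combination_in_span[OF S]] by metis
  define T where "T = S \<union> S'"
  have T: "finite T" "T \<subseteq> X" "S \<subseteq> T" "S' \<subseteq> T" using S S' by (auto simp: T_def)
  define d where "d y = (if y \<in> S then c y else 0)" for y
  define d' where "d' y = (if y \<in> S' then c' y else 0)" for y
  have s: "(\<Sum>y\<in>S. cnj (c y) * f y) = (\<Sum>y\<in>T. cnj (d y) * f y)"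
    "(\<Sum>y\<in>S'. cnj (c' y) * f y) = (\<Sum>y\<in>T. cnj (d' y) * f y)"
    unfolding d_def d'_def using T by (intro sum.mono_neutral_cong_left; auto)+
  have "comb T d = comb T d'"
    using S'(3) kernel_combination_enlarge[OF T(1,3), of X k c] kernel_combination_enlarge[OF T(1,4), of X k c']
    unfolding d_def d'_def by simp
  then have "comb T (\<lambda>y. d y + (-1) * d' y) = (\<lambda>x. 0)"
    unfolding kernel_combination_add[symmetric] kernel_combination_scale[symmetric] by simp
  then have "(cmod (\<Sum>y\<in>T. cnj (d y + (-1) * d' y) * f y))\<^sup>2 \<le> C\<^sup>2 * (span.nm (\<lambda>x. 0))\<^sup>2"
    using dominated_bound[OF f T(1,2), of "\<lambda>y. d y + (-1) * d' y"] by simp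
  also have "span.nm (\<lambda>x. 0) = 0" using span.zero_left[OF span.zero_mem] by (simp add: norm_of_def)
  finally have "(\<Sum>y\<in>T. cnj (d y + (-1) * d' y) * f y) = 0" by simp
  then show ?thesis unfolding S'(4) s by (simp add: algebra_simps sum_subtractf)
qed

lemma dominated_pairing_add:
  assumes "dominated_by_kernel X k C f" "g \<in> Sp" "h \<in> Sp"
  shows "pair f (\<lambda>x. g x + h x) = pair f g + pair f h"
proof -
  obtain S c d where S: "finite S" "S \<subseteq> X" "g = comb S c" "h = comb S d"
    using kernel_spanE2[OF assms(2,3)] .
  show ?thesis unfolding S(3,4) kernel_combination_add dominated_pairing[OF assms(1) S(1,2)]
    by (simp add: algebra_simps sum.distrib)
qed

lemma dominated_pairing_scale:
  assumes "dominated_by_kernel X k C f" "g \<in> Sp"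
  shows "pair f (\<lambda>x. a * g x) = cnj a * pair f g"
proof -
  obtain S c where S: "finite S" "S \<subseteq> X" "g = comb S c"
    using assms(2) unfolding kernel_span_def by blast
  show ?thesis unfolding S(3) kernel_combination_scale dominated_pairing[OF assms(1) S(1,2)]
    by (simp add: algebra_simps sum_distrib_left)
qed

lemma dominated_pairing_bound:
  assumes "dominated_by_kernel X k C f" "0 \<le> C" "g \<in> Sp"
  shows "cmod (pair f g) \<le> C * span.nm g"
proof -
  obtain S c where S: "finite S" "S \<subseteq> X" "g = comb S c"
    using assms(3) unfolding kernel_span_def by blast
  have "(cmod (pair f g))\<^sup>2 \<le> (C * span.nm g)\<^sup>2"
    using dominated_bound[OF assms(1) S(1,2), of c]
    unfolding S(3) dominated_pairing[OF assms(1) S(1,2)] power_mult_distrib .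
  then show ?thesis
    by (rule power2_le_imp_le) (intro mult_nonneg_nonneg assms(2) span.nm_nonneg[OF assms(3)])
qed

text \<open>Riesz representation by minimising \<open>\<parallel>v\<parallel>\<^sup>2 - 2 Re \<langle>f, v\<rangle>\<close> over the span of the kernel functions: by the
  parallelogram law a minimising sequence is Cauchy, and perturbing it in the direction of a kernel
  function shows that its values converge to those of \<open>f\<close>.\<close>

lemma dominated_in_completion:
  assumes f: "dominated_by_kernel X k C f" and C: "0 \<le> C"
  shows "f \<in> completion"
proof -
  define J where "J v = (span.nm v)\<^sup>2 - 2 * Re (pair f v)" for v
  let ?H = "Sp" and ?ip = "pair"
  have lower: "- C\<^sup>2 \<le> J v" if "v \<in> ?H" for v
  proof -
    have "Re (?ip f v) \<le> C * span.nm v"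
      using dominated_pairing_bound[OF f C that] complex_Re_le_cmod order_trans by blast
    moreover have "0 \<le> (span.nm v - C)\<^sup>2" by simp
    ultimately show ?thesis unfolding J_def by (simp add: power2_eq_square algebra_simps)
  qed
  then have bdd: "bdd_below (J ` ?H)" by (auto simp: bdd_below_def)
  define I where "I = Inf (J ` ?H)"
  have I: "I \<le> J v" if "v \<in> ?H" for v unfolding I_def using that bdd by (intro cInf_lower) auto
  have "\<exists>v\<in>?H. J v < I + 1 / (real n + 1)" for n
  proof -
    have "I < I + 1 / (real n + 1)" by simp
    then have "\<exists>y\<in>J ` ?H. y < I + 1 / (real n + 1)"
      unfolding I_def using bdd span.zero_mem by (subst (asm) cInf_less_iff) auto
    then show ?thesis by blast
  qed
  then obtain v where v: "\<And>n. v n \<in> ?H" "\<And>n. J (v n) < I + 1 / (real n + 1)" by metis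
  have par: "(span.nm (\<lambda>x. u x - w x))\<^sup>2 \<le> 2 * J u + 2 * J w - 4 * I" if u: "u \<in> ?H" and w: "w \<in> ?H" for u w
  proof -
    define m where "m = (\<lambda>x. (1/2) * (u x + w x))"
    have uw: "(\<lambda>x. u x + w x) \<in> ?H" by (intro span.add_mem u w)
    have mm: "m \<in> ?H" unfolding m_def by (intro span.scale_mem uw)
    have "2 * span.nm m = span.nm (\<lambda>x. u x + w x)"
      unfolding m_def span.nm_scale[OF uw] by simp
    then have "(2 * span.nm m)\<^sup>2 = (span.nm (\<lambda>x. u x + w x))\<^sup>2" by simp
    then have 1: "4 * (span.nm m)\<^sup>2 = (span.nm u)\<^sup>2 + 2 * Re (?ip u w) + (span.nm w)\<^sup>2"
      unfolding span.nm_add_square[OF u w] power_mult_distrib by simp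
    note 2 = span.nm_diff_square[OF u w]
    have fm: "?ip f m = (?ip f u + ?ip f w) / 2"
      unfolding m_def dominated_pairing_scale[OF f uw] dominated_pairing_add[OF f u w] by simp
    have 3: "Re (?ip f m) = (Re (?ip f u) + Re (?ip f w)) / 2" by (simp only: fm) simp
    have "I \<le> (span.nm m)\<^sup>2 - 2 * Re (?ip f m)" using I[OF mm] by (simp only: J_def)
    then show ?thesis unfolding J_def 2 using 1 3 by argo
  qed
  have cv: "span.cauchy v"
    unfolding span.cauchy_def
  proof (intro conjI)
    show "\<forall>n. v n \<in> ?H" using v(1) by simp
    show "\<forall>e>0. \<exists>M. \<forall>m\<ge>M. \<forall>n\<ge>M. span.nm (\<lambda>x. v m x - v n x) < e"
    proof (intro allI impI)
      fix e :: real assume e: "0 < e"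
    then have "0 < e\<^sup>2 / 4" by simp
    then obtain M where M: "1 / (real M + 1) < e\<^sup>2 / 4"
      using reals_Archimedean[of "e\<^sup>2 / 4"] by (auto simp: inverse_eq_divide add.commute)
    have "span.nm (\<lambda>x. v m x - v n x) < e" if "m \<ge> M" "n \<ge> M" for m n
    proof (rule power2_less_imp_less)
      have "1 / (real m + 1) \<le> 1 / (real M + 1)" "1 / (real n + 1) \<le> 1 / (real M + 1)"
        using that by (auto intro!: divide_left_mono)
      then show "(span.nm (\<lambda>x. v m x - v n x))\<^sup>2 < e\<^sup>2"
        using par[OF v(1)[of m] v(1)[of n]] v(2)[of m] v(2)[of n] M by linarith
    qed (use e in simp)
    then show "\<exists>M. \<forall>m\<ge>M. \<forall>n\<ge>M. span.nm (\<lambda>x. v m x - v n x) < e" by (intro exI allI impI)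
    qed
  qed
  have "(\<lambda>n. v n x) \<longlonglongrightarrow> f x" for x
  proof (cases "x \<in> X")
    case True
    let ?e = "zero_ext X (\<lambda>z. k z x)"
    have em: "?e \<in> ?H" by (rule kernel_function_in_span[OF True])
    define s where "s = 1 / (1 + (span.nm ?e)\<^sup>2)"
    have s: "0 < s" "s * (span.nm ?e)\<^sup>2 \<le> 1" by (auto simp: s_def add_pos_nonneg field_simps)
    (* s is small enough for the quadratic term of the perturbation to be at most half of the linear one *)
    have fe: "?ip f ?e = f x"
      using dominated_pairing[OF f, of "{x}" "\<lambda>_. 1"] True by (simp add: kernel_combination_def)
    have est: "s * (cmod (v n x - f x))\<^sup>2 \<le> 1 / (real n + 1)" for n
    proof -
      define \<delta> where "\<delta> = v n x - f x"
      define a where "a = - of_real s * \<delta>"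
      have ae: "(\<lambda>x. a * ?e x) \<in> ?H" by (intro span.scale_mem em)
      have vn: "v n \<in> ?H" by (rule v)
      define w where "w = (\<lambda>x. v n x + a * ?e x)"
      have wm: "w \<in> ?H" unfolding w_def by (intro span.add_mem vn ae)
      have ve: "?ip (v n) ?e = v n x" by (rule span_reproducing[OF vn True])
      have "(span.nm w)\<^sup>2 = (span.nm (v n))\<^sup>2 + 2 * Re (?ip (v n) (\<lambda>x. a * ?e x))
          + (span.nm (\<lambda>x. a * ?e x))\<^sup>2"
        unfolding w_def by (rule span.nm_add_square[OF vn ae])
      also have "?ip (v n) (\<lambda>x. a * ?e x) = cnj a * v n x"
        by (simp add: span.scale_right[OF em vn] ve)
      also have "span.nm (\<lambda>x. a * ?e x) = cmod a * span.nm ?e" by (rule span.nm_scale[OF em])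
      finally have n1: "(span.nm w)\<^sup>2 =
        (span.nm (v n))\<^sup>2 + 2 * Re (cnj a * v n x) + (cmod a)\<^sup>2 * (span.nm ?e)\<^sup>2"
        by (simp add: power_mult_distrib)
      have "?ip f w = ?ip f (v n) + cnj a * f x"
        unfolding w_def dominated_pairing_add[OF f vn ae] dominated_pairing_scale[OF f em] fe ..
      then have "J w = J (v n) + 2 * Re (cnj a * \<delta>) + (cmod a)\<^sup>2 * (span.nm ?e)\<^sup>2"
        unfolding J_def n1 \<delta>_def by (simp add: algebra_simps)
      moreover have "cnj a * \<delta> = - of_real s * (\<delta> * cnj \<delta>)" by (simp add: a_def)
      then have "Re (cnj a * \<delta>) = - s * (cmod \<delta>)\<^sup>2"
        unfolding complex_norm_square[symmetric] by (simp flip: of_real_power)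
      moreover have "(cmod a)\<^sup>2 * (span.nm ?e)\<^sup>2 = s * (cmod \<delta>)\<^sup>2 * (s * (span.nm ?e)\<^sup>2)"
        using s by (simp add: a_def norm_mult power_mult_distrib power2_eq_square)
      moreover have "s * (cmod \<delta>)\<^sup>2 * (s * (span.nm ?e)\<^sup>2) \<le> s * (cmod \<delta>)\<^sup>2 * 1"
        using s by (intro mult_left_mono) auto
      ultimately show ?thesis using I[OF wm] v(2)[of n] unfolding \<delta>_def by linarith
    qed
    have "(\<lambda>n. (cmod (v n x - f x))\<^sup>2) \<longlonglongrightarrow> 0"
    proof (rule tendsto_zero_norm_le)
      show "norm ((cmod (v n x - f x))\<^sup>2) \<le> (1 / s) * (1 / (real n + 1))" for n
      proof -
        have "(cmod (v n x - f x))\<^sup>2 = (1 / s) * (s * (cmod (v n x - f x))\<^sup>2)" using s by simp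
        also have "\<dots> \<le> (1 / s) * (1 / (real n + 1))" using est[of n] s by (intro mult_left_mono) auto
        finally show ?thesis by simp
      qed
      show "(\<lambda>n. (1 / s) * (1 / (real n + 1))) \<longlonglongrightarrow> 0"
        using tendsto_mult_left[OF LIMSEQ_inverse_real_of_nat, of "1 / s"]
        by (simp add: inverse_eq_divide add.commute)
    qed
    then have "(\<lambda>n. cmod (v n x - f x)) \<longlonglongrightarrow> 0"
      using tendsto_real_sqrt[of "\<lambda>n. (cmod (v n x - f x))\<^sup>2" 0] by simp
    then show ?thesis by (rule LIM_zero_cancel[OF tendsto_norm_zero_cancel])
  next
    case False
    then have "f x = 0" using f by (simp add: dominated_by_kernel_def)
    then show ?thesis using span_outside[OF v(1) False] by simp
  qed
  then show ?thesis using cv unfolding completion_def approximates_def by blast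
qed

text \<open>Any reproducing kernel Hilbert space of \<open>k\<close> contains the span of the kernel functions isometrically
  and is exhausted by limits of it, so it coincides with the completion.\<close>

context
  fixes H ip assumes R: "is_rkhs X k H ip"
begin

interpretation R: semi_inner_product H ip
  using R by (rule is_rkhs_semi_inner_product)

lemma rkhs_kernel_function: "w \<in> X \<Longrightarrow> zero_ext X (\<lambda>z. k z w) \<in> H"
  using R unfolding is_rkhs_def by simp

lemma rkhs_reproducing: "f \<in> H \<Longrightarrow> w \<in> X \<Longrightarrow> ip f (zero_ext X (\<lambda>z. k z w)) = f w"
  using R unfolding is_rkhs_def by simp

lemma rkhs_outside: "f \<in> H \<Longrightarrow> x \<notin> X \<Longrightarrow> f x = 0"
  using R unfolding is_rkhs_def by simp

lemma rkhs_kernel_combination: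
  assumes S: "finite S" "S \<subseteq> X"
  shows "comb S c \<in> H"
    "f \<in> H \<Longrightarrow> ip f (comb S c) = (\<Sum>y\<in>S. cnj (c y) * f y)"
proof -
  have eq: "comb S c = (\<lambda>x. \<Sum>y\<in>S. c y * zero_ext X (\<lambda>z. k z y) x)"
    by (auto simp: kernel_combination_def zero_ext_def)
  have m: "(\<lambda>x. c y * zero_ext X (\<lambda>z. k z y) x) \<in> H" if "y \<in> S" for y
    using that S by (intro R.scale_mem rkhs_kernel_function) auto
  show "comb S c \<in> H" unfolding eq by (intro R.sum_mem m)
  assume f: "f \<in> H"
  have "ip f (comb S c) = (\<Sum>y\<in>S. ip f (\<lambda>x. c y * zero_ext X (\<lambda>z. k z y) x))"
    unfolding eq using m f by (intro R.sum_right)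
  also have "\<dots> = (\<Sum>y\<in>S. cnj (c y) * f y)"
    using S f by (intro sum.cong refl) (auto simp: R.scale_right rkhs_kernel_function rkhs_reproducing subset_iff)
  finally show "ip f (comb S c) = (\<Sum>y\<in>S. cnj (c y) * f y)" .
qed

lemma span_subset_rkhs: "Sp \<subseteq> H"
  unfolding kernel_span_def by (auto simp: rkhs_kernel_combination(1))

lemma rkhs_inner_on_span:
  assumes "f \<in> Sp" "g \<in> Sp" shows "ip f g = pair f g"
proof -
  obtain S c where S: "finite S" "S \<subseteq> X" "g = comb S c"
    using assms(2) unfolding kernel_span_def by blast
  have "f \<in> H" using assms(1) span_subset_rkhs by blast
  then show ?thesis unfolding S(3) by (simp add: rkhs_kernel_combination(2)[OF S(1,2)] pairing_span[OF assms(1) S(1,2)])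
qed

lemma rkhs_dominated:
  assumes f: "f \<in> H" shows "dominated_by_kernel X k (norm_of ip f) f"
  unfolding dominated_by_kernel_def
proof (intro conjI allI impI psdI)
  fix F c assume F: "finite F" "F \<subseteq> X"
  let ?v = "comb F (\<lambda>y. cnj (c y))"
  have vm: "?v \<in> H" by (rule rkhs_kernel_combination(1)[OF F])
  define L where "L = (\<Sum>y\<in>F. c y * f y)"
  have fv: "ip f ?v = L" using rkhs_kernel_combination(2)[OF F f] by (simp add: L_def)
  have "ip ?v ?v = (\<Sum>x\<in>F. c x * ?v x)" using rkhs_kernel_combination(2)[OF F vm] by simp
  also have "\<dots> = (\<Sum>x\<in>F. \<Sum>y\<in>F. c x * cnj (c y) * k x y)"
    using F by (intro sum.cong refl) (auto simp: kernel_combination_at sum_distrib_left mult.assoc)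
  finally have vv: "ip ?v ?v = (\<Sum>x\<in>F. \<Sum>y\<in>F. c x * cnj (c y) * k x y)" .
  have "(\<Sum>x\<in>F. \<Sum>y\<in>F. c x * cnj (c y) * (of_real ((norm_of ip f)\<^sup>2) * k x y - f x * cnj (f y))) =
    of_real ((norm_of ip f)\<^sup>2) * ip ?v ?v - of_real ((cmod L)\<^sup>2)"
    unfolding quadratic_form_minus_rank_one vv L_def ..
  also have "\<dots> = of_real ((norm_of ip f)\<^sup>2 * (norm_of ip ?v)\<^sup>2 - (cmod L)\<^sup>2)"
    by (simp only: R.ip_self(1)[OF vm] of_real_diff of_real_mult of_real_power)
  finally have eq: "(\<Sum>x\<in>F. \<Sum>y\<in>F. c x * cnj (c y) * (of_real ((norm_of ip f)\<^sup>2) * k x y - f x * cnj (f y))) =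
    of_real ((norm_of ip f)\<^sup>2 * (norm_of ip ?v)\<^sup>2 - (cmod L)\<^sup>2)" .
  have "(cmod L)\<^sup>2 \<le> (norm_of ip f * norm_of ip ?v)\<^sup>2"
    using R.Cauchy_Schwarz[OF f vm] fv by (intro power_mono) auto
  then show "0 \<le> (\<Sum>x\<in>F. \<Sum>y\<in>F. c x * cnj (c y) * (of_real ((norm_of ip f)\<^sup>2) * k x y - f x * cnj (f y)))"
    unfolding eq by (simp add: less_eq_complex_def power_mult_distrib)
qed (rule rkhs_outside[OF f])

lemma approximated_in_rkhs:
  assumes a: "approximates \<sigma> f"
  shows "f \<in> H" "(\<lambda>n. norm_of ip (\<lambda>x. \<sigma> n x - f x)) \<longlonglongrightarrow> 0"
proof -
  have c: "span.cauchy \<sigma>" using a by (simp add: approximates_def)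
  note m = span.cauchy_mem[OF c]
  have mH: "\<sigma> n \<in> H" for n using m span_subset_rkhs by blast
  have "norm_of ip (\<lambda>x. \<sigma> i x - \<sigma> j x) = span.nm (\<lambda>x. \<sigma> i x - \<sigma> j x)" for i j
    using rkhs_inner_on_span[OF span.diff_mem[OF m[of i] m[of j]] span.diff_mem[OF m[of i] m[of j]]] by (simp add: norm_of_def)
  then have "\<forall>e>0. \<exists>M. \<forall>i\<ge>M. \<forall>j\<ge>M. norm_of ip (\<lambda>x. \<sigma> i x - \<sigma> j x) < e"
    using c unfolding span.cauchy_def by simp
  moreover have "\<forall>\<sigma>. (\<forall>n. \<sigma> n \<in> H) \<and> (\<forall>e>0. \<exists>M. \<forall>m\<ge>M. \<forall>n\<ge>M. norm_of ip (\<lambda>x. \<sigma> m x - \<sigma> n x) < e) \<longrightarrow>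
      (\<exists>f\<in>H. (\<lambda>n. norm_of ip (\<lambda>x. \<sigma> n x - f x)) \<longlonglongrightarrow> 0)"
    using R unfolding is_rkhs_def hilbert_space_on_def by simp
  ultimately obtain g where g: "g \<in> H" "(\<lambda>n. norm_of ip (\<lambda>x. \<sigma> n x - g x)) \<longlonglongrightarrow> 0"
    using mH by blast
  have "f = g"
  proof
    fix x
    have lf: "(\<lambda>n. \<sigma> n x) \<longlonglongrightarrow> f x" using a by (simp add: approximates_def)
    show "f x = g x"
    proof (cases "x \<in> X")
      case True
      have "(\<lambda>n. \<sigma> n x) \<longlonglongrightarrow> g x"
        using R.ip_tendsto[OF mH g rkhs_kernel_function[OF True]]
        by (simp add: rkhs_reproducing[OF mH True] rkhs_reproducing[OF g(1) True])
      then show ?thesis using lf LIMSEQ_unique by blast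
    next
      case False
      then show ?thesis using lf by (simp add: rkhs_outside[OF mH False] rkhs_outside[OF g(1) False] LIMSEQ_const_iff)
    qed
  qed
  then show "f \<in> H" "(\<lambda>n. norm_of ip (\<lambda>x. \<sigma> n x - f x)) \<longlonglongrightarrow> 0" using g by auto
qed

lemma rkhs_eq_completion: "H = completion"
proof
  show "H \<subseteq> completion"
    using dominated_in_completion[OF rkhs_dominated R.nm_nonneg] by blast
  show "completion \<subseteq> H"
    using approximated_in_rkhs(1)[OF approximants] by blast
qed

end

text \<open>The Moore--Aronszajn theorem: the completion is a reproducing kernel Hilbert space of \<open>k\<close>, and every
  other one is the same set of functions, so the descriptions that define \<open>rkhs\<close> and \<open>rkhs_inner\<close> are met.\<close>

lemma is_rkhs_rkhs: "is_rkhs X k (rkhs X k) (rkhs_inner X k)"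
proof -
  have "rkhs X k = completion"
    unfolding rkhs_def using is_rkhs_completion rkhs_eq_completion by (intro the_equality) blast+
  then have "is_rkhs X k (rkhs X k) completion_inner" using is_rkhs_completion by simp
  then show ?thesis unfolding rkhs_inner_def by (rule someI[of "is_rkhs X k (rkhs X k)"])
qed

sublocale rkhs: semi_inner_product "rkhs X k" "rkhs_inner X k"
  using is_rkhs_rkhs by (rule is_rkhs_semi_inner_product)

lemma dominated_in_rkhs: "dominated_by_kernel X k C f \<Longrightarrow> 0 \<le> C \<Longrightarrow> f \<in> rkhs X k"
  using dominated_in_completion rkhs_eq_completion[OF is_rkhs_rkhs] by simp

lemma kernel_span_dense:
  assumes "f \<in> rkhs X k"
  obtains \<sigma> where "\<And>n. \<sigma> n \<in> Sp" "(\<lambda>n. rkhs.nm (\<lambda>x. \<sigma> n x - f x)) \<longlonglongrightarrow> 0"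
proof
  have a: "approximates (approximants f) f"
    using assms rkhs_eq_completion[OF is_rkhs_rkhs] by (intro approximants) simp
  show "approximants f n \<in> Sp" for n
    using a by (intro span.cauchy_mem) (simp add: approximates_def)
  show "(\<lambda>n. rkhs.nm (\<lambda>x. approximants f n x - f x)) \<longlonglongrightarrow> 0"
    by (rule approximated_in_rkhs(2)[OF is_rkhs_rkhs a])
qed

end

section \<open>Contractive multipliers\<close>

context psd_kernel
begin

lemma combination_in_rkhs:
  "finite S \<Longrightarrow> S \<subseteq> X \<Longrightarrow> comb S c \<in> rkhs X k"
  by (rule rkhs_kernel_combination(1)[OF is_rkhs_rkhs])

lemma inner_combination:
  "finite S \<Longrightarrow> S \<subseteq> X \<Longrightarrow> f \<in> rkhs X k \<Longrightarrow>
   rkhs_inner X k f (comb S c) = (\<Sum>y\<in>S. cnj (c y) * f y)"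
  by (rule rkhs_kernel_combination(2)[OF is_rkhs_rkhs])

lemma quadratic_form_eq_norm:
  assumes S: "finite S" "S \<subseteq> X"
  shows "(\<Sum>x\<in>S. \<Sum>y\<in>S. c x * cnj (c y) * k x y) =
    of_real ((rkhs.nm (comb S (\<lambda>y. cnj (c y))))\<^sup>2)"
proof -
  let ?v = "comb S (\<lambda>y. cnj (c y))"
  have "of_real ((rkhs.nm ?v)\<^sup>2) = (\<Sum>x\<in>S. c x * ?v x)"
    unfolding rkhs.ip_self(1)[OF combination_in_rkhs[OF S], symmetric]
      inner_combination[OF S combination_in_rkhs[OF S]] by simp
  also have "\<dots> = (\<Sum>x\<in>S. \<Sum>y\<in>S. c x * cnj (c y) * k x y)"
    using S by (intro sum.cong refl) (auto simp: kernel_combination_at sum_distrib_left mult.assoc)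
  finally show ?thesis ..
qed

lemma block_quadratic_form_eq_norms:
  fixes N :: nat
  assumes S: "finite S" "S \<subseteq> X"
  shows "(\<Sum>s\<in>S \<times> {..<N}. \<Sum>t\<in>S \<times> {..<N}. c s * cnj (c t) *
      (if snd s = snd t then k (fst s) (fst t) else 0)) =
    of_real (\<Sum>a<N. (rkhs.nm (comb S (\<lambda>y. cnj (c (y, a)))))\<^sup>2)"
proof -
  have "(\<Sum>s\<in>S \<times> {..<N}. \<Sum>t\<in>S \<times> {..<N}. c s * cnj (c t) *
      (if snd s = snd t then k (fst s) (fst t) else 0)) =
    (\<Sum>x\<in>S. \<Sum>a<N. \<Sum>y\<in>S. \<Sum>b<N. c (x, a) * cnj (c (y, b)) * (if a = b then k x y else 0))"
    unfolding sum.cartesian_product' by (simp only: fst_conv snd_conv)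
  also have "\<dots> = (\<Sum>x\<in>S. \<Sum>a<N. \<Sum>y\<in>S. c (x, a) * cnj (c (y, a)) * k x y)"
  proof (intro sum.cong refl, goal_cases)
    case (1 x a y)
    have "(\<Sum>b<N. c (x, a) * cnj (c (y, b)) * (if a = b then k x y else 0)) =
      (\<Sum>b<N. if b = a then c (x, a) * cnj (c (y, b)) * k x y else 0)"
      by (intro sum.cong refl) auto
    also have "\<dots> = c (x, a) * cnj (c (y, a)) * k x y" using 1 by simp
    finally show ?case .
  qed
  also have "\<dots> = (\<Sum>a<N. \<Sum>x\<in>S. \<Sum>y\<in>S. c (x, a) * cnj (c (y, a)) * k x y)" by (rule sum.swap)
  also have "\<dots> = of_real (\<Sum>a<N. (rkhs.nm (comb S (\<lambda>y. cnj (c (y, a)))))\<^sup>2)"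
    unfolding of_real_sum by (intro sum.cong refl quadratic_form_eq_norm S)
  finally show ?thesis .
qed

lemma block_pairing:
  fixes N :: nat
  assumes S: "finite S" "S \<subseteq> X" and f: "\<And>a. a < N \<Longrightarrow> f a \<in> rkhs X k"
  shows "(\<Sum>s\<in>S \<times> {..<N}. c s * f (snd s) (fst s)) =
    (\<Sum>a<N. rkhs_inner X k (f a) (comb S (\<lambda>y. cnj (c (y, a)))))"
proof -
  have "(\<Sum>s\<in>S \<times> {..<N}. c s * f (snd s) (fst s)) = (\<Sum>x\<in>S. \<Sum>a<N. c (x, a) * f a x)"
    unfolding sum.cartesian_product' by (simp only: fst_conv snd_conv)
  also have "\<dots> = (\<Sum>a<N. \<Sum>x\<in>S. c (x, a) * f a x)" by (rule sum.swap)
  also have "\<dots> = (\<Sum>a<N. rkhs_inner X k (f a) (comb S (\<lambda>y. cnj (c (y, a)))))"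
    using f by (intro sum.cong refl) (simp add: inner_combination[OF S])
  finally show ?thesis .
qed

text \<open>The components \<open>f a\<close> form a single function on \<open>X \<times> {..<N}\<close>, and \<open>\<H> \<otimes> \<complex>\<^sup>N\<close> is the reproducing kernel
  space of the block diagonal kernel there. Here and in \<open>components_of_psd\<close>, membership in a ball of that
  space is expressed through positivity.\<close>

lemma psd_of_components:
  fixes N :: nat
  assumes f: "\<And>a. a < N \<Longrightarrow> f a \<in> rkhs X k"
  shows "psd (X \<times> {..<N}) (\<lambda>s t. of_real (\<Sum>a<N. (rkhs.nm (f a))\<^sup>2) *
      (if snd s = snd t then k (fst s) (fst t) else 0) - f (snd s) (fst s) * cnj (f (snd t) (fst t)))"
proof (rule psd_cofinalI)
  fix F assume F: "finite F" "F \<subseteq> X \<times> {..<N}"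
  define S where "S = fst ` F"
  have S: "finite S" "S \<subseteq> X" "F \<subseteq> S \<times> {..<N}" using F by (force simp: S_def)+
  let ?C = "\<Sum>a<N. (rkhs.nm (f a))\<^sup>2"
  have "0 \<le> (\<Sum>s\<in>S \<times> {..<N}. \<Sum>t\<in>S \<times> {..<N}. c s * cnj (c t) * (of_real ?C *
      (if snd s = snd t then k (fst s) (fst t) else 0) - f (snd s) (fst s) * cnj (f (snd t) (fst t))))" for c
  proof -
    define v where "v a = comb S (\<lambda>y. cnj (c (y, a)))" for a
    have vm: "v a \<in> rkhs X k" for a unfolding v_def by (rule combination_in_rkhs[OF S(1,2)])
    have bp: "(\<Sum>s\<in>S \<times> {..<N}. c s * f (snd s) (fst s)) = (\<Sum>a<N. rkhs_inner X k (f a) (v a))"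
      using block_pairing[OF S(1,2), of N f c] f by (simp add: v_def)
    have "cmod (\<Sum>a<N. rkhs_inner X k (f a) (v a)) \<le> (\<Sum>a<N. rkhs.nm (f a) * rkhs.nm (v a))"
      by (intro sum_norm_le rkhs.Cauchy_Schwarz vm f) auto
    also have "\<dots> = (\<Sum>a<N. \<bar>rkhs.nm (f a)\<bar> * \<bar>rkhs.nm (v a)\<bar>)"
      using rkhs.nm_nonneg f vm by (intro sum.cong refl) simp
    also have "\<dots> \<le> L2_set (\<lambda>a. rkhs.nm (f a)) {..<N} * L2_set (\<lambda>a. rkhs.nm (v a)) {..<N}"
      by (rule L2_set_mult_ineq)
    finally have "(cmod (\<Sum>a<N. rkhs_inner X k (f a) (v a)))\<^sup>2 \<le>
      (L2_set (\<lambda>a. rkhs.nm (f a)) {..<N} * L2_set (\<lambda>a. rkhs.nm (v a)) {..<N})\<^sup>2"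
      by (intro power_mono) auto
    also have "\<dots> = ?C * (\<Sum>a<N. (rkhs.nm (v a))\<^sup>2)"
      unfolding L2_set_def power_mult_distrib by (simp add: sum_nonneg)
    finally have *: "0 \<le> ?C * (\<Sum>a<N. (rkhs.nm (v a))\<^sup>2) - (cmod (\<Sum>a<N. rkhs_inner X k (f a) (v a)))\<^sup>2"
      by simp
    have "(\<Sum>s\<in>S \<times> {..<N}. \<Sum>t\<in>S \<times> {..<N}. c s * cnj (c t) * (of_real ?C *
      (if snd s = snd t then k (fst s) (fst t) else 0) - f (snd s) (fst s) * cnj (f (snd t) (fst t)))) =
      of_real (?C * (\<Sum>a<N. (rkhs.nm (v a))\<^sup>2) - (cmod (\<Sum>a<N. rkhs_inner X k (f a) (v a)))\<^sup>2)"
      unfolding quadratic_form_minus_rank_one block_quadratic_form_eq_norms[OF S(1,2)]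
        bp v_def[symmetric] by simp
    then show ?thesis using * by (simp only: less_eq_complex_def) simp
  qed
  then show "\<exists>G. finite G \<and> F \<subseteq> G \<and> (\<forall>c. 0 \<le> (\<Sum>s\<in>G. \<Sum>t\<in>G. c s * cnj (c t) * (of_real ?C *
      (if snd s = snd t then k (fst s) (fst t) else 0) - f (snd s) (fst s) * cnj (f (snd t) (fst t)))))"
    using S by (intro exI[of _ "S \<times> {..<N}"]) blast
qed

lemma common_span_representation:
  assumes "\<And>a. a < (N::nat) \<Longrightarrow> v a \<in> Sp"
  shows "\<exists>S c. finite S \<and> S \<subseteq> X \<and> (\<forall>a<N. v a = comb S (c a))"
proof -
  have "\<exists>S c. finite S \<and> S \<subseteq> X \<and> v a = comb S c" if "a < N" for a
    using assms[OF that] unfolding kernel_span_def by blast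
  then obtain S c where S: "\<And>a. a < N \<Longrightarrow> finite (S a) \<and> S a \<subseteq> X \<and> v a = comb (S a) (c a)"
    by metis
  define T where "T = (\<Union>a<N. S a)"
  have T: "finite T" "T \<subseteq> X" using S by (auto simp: T_def)
  have "v a = comb T (\<lambda>y. if y \<in> S a then c a y else 0)" if "a < N" for a
  proof -
    have "S a \<subseteq> T" using that by (auto simp: T_def)
    then show ?thesis using S[OF that] kernel_combination_enlarge[OF T(1)] by metis
  qed
  then show ?thesis using T by (intro exI[of _ T] exI[of _ "\<lambda>a y. if y \<in> S a then c a y else 0"]) auto
qed

text \<open>Positivity says \<open>\<bar>\<langle>g, v\<rangle>\<bar>\<^sup>2 \<le> C \<parallel>v\<parallel>\<^sup>2\<close> for vectors \<open>v\<close> of combinations of kernel functions; by density this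
  may be used at \<open>v = g\<close>, where it reads \<open>\<parallel>g\<parallel>\<^sup>4 \<le> C \<parallel>g\<parallel>\<^sup>2\<close>.\<close>

lemma components_of_psd:
  fixes N :: nat
  assumes C: "0 \<le> C" and zero: "\<And>a x. a < N \<Longrightarrow> x \<notin> X \<Longrightarrow> g a x = 0"
    and pos: "psd (X \<times> {..<N}) (\<lambda>s t. of_real C *
      (if snd s = snd t then k (fst s) (fst t) else 0) - g (snd s) (fst s) * cnj (g (snd t) (fst t)))"
  shows "\<And>a. a < N \<Longrightarrow> g a \<in> rkhs X k" "(\<Sum>a<N. (rkhs.nm (g a))\<^sup>2) \<le> C"
proof -
  show mem: "g a \<in> rkhs X k" if "a < N" for a
  proof (rule dominated_in_rkhs)
    have "psd X (\<lambda>x y. of_real C * (if snd (x, a) = snd (y, a) then k (fst (x, a)) (fst (y, a)) else 0)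
        - g (snd (x, a)) (fst (x, a)) * cnj (g (snd (y, a)) (fst (y, a))))"
      by (rule psd_reindex[OF pos]) (use that in auto)
    then show "dominated_by_kernel X k (sqrt C) (g a)"
      using zero[OF that] C by (simp add: dominated_by_kernel_def del: of_real_power)
  qed (use C in simp)
  have "\<exists>\<sigma>. (\<forall>n. \<sigma> n \<in> Sp) \<and> (\<lambda>n. rkhs.nm (\<lambda>x. \<sigma> n x - g a x)) \<longlonglongrightarrow> 0" if "a < N" for a
    using kernel_span_dense[OF mem[OF that]] by blast
  then obtain \<sigma> where \<sigma>: "\<And>a n. a < N \<Longrightarrow> \<sigma> a n \<in> Sp"
    "\<And>a. a < N \<Longrightarrow> (\<lambda>n. rkhs.nm (\<lambda>x. \<sigma> a n x - g a x)) \<longlonglongrightarrow> 0" by metis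
  have \<sigma>m: "\<sigma> a n \<in> rkhs X k" if "a < N" for a n
    using \<sigma>(1)[OF that] span_subset_rkhs[OF is_rkhs_rkhs] by blast
  have bound: "(cmod (\<Sum>a<N. rkhs_inner X k (g a) (\<sigma> a n)))\<^sup>2 \<le> C * (\<Sum>a<N. (rkhs.nm (\<sigma> a n))\<^sup>2)" for n
  proof -
    obtain S d where S: "finite S" "S \<subseteq> X" "\<And>a. a < N \<Longrightarrow> \<sigma> a n = comb S (d a)"
      using common_span_representation[of N "\<lambda>a. \<sigma> a n"] \<sigma>(1) by blast
    define c where "c s = cnj (d (snd s) (fst s))" for s
    have cd: "comb S (\<lambda>y. cnj (c (y, a))) = \<sigma> a n" if "a < N" for a
      using S(3)[OF that] by (simp add: c_def)
    have bp: "(\<Sum>s\<in>S \<times> {..<N}. c s * g (snd s) (fst s)) = (\<Sum>a<N. rkhs_inner X k (g a) (\<sigma> a n))"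
      using block_pairing[OF S(1,2), of N g c] mem by (simp add: cd)
    have "0 \<le> (\<Sum>s\<in>S \<times> {..<N}. \<Sum>t\<in>S \<times> {..<N}. c s * cnj (c t) * (of_real C *
      (if snd s = snd t then k (fst s) (fst t) else 0) - g (snd s) (fst s) * cnj (g (snd t) (fst t))))"
      by (rule psdD[OF pos]) (use S in auto)
    also have "\<dots> = of_real (C * (\<Sum>a<N. (rkhs.nm (\<sigma> a n))\<^sup>2) - (cmod (\<Sum>a<N. rkhs_inner X k (g a) (\<sigma> a n)))\<^sup>2)"
      unfolding quadratic_form_minus_rank_one block_quadratic_form_eq_norms[OF S(1,2)]
        bp by (simp add: cd)
    finally show ?thesis by (simp add: less_eq_complex_def)
  qed
  let ?R = "\<Sum>a<N. (rkhs.nm (g a))\<^sup>2"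
  have "(\<lambda>n. \<Sum>a<N. rkhs_inner X k (g a) (\<sigma> a n)) \<longlonglongrightarrow> (\<Sum>a<N. rkhs_inner X k (g a) (g a))"
  proof (rule tendsto_sum)
    fix a assume "a \<in> {..<N}"
    then have a: "a < N" by simp
    have "(\<lambda>n. cnj (rkhs_inner X k (\<sigma> a n) (g a))) \<longlonglongrightarrow> cnj (rkhs_inner X k (g a) (g a))"
      by (intro tendsto_cnj rkhs.ip_tendsto \<sigma>m mem \<sigma>(2) a)
    then show "(\<lambda>n. rkhs_inner X k (g a) (\<sigma> a n)) \<longlonglongrightarrow> rkhs_inner X k (g a) (g a)"
      unfolding rkhs.commute[OF \<sigma>m[OF a] mem[OF a], symmetric] rkhs.commute[OF mem[OF a] mem[OF a], symmetric] .
  qed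
  moreover have "(\<Sum>a<N. rkhs_inner X k (g a) (g a)) = of_real ?R"
    unfolding of_real_sum by (intro sum.cong refl rkhs.ip_self(1) mem) simp
  ultimately have "(\<lambda>n. (cmod (\<Sum>a<N. rkhs_inner X k (g a) (\<sigma> a n)))\<^sup>2) \<longlonglongrightarrow> (cmod (of_real ?R))\<^sup>2"
    by (intro tendsto_power tendsto_norm) simp
  moreover have "(\<lambda>n. C * (\<Sum>a<N. (rkhs.nm (\<sigma> a n))\<^sup>2)) \<longlonglongrightarrow> C * ?R"
    by (intro tendsto_mult tendsto_const tendsto_sum tendsto_power rkhs.nm_tendsto \<sigma>m mem \<sigma>(2)) auto
  ultimately have "(cmod (of_real ?R))\<^sup>2 \<le> C * ?R"
    by (rule LIMSEQ_le) (use bound in blast)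
  then have "?R\<^sup>2 \<le> C * ?R" by (simp only: norm_of_real power2_abs)
  moreover have "0 \<le> ?R" by (intro sum_nonneg) simp
  ultimately show "?R \<le> C"
    using C by (cases "?R = 0") (auto simp: power2_eq_square mult_le_cancel_right)
qed

end

text \<open>If \<open>C k - F F*\<close> is positive, so is \<open>C k \<Phi> \<Phi>* - (\<Phi> F) (\<Phi> F)*\<close>; adding \<open>C (l - k \<Phi> \<Phi>*)\<close> gives the positivity
  of \<open>C l - (\<Phi> F) (\<Phi> F)*\<close>, which places \<open>\<Phi> F\<close> in the ball of the same radius.\<close>

lemma contractive_multiplierI:
  assumes k: "psd X k" and l: "psd X l"
    and \<Phi>: "\<And>x. x \<in> X \<Longrightarrow> \<Phi> x \<in> carrier_mat N N"
    and pos: "psd (X \<times> {..<N}) (\<lambda>s t. (if snd s = snd t then l (fst s) (fst t) else 0) -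
      k (fst s) (fst t) * (\<Sum>c<N. \<Phi> (fst s) $$ (snd s, c) * cnj (\<Phi> (fst t) $$ (snd t, c))))"
  shows "\<Phi> \<in> Mult X k l N" "mult_norm X k l N \<Phi> \<le> 1"
proof -
  interpret k: psd_kernel X k by unfold_locales (rule k)
  interpret l: psd_kernel X l by unfold_locales (rule l)
  have main: "mult_apply \<Phi> F \<in> rkhs_vec X l N \<and> rkhs_vec_norm X l N (mult_apply \<Phi> F) \<le> rkhs_vec_norm X k N F"
    if F: "F \<in> rkhs_vec X k N" for F
  proof -
    define f where "f = component X F"
    define g where "g = component X (mult_apply \<Phi> F)"
    define C where "C = (\<Sum>a<N. (k.rkhs.nm (f a))\<^sup>2)"
    have C: "0 \<le> C" by (auto simp: C_def intro: sum_nonneg)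
    have fm: "f a \<in> rkhs X k" if "a < N" for a using F that by (simp add: rkhs_vec_def f_def)
    have Fc: "F x \<in> carrier_vec N" if "x \<in> X" for x using F that by (simp add: rkhs_vec_def)
    have g_eq: "g a x = (\<Sum>c<N. \<Phi> x $$ (a, c) * f c x)" if "a < N" "x \<in> X" for a x
      using that \<Phi>[OF that(2)] Fc[OF that(2)]
      by (auto simp: g_def f_def component_def zero_ext_def mult_apply_def scalar_prod_def lessThan_atLeast0 intro!: sum.cong)
    have g0: "g a x = 0" if "x \<notin> X" for a x using that by (simp add: g_def component_def zero_ext_def)
    let ?A = "\<lambda>s c. \<Phi> (fst s) $$ (snd s, c)"
    have "psd (X \<times> {..<N}) (\<lambda>s t. \<Sum>c<N. \<Sum>d<N. ?A s c * cnj (?A t d) *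
      (of_real C * (if snd (fst s, c) = snd (fst t, d) then k (fst (fst s, c)) (fst (fst t, d)) else 0)
        - f (snd (fst s, c)) (fst (fst s, c)) * cnj (f (snd (fst t, d)) (fst (fst t, d)))))"
      unfolding C_def by (rule psd_combination[OF k.psd_of_components[OF fm]]) auto
    then have 1: "psd (X \<times> {..<N}) (\<lambda>s t. of_real C * (k (fst s) (fst t) * (\<Sum>c<N. ?A s c * cnj (?A t c)))
        - g (snd s) (fst s) * cnj (g (snd t) (fst t)))"
    proof (rule psd_cong_imp)
      fix s t assume st: "s \<in> X \<times> {..<N}" "t \<in> X \<times> {..<N}"
      have "(\<Sum>c<N. \<Sum>d<N. ?A s c * cnj (?A t d) * (of_real C * (if c = d then k (fst s) (fst t) else 0))) =
        (\<Sum>c<N. \<Sum>d<N. if d = c then ?A s c * cnj (?A t d) * (of_real C * k (fst s) (fst t)) else 0)"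
        by (intro sum.cong refl) auto
      also have "\<dots> = of_real C * (k (fst s) (fst t) * (\<Sum>c<N. ?A s c * cnj (?A t c)))"
        by (simp add: sum_distrib_left mult_ac)
      finally have e1: "(\<Sum>c<N. \<Sum>d<N. ?A s c * cnj (?A t d) * (of_real C * (if c = d then k (fst s) (fst t) else 0))) =
        of_real C * (k (fst s) (fst t) * (\<Sum>c<N. ?A s c * cnj (?A t c)))" .
      have "g (snd s) (fst s) * cnj (g (snd t) (fst t)) =
        (\<Sum>c<N. \<Sum>d<N. (?A s c * f c (fst s)) * cnj (?A t d * f d (fst t)))"
        using st by (auto simp: g_eq cnj_sum sum_product)
      also have "\<dots> = (\<Sum>c<N. \<Sum>d<N. ?A s c * cnj (?A t d) * (f c (fst s) * cnj (f d (fst t))))"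
        by (intro sum.cong refl) simp
      finally show "of_real C * (k (fst s) (fst t) * (\<Sum>c<N. ?A s c * cnj (?A t c)))
          - g (snd s) (fst s) * cnj (g (snd t) (fst t)) =
        (\<Sum>c<N. \<Sum>d<N. ?A s c * cnj (?A t d) *
          (of_real C * (if snd (fst s, c) = snd (fst t, d) then k (fst (fst s, c)) (fst (fst t, d)) else 0)
          - f (snd (fst s, c)) (fst (fst s, c)) * cnj (f (snd (fst t, d)) (fst (fst t, d)))))"
        unfolding fst_conv snd_conv right_diff_distrib sum_subtractf e1 by simp
    qed
    have 2: "psd (X \<times> {..<N}) (\<lambda>s t. of_real C * ((if snd s = snd t then l (fst s) (fst t) else 0) -
      k (fst s) (fst t) * (\<Sum>c<N. ?A s c * cnj (?A t c))))"
      by (rule psd_scale[OF pos C])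
    have 3: "psd (X \<times> {..<N}) (\<lambda>s t. of_real C * (if snd s = snd t then l (fst s) (fst t) else 0)
        - g (snd s) (fst s) * cnj (g (snd t) (fst t)))"
      by (rule psd_cong_imp[OF psd_add[OF 1 2]]) (simp only: right_diff_distrib, simp)
    note res = l.components_of_psd[OF C g0 3]
    have "mult_apply \<Phi> F \<in> rkhs_vec X l N"
      using res(1) mult_mat_vec_carrier[OF \<Phi> Fc] by (auto simp: rkhs_vec_def g_def mult_apply_def)
    moreover have "rkhs_vec_norm X l N (mult_apply \<Phi> F) \<le> rkhs_vec_norm X k N F"
      using res(2) by (simp add: rkhs_vec_norm_def C_def f_def g_def)
    ultimately show ?thesis ..
  qed
  then show "\<Phi> \<in> Mult X k l N" using \<Phi> by (auto simp: Mult_def)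
  show "mult_norm X k l N \<Phi> \<le> 1"
    unfolding mult_norm_def
  proof (rule SUP_least)
    fix F assume "F \<in> {F \<in> rkhs_vec X k N. rkhs_vec_norm X k N F \<le> 1}"
    then have "rkhs_vec_norm X l N (mult_apply \<Phi> F) \<le> 1" using main[of F] by auto
    then show "ereal (rkhs_vec_norm X l N (mult_apply \<Phi> F)) \<le> 1" by simp
  qed
qed

text \<open>The converse for scalar multipliers: the adjoint sends the kernel function of \<open>l\<close> at \<open>x\<close> to \<open>cnj (\<phi> x)\<close>
  times that of \<open>k\<close>, and contractivity is tested on the span.\<close>

lemma contractive_scalar_multiplierD:
  assumes k: "psd X k" and l: "psd X l"
    and \<Phi>: "\<Phi> \<in> Mult X k l 1" "mult_norm X k l 1 \<Phi> \<le> 1"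
  shows "psd X (\<lambda>x y. l x y - \<Phi> x $$ (0, 0) * cnj (\<Phi> y $$ (0, 0)) * k x y)"
proof -
  interpret k: psd_kernel X k by unfold_locales (rule k)
  interpret l: psd_kernel X l by unfold_locales (rule l)
  define \<phi> where "\<phi> x = \<Phi> x $$ (0, 0)" for x
  have \<Phi>c: "\<Phi> x \<in> carrier_mat 1 1" if "x \<in> X" for x using \<Phi>(1) that by (simp add: Mult_def)
  let ?M = "\<lambda>f. zero_ext X (\<lambda>x. \<phi> x * f x)"
  have comp: "component X (\<lambda>x. vec 1 (\<lambda>_. f x)) 0 = f" if "f \<in> rkhs X k" for f
    using that k.rkhs_outside[OF k.is_rkhs_rkhs that] by (auto simp: component_def zero_ext_def)
  have appl: "component X (mult_apply \<Phi> (\<lambda>x. vec 1 (\<lambda>_. f x))) 0 = ?M f" for f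
  proof
    fix x show "component X (mult_apply \<Phi> (\<lambda>x. vec 1 (\<lambda>_. f x))) 0 x = ?M f x"
      using \<Phi>c[of x] by (auto simp: component_def zero_ext_def mult_apply_def scalar_prod_def \<phi>_def)
  qed
  have vecm: "(\<lambda>x. vec 1 (\<lambda>_. f x)) \<in> rkhs_vec X k 1" if "f \<in> rkhs X k" for f
    using comp[OF that] that by (simp add: rkhs_vec_def)
  have Mm: "?M f \<in> rkhs X l" if "f \<in> rkhs X k" for f
  proof -
    have "mult_apply \<Phi> (\<lambda>x. vec 1 (\<lambda>_. f x)) \<in> rkhs_vec X l 1"
      using \<Phi>(1) vecm[OF that] unfolding Mult_def by blast
    then have "component X (mult_apply \<Phi> (\<lambda>x. vec 1 (\<lambda>_. f x))) 0 \<in> rkhs X l"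
      unfolding rkhs_vec_def by blast
    then show ?thesis unfolding appl .
  qed
  have unit: "l.rkhs.nm (?M f) \<le> 1" if f: "f \<in> rkhs X k" "k.rkhs.nm f \<le> 1" for f
  proof -
    let ?F = "\<lambda>x. vec 1 (\<lambda>_. f x)"
    have "rkhs_vec_norm X k 1 ?F \<le> 1"
      using f comp[OF f(1)] k.rkhs.nm_nonneg[OF f(1)] by (simp add: rkhs_vec_norm_def)
    then have "ereal (rkhs_vec_norm X l 1 (mult_apply \<Phi> ?F)) \<le> mult_norm X k l 1 \<Phi>"
      unfolding mult_norm_def using vecm[OF f(1)] by (intro SUP_upper) auto
    then have "rkhs_vec_norm X l 1 (mult_apply \<Phi> ?F) \<le> 1" using \<Phi>(2) order_trans by fastforce
    then show ?thesis using appl[of f] l.rkhs.nm_nonneg[OF Mm[OF f(1)]] by (simp add: rkhs_vec_norm_def)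
  qed
  have contr: "l.rkhs.nm (?M f) \<le> k.rkhs.nm f" if f: "f \<in> rkhs X k" for f
  proof (rule dense_ge)
    fix r assume r: "k.rkhs.nm f < r"
    then have r0: "0 < r" using k.rkhs.nm_nonneg[OF f] by simp
    define a where "a = complex_of_real (1 / r)"
    have a: "cmod a = 1 / r" using r0 by (simp add: a_def del: of_real_divide)
    let ?g = "\<lambda>x. a * f x"
    have "k.rkhs.nm ?g \<le> 1" using r r0 by (simp add: k.rkhs.nm_scale[OF f] a)
    then have "l.rkhs.nm (?M ?g) \<le> 1" by (intro unit k.rkhs.scale_mem f)
    moreover have "?M ?g = (\<lambda>x. a * ?M f x)" by (auto simp: zero_ext_def)
    ultimately show "l.rkhs.nm (?M f) \<le> r"
      using r0 by (simp add: l.rkhs.nm_scale[OF Mm[OF f]] a)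
  qed
  show ?thesis unfolding \<phi>_def[symmetric]
  proof (rule psdI)
    fix F c assume F: "finite F" "F \<subseteq> X"
    define v where "v = kernel_combination X l F (\<lambda>y. cnj (c y))"
    define u where "u = kernel_combination X k F (\<lambda>y. cnj (c y * \<phi> y))"
    have vm: "v \<in> rkhs X l" unfolding v_def by (rule l.combination_in_rkhs[OF F])
    have um: "u \<in> rkhs X k" unfolding u_def by (rule k.combination_in_rkhs[OF F])
    have "rkhs_inner X l (?M u) v = (\<Sum>y\<in>F. c y * ?M u y)"
      unfolding v_def using l.inner_combination[OF F Mm[OF um]] by simp
    also have "\<dots> = (\<Sum>y\<in>F. cnj (cnj (c y * \<phi> y)) * u y)"
      using F by (intro sum.cong refl) (auto simp: zero_ext_def)
    also have "\<dots> = rkhs_inner X k u u"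
      using k.inner_combination[OF F um, of "\<lambda>y. cnj (c y * \<phi> y)"] unfolding u_def[symmetric] by simp
    also have "\<dots> = of_real ((k.rkhs.nm u)\<^sup>2)" by (rule k.rkhs.ip_self(1)[OF um])
    finally have "(k.rkhs.nm u)\<^sup>2 \<le> l.rkhs.nm (?M u) * l.rkhs.nm v"
      using l.rkhs.Cauchy_Schwarz[OF Mm[OF um] vm] by (simp add: norm_power)
    also have "\<dots> \<le> k.rkhs.nm u * l.rkhs.nm v"
      by (intro mult_right_mono contr um l.rkhs.nm_nonneg vm)
    finally have "k.rkhs.nm u \<le> l.rkhs.nm v"
      using k.rkhs.nm_nonneg[OF um] l.rkhs.nm_nonneg[OF vm]
      by (cases "k.rkhs.nm u = 0") (auto simp: power2_eq_square)
    then have le: "(k.rkhs.nm u)\<^sup>2 \<le> (l.rkhs.nm v)\<^sup>2" by (intro power_mono k.rkhs.nm_nonneg um)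
    have "(\<Sum>x\<in>F. \<Sum>y\<in>F. c x * cnj (c y) * (l x y - \<phi> x * cnj (\<phi> y) * k x y)) =
      (\<Sum>x\<in>F. \<Sum>y\<in>F. c x * cnj (c y) * l x y) - (\<Sum>x\<in>F. \<Sum>y\<in>F. (c x * \<phi> x) * cnj (c y * \<phi> y) * k x y)"
      unfolding sum_subtractf[symmetric] by (intro sum.cong refl) (simp add: algebra_simps)
    also have "\<dots> = of_real ((l.rkhs.nm v)\<^sup>2 - (k.rkhs.nm u)\<^sup>2)"
      unfolding k.quadratic_form_eq_norm[OF F] l.quadratic_form_eq_norm[OF F] v_def u_def by simp
    finally show "0 \<le> (\<Sum>x\<in>F. \<Sum>y\<in>F. c x * cnj (c y) * (l x y - \<phi> x * cnj (\<phi> y) * k x y))"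
      using le by (simp only: less_eq_complex_def) simp
  qed
qed

section \<open>Extension equations\<close>

text \<open>Orthogonal projection of \<open>b\<close> onto the span of the \<open>v p\<close>, one vector at a time as in the Gram--Schmidt
  process.\<close>

lemma orthogonal_projection_exists:
  fixes v :: "'p \<Rightarrow> 'q \<Rightarrow> complex" and b :: "'q \<Rightarrow> complex"
  assumes "finite P" "finite D"
  shows "\<exists>\<xi>. \<forall>p\<in>P. (\<Sum>q\<in>D. (b q - (\<Sum>p'\<in>P. \<xi> p' * v p' q)) * cnj (v p q)) = 0"
  using assms(1)
proof (induction P arbitrary: b rule: finite_induct)
  case empty
  then show ?case by simp
next
  case (insert p0 P)
  obtain \<eta> where \<eta>: "\<And>p. p \<in> P \<Longrightarrow> (\<Sum>q\<in>D. (v p0 q - (\<Sum>p'\<in>P. \<eta> p' * v p' q)) * cnj (v p q)) = 0"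
    using insert.IH[of "v p0"] by blast
  obtain \<zeta> where \<zeta>: "\<And>p. p \<in> P \<Longrightarrow> (\<Sum>q\<in>D. (b q - (\<Sum>p'\<in>P. \<zeta> p' * v p' q)) * cnj (v p q)) = 0"
    using insert.IH[of b] by blast
  define r where "r q = v p0 q - (\<Sum>p'\<in>P. \<eta> p' * v p' q)" for q
  define e where "e q = b q - (\<Sum>p'\<in>P. \<zeta> p' * v p' q)" for q
  define R where "R = (\<Sum>q\<in>D. r q * cnj (r q))"
  define t where "t = (\<Sum>q\<in>D. e q * cnj (r q)) / R"
  have tR: "(\<Sum>q\<in>D. e q * cnj (r q)) = t * R"
  proof (cases "R = 0")
    case True
    have "(\<Sum>q\<in>D. (cmod (r q))\<^sup>2) = Re R"
      unfolding R_def complex_norm_square[symmetric] by (simp flip: of_real_sum of_real_power)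
    then have "r q = 0" if "q \<in> D" for q
      using True that assms(2) sum_nonneg_eq_0_iff[of D "\<lambda>q. (cmod (r q))\<^sup>2"] by simp
    then show ?thesis using True by simp
  qed (simp add: t_def)
  define \<xi> where "\<xi> p = (if p = p0 then t else \<zeta> p - t * \<eta> p)" for p
  have res: "b q - (\<Sum>p'\<in>insert p0 P. \<xi> p' * v p' q) = e q - t * r q" for q
  proof -
    have "(\<Sum>p'\<in>P. \<xi> p' * v p' q) = (\<Sum>p'\<in>P. \<zeta> p' * v p' q - t * (\<eta> p' * v p' q))"
      using insert.hyps by (intro sum.cong refl) (auto simp: \<xi>_def algebra_simps)
    then show ?thesis using insert.hyps
      by (simp add: e_def r_def \<xi>_def[of p0] sum_subtractf sum_distrib_left[symmetric] algebra_simps)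
  qed
  have orth: "(\<Sum>q\<in>D. (e q - t * r q) * cnj (v p q)) = 0" if "p \<in> P" for p
  proof -
    have "(\<Sum>q\<in>D. (e q - t * r q) * cnj (v p q)) = (\<Sum>q\<in>D. e q * cnj (v p q)) - t * (\<Sum>q\<in>D. r q * cnj (v p q))"
      by (simp add: algebra_simps sum_subtractf sum_distrib_left)
    then show ?thesis using \<eta>[OF that] \<zeta>[OF that] by (simp add: e_def r_def)
  qed
  have "(\<Sum>q\<in>D. (e q - t * r q) * cnj (v p0 q)) = 0"
  proof -
    have v0: "v p0 q = r q + (\<Sum>p'\<in>P. \<eta> p' * v p' q)" for q by (simp add: r_def)
    have "(\<Sum>q\<in>D. (e q - t * r q) * cnj (v p0 q)) =
      (\<Sum>q\<in>D. (e q - t * r q) * cnj (r q)) + (\<Sum>q\<in>D. \<Sum>p'\<in>P. cnj (\<eta> p') * ((e q - t * r q) * cnj (v p' q)))"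
      unfolding v0 by (simp add: distrib_left sum.distrib sum_distrib_left mult_ac)
    also have "(\<Sum>q\<in>D. \<Sum>p'\<in>P. cnj (\<eta> p') * ((e q - t * r q) * cnj (v p' q))) =
      (\<Sum>p'\<in>P. cnj (\<eta> p') * (\<Sum>q\<in>D. (e q - t * r q) * cnj (v p' q)))"
      by (subst sum.swap) (simp add: sum_distrib_left)
    also have "\<dots> = 0" using orth by simp
    also have "(\<Sum>q\<in>D. (e q - t * r q) * cnj (r q)) = 0"
      using tR by (simp add: left_diff_distrib sum_subtractf R_def sum_distrib_left mult.assoc)
    finally show ?thesis by simp
  qed
  then show ?case using orth unfolding res[symmetric] by (intro exI[of _ \<xi>]) auto
qed

text \<open>The Fredholm alternative for square linear systems: the residual of the orthogonal projection of \<open>b\<close>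
  onto the span of the rows of \<open>A\<close> lies in the cokernel, hence is orthogonal to \<open>b\<close> and so to itself.\<close>

lemma linear_system_solvable:
  fixes A :: "'d \<Rightarrow> 'd \<Rightarrow> complex"
  assumes D: "finite D"
    and ker: "\<And>r. (\<And>p. p \<in> D \<Longrightarrow> (\<Sum>q\<in>D. r q * cnj (A p q)) = 0) \<Longrightarrow> (\<Sum>q\<in>D. r q * cnj (b q)) = 0"
  shows "\<exists>\<xi>. \<forall>q\<in>D. (\<Sum>p\<in>D. \<xi> p * A p q) = b q"
proof -
  obtain \<xi> where \<xi>: "\<And>p. p \<in> D \<Longrightarrow> (\<Sum>q\<in>D. (b q - (\<Sum>p'\<in>D. \<xi> p' * A p' q)) * cnj (A p q)) = 0"
    using orthogonal_projection_exists[OF D D, of b A] by blast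
  define r where "r q = b q - (\<Sum>p\<in>D. \<xi> p * A p q)" for q
  have o: "(\<Sum>q\<in>D. r q * cnj (A p q)) = 0" if "p \<in> D" for p using \<xi>[OF that] by (simp add: r_def)
  have "(\<Sum>q\<in>D. r q * cnj (r q)) =
      (\<Sum>q\<in>D. r q * cnj (b q)) - (\<Sum>q\<in>D. \<Sum>p\<in>D. cnj (\<xi> p) * (r q * cnj (A p q)))"
    unfolding sum_subtractf[symmetric]
  proof (intro sum.cong refl, goal_cases)
    case (1 q)
    have "cnj (r q) = cnj (b q) - (\<Sum>p\<in>D. cnj (\<xi> p) * cnj (A p q))" by (simp add: r_def)
    then show ?case by (simp add: right_diff_distrib sum_distrib_left mult_ac)
  qed
  also have "(\<Sum>q\<in>D. \<Sum>p\<in>D. cnj (\<xi> p) * (r q * cnj (A p q))) = (\<Sum>p\<in>D. cnj (\<xi> p) * (\<Sum>q\<in>D. r q * cnj (A p q)))"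
    by (subst sum.swap) (simp add: sum_distrib_left)
  also have "\<dots> = 0" using o by simp
  also have "(\<Sum>q\<in>D. r q * cnj (b q)) = 0" by (rule ker) (rule o)
  finally have "(\<Sum>q\<in>D. r q * cnj (r q)) = 0" by simp
  moreover have "Re (\<Sum>q\<in>D. r q * cnj (r q)) = (\<Sum>q\<in>D. (cmod (r q))\<^sup>2)"
    unfolding complex_norm_square[symmetric] by (simp flip: of_real_sum of_real_power)
  ultimately have "(\<Sum>q\<in>D. (cmod (r q))\<^sup>2) = 0" by simp
  then have "r q = 0" if "q \<in> D" for q
    using that D sum_nonneg_eq_0_iff[of D "\<lambda>q. (cmod (r q))\<^sup>2"] by simp
  then show ?thesis unfolding r_def by (intro exI[of _ \<xi>]) auto
qed

text \<open>If the pairings of each vector \<open>y\<close> with the finite family \<open>D\<close> agree with those of the combination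
  \<open>\<xi> y\<close> of that family, subtracting the combination is an orthogonal projection and lowers the Gram
  kernel by the Gram kernel of the combinations.\<close>

lemma psd_minus_projection:
  assumes K: "psd S K" and D: "finite D" "D \<subseteq> S" and T: "T \<subseteq> S"
    and eq: "\<And>y q. y \<in> T \<Longrightarrow> q \<in> D \<Longrightarrow> K y q = (\<Sum>p\<in>D. \<xi> y p * K p q)"
  shows "psd T (\<lambda>y y'. K y y' - (\<Sum>p\<in>D. \<Sum>q\<in>D. \<xi> y p * cnj (\<xi> y' q) * K p q))"
proof -
  define A where "A y i = (case i of None \<Rightarrow> 1 | Some p \<Rightarrow> - \<xi> y p)" for y and i :: "'a option"
  define g where "g y i = (case i of None \<Rightarrow> y | Some p \<Rightarrow> p)" for y and i :: "'a option"
  let ?I = "insert None (Some ` D)"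
  have I: "sum f ?I = f None + (\<Sum>p\<in>D. f (Some p))" for f :: "'a option \<Rightarrow> complex"
    using D(1) by (simp add: sum.reindex)
  have "psd T (\<lambda>y y'. \<Sum>i\<in>?I. \<Sum>j\<in>?I. A y i * cnj (A y' j) * K (g y i) (g y' j))"
    using D T by (intro psd_combination[OF K]) (auto simp: g_def)
  then show ?thesis
  proof (rule psd_cong_imp)
    fix y y' assume y: "y \<in> T" "y' \<in> T"
    let ?Q = "\<Sum>p\<in>D. \<Sum>q\<in>D. \<xi> y p * cnj (\<xi> y' q) * K p q"
    have 1: "(\<Sum>q\<in>D. cnj (\<xi> y' q) * K y q) = ?Q"
    proof -
      have "(\<Sum>q\<in>D. cnj (\<xi> y' q) * K y q) = (\<Sum>q\<in>D. \<Sum>p\<in>D. \<xi> y p * cnj (\<xi> y' q) * K p q)"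
        using y by (intro sum.cong refl) (simp add: eq sum_distrib_left mult_ac)
      then show ?thesis by (subst sum.swap)
    qed
    have 2: "(\<Sum>p\<in>D. \<xi> y p * K p y') = ?Q"
    proof (intro sum.cong refl, goal_cases)
      case (1 p)
      have "K p y' = cnj (K y' p)" using psd_hermitian[OF K, of y' p] 1 y D T by blast
      also have "\<dots> = (\<Sum>q\<in>D. cnj (\<xi> y' q) * cnj (K q p))" using eq[OF y(2) 1] by simp
      also have "\<dots> = (\<Sum>q\<in>D. cnj (\<xi> y' q) * K p q)"
        using psd_hermitian[OF K] 1 D by (intro sum.cong refl) (metis subsetD)
      finally show ?case by (simp add: sum_distrib_left mult_ac)
    qed
    show "K y y' - ?Q = (\<Sum>i\<in>?I. \<Sum>j\<in>?I. A y i * cnj (A y' j) * K (g y i) (g y' j))"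
      unfolding I using 1 2 by (simp add: A_def g_def sum_negf sum.distrib sum_subtractf)
  qed
qed

lemma psd_delta_except: "psd UNIV (\<lambda>i j. if i = j \<and> i \<noteq> a then 1 else 0)"
proof (rule psdI)
  fix F :: "'a set" and c assume F: "finite F"
  have "(\<Sum>x\<in>F. \<Sum>y\<in>F. c x * cnj (c y) * (if x = y \<and> x \<noteq> a then 1 else 0)) =
    (\<Sum>x\<in>F. \<Sum>y\<in>F. if y = x then (if x \<noteq> a then c x * cnj (c x) else 0) else 0)"
    by (intro sum.cong refl) auto
  also have "\<dots> = (\<Sum>x\<in>F. if x \<noteq> a then c x * cnj (c x) else 0)" using F by simp
  also have "0 \<le> \<dots>" by (intro sum_nonneg) (simp add: complex_mult_cnj_nonneg)
  finally show "0 \<le> (\<Sum>x\<in>F. \<Sum>y\<in>F. c x * cnj (c y) * (if x = y \<and> x \<noteq> a then 1 else 0))" .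
qed

text \<open>\<open>h x y\<close> dominates \<open>h x z h z y / h z z\<close>, the part that the point \<open>z\<close> sees.\<close>

lemma psd_scaled_minus_section:
  assumes h: "psd X h" and z: "z \<in> X" and \<rho>: "Re (h z z) \<le> \<rho>"
  shows "psd X (\<lambda>x y. of_real \<rho> * h x y - h x z * h z y)"
proof (cases "h z z = 0")
  case True
  have "h x z = 0" if "x \<in> X" for x using psd_Cauchy_Schwarz[OF h that z] True by simp
  moreover have "0 \<le> \<rho>" using True \<rho> by simp
  ultimately show ?thesis by (intro psd_cong_imp[OF psd_scale[OF h]]) auto
next
  case False
  have "psd X (\<lambda>x y. of_real (Re (h z z)) * (h x y - h x z * h z y / h z z) + of_real (\<rho> - Re (h z z)) * h x y)"
    using psd_diagonal_real(2)[OF h z] \<rho>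
    by (intro psd_add psd_scale psd_Schur_complement h z False) auto
  then show ?thesis
  proof (rule psd_cong_imp)
    fix x y
    have "complex_of_real (Re (h z z)) = h z z" using psd_diagonal_real(1)[OF h z] by simp
    then show "of_real \<rho> * h x y - h x z * h z y =
      of_real (Re (h z z)) * (h x y - h x z * h z y / h z z) + of_real (\<rho> - Re (h z z)) * h x y"
      using False by (simp add: algebra_simps)
  qed
qed

text \<open>Keeping the two coefficient vectors apart lets the estimates below speak of inner products as well as
  of norms.\<close>

definition form :: "'d set \<Rightarrow> ('d \<Rightarrow> complex) \<Rightarrow> ('d \<Rightarrow> complex) \<Rightarrow> ('d \<Rightarrow> 'd \<Rightarrow> complex) \<Rightarrow> complex" where
  "form D f g K = (\<Sum>q\<in>D. \<Sum>p\<in>D. f q * cnj (g p) * K q p)"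

lemma form_add: "form D f g (\<lambda>q p. K q p + L q p) = form D f g K + form D f g L"
  by (simp add: form_def algebra_simps sum.distrib)

lemma form_diff: "form D f g (\<lambda>q p. K q p - L q p) = form D f g K - form D f g L"
  by (simp add: form_def algebra_simps sum_subtractf)

lemma form_scale: "form D f g (\<lambda>q p. a * K q p) = a * form D f g K"
  by (simp add: form_def sum_distrib_left mult_ac)

lemma form_nonneg: "finite D \<Longrightarrow> psd D K \<Longrightarrow> 0 \<le> Re (form D f f K)"
  using psdD[of D K D f] by (simp add: form_def less_eq_complex_def)

lemma form_cong: "(\<And>q p. q \<in> D \<Longrightarrow> p \<in> D \<Longrightarrow> K q p = L q p) \<Longrightarrow> form D f g K = form D f g L"
  unfolding form_def by (intro sum.cong refl) auto

text \<open>The semi-norm given by \<open>K\<close> is nonnegative at \<open>u f - f\<close>.\<close>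

lemma form_polarization:
  assumes D: "finite D" and K: "psd D K"
  shows "2 * Re (form D (\<lambda>q. u q * f q) f K) \<le>
    Re (form D f f K) + Re (form D (\<lambda>q. u q * f q) (\<lambda>q. u q * f q) K)"
proof -
  let ?g = "\<lambda>q. u q * f q"
  have "0 \<le> Re (form D (\<lambda>q. ?g q - f q) (\<lambda>q. ?g q - f q) K)" by (rule form_nonneg[OF D K])
  also have "form D (\<lambda>q. ?g q - f q) (\<lambda>q. ?g q - f q) K = form D ?g ?g K - form D ?g f K - form D f ?g K + form D f f K"
    by (simp add: form_def algebra_simps sum_subtractf sum.distrib)
  also have "form D f ?g K = cnj (form D ?g f K)"
  proof -
    have "cnj (form D ?g f K) = (\<Sum>q\<in>D. \<Sum>p\<in>D. cnj (?g q) * f p * K p q)"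
      unfolding form_def cnj_sum
    proof (intro sum.cong refl, goal_cases)
      case (1 q p)
      have "cnj (K q p) = K p q" using psd_hermitian[OF K 1] by simp
      then show ?case by simp
    qed
    also have "\<dots> = form D f ?g K" unfolding form_def by (subst sum.swap) (simp add: mult.commute[of "f _"])
    finally show ?thesis ..
  qed
  finally show ?thesis by simp
qed

lemma weighted_form_bound:
  assumes h: "psd X h" and w: "psd D w" and D: "finite D" and pt: "\<And>q. q \<in> D \<Longrightarrow> pt q \<in> X"
    and z: "z \<in> X" "Re (h z z) \<le> \<rho>"
  shows "Re (form D (\<lambda>q. h (pt q) z * r q) (\<lambda>q. h (pt q) z * r q) w) \<le>
    \<rho> * Re (form D r r (\<lambda>q q'. h (pt q) (pt q') * w q q'))"
proof -
  let ?u = "\<lambda>q. h (pt q) z"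
  have "psd D (\<lambda>q q'. (of_real \<rho> * h (pt q) (pt q') - ?u q * h z (pt q')) * w q q')"
    using pt by (intro psd_mult w psd_reindex[OF psd_scaled_minus_section[OF h z]]) auto
  then have "0 \<le> Re (form D r r (\<lambda>q q'. (of_real \<rho> * h (pt q) (pt q') - ?u q * h z (pt q')) * w q q'))"
    by (rule form_nonneg[OF D])
  also have "form D r r (\<lambda>q q'. (of_real \<rho> * h (pt q) (pt q') - ?u q * h z (pt q')) * w q q') =
    form D r r (\<lambda>q q'. of_real \<rho> * (h (pt q) (pt q') * w q q') - ?u q * cnj (?u q') * w q q')"
    using psd_hermitian[OF h _ z(1)] pt by (intro form_cong) (simp add: algebra_simps)
  also have "\<dots> = of_real \<rho> * form D r r (\<lambda>q q'. h (pt q) (pt q') * w q q') -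
      form D (\<lambda>q. ?u q * r q) (\<lambda>q. ?u q * r q) w"
    unfolding form_diff form_scale by (simp add: form_def mult_ac)
  finally show ?thesis by simp
qed

text \<open>The identity \<open>data\<close> says that the vectors with Gram kernel \<open>w + \<Gamma>\<close> are the images, under an isometry
  \<open>V\<close>, of vectors with the Gram kernel on the right-hand side. Applying \<open>V\<close>, extended by zero to the
  orthogonal complement, to the vector that belongs to a new point \<open>z\<close> and a new row \<open>a\<close> leads to a fixed
  point equation, because that vector is built from the unknown itself; in coordinates with respect to
  the data it is the linear system below.

  A vector \<open>r\<close> in the cokernel has energy \<open>g\<close> in the semi-norm of \<open>w + \<Gamma>\<close>. Orthogonality bounds \<open>g\<close> by the
  energy of \<open>r\<close> weighted with \<open>h (\<cdot>, z)\<close> and \<open>p (\<cdot>, z)\<close>, hence by \<open>\<rho> (g - \<sigma>)\<close>, where \<open>\<rho> < 1\<close> bounds the diagonals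
  at \<open>z\<close> and \<open>\<sigma> \<ge> 0\<close> comes from the constant term of \<open>data\<close>. So \<open>\<sigma>\<close> vanishes, which is the orthogonality of
  \<open>r\<close> to the right-hand side.\<close>

lemma extension_equation_solvable:
  fixes lab :: "'d \<Rightarrow> nat"
  assumes h: "psd X h" and p: "psd X p" and D: "finite D" and pt: "\<And>q. q \<in> D \<Longrightarrow> pt q \<in> X"
    and w: "psd D w" and \<Gamma>: "psd D \<Gamma>" and z: "z \<in> X" "Re (h z z) < 1" "Re (p z z) < 1"
    and data: "\<And>q q'. q \<in> D \<Longrightarrow> q' \<in> D \<Longrightarrow> w q q' + \<Gamma> q q' =
      (if lab q = lab q' then 1 else 0) + h (pt q) (pt q') * w q q' + p (pt q) (pt q') * \<Gamma> q q'"
  shows "\<exists>\<xi>. \<forall>q\<in>D. (\<Sum>q'\<in>D. \<xi> q' * ((1 - h z (pt q)) * w q' q + (1 - p z (pt q)) * \<Gamma> q' q)) =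
    (if a = lab q then 1 else 0)"
proof (rule linear_system_solvable[OF D])
  fix r assume r: "\<And>q'. q' \<in> D \<Longrightarrow>
    (\<Sum>q\<in>D. r q * cnj ((1 - h z (pt q)) * w q' q + (1 - p z (pt q)) * \<Gamma> q' q)) = 0"
  define u where "u q = h (pt q) z" for q
  define v where "v q = p (pt q) z" for q
  define \<rho> where "\<rho> = max (Re (h z z)) (Re (p z z))"
  have \<rho>: "0 \<le> \<rho>" "\<rho> < 1" "Re (h z z) \<le> \<rho>" "Re (p z z) \<le> \<rho>"
    using z psd_diagonal_real(2)[OF h z(1)] by (auto simp: \<rho>_def)
  let ?d = "\<lambda>q q'. if lab q = lab q' then 1 else (0::complex)"
  let ?h = "\<lambda>q q'. h (pt q) (pt q')" and ?p = "\<lambda>q q'. p (pt q) (pt q')"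
  let ?ur = "\<lambda>q. u q * r q" and ?vr = "\<lambda>q. v q * r q"
  define g where "g = Re (form D r r w) + Re (form D r r \<Gamma>)"
  define Hw where "Hw = Re (form D r r (\<lambda>q q'. ?h q q' * w q q'))"
  define Pg where "Pg = Re (form D r r (\<lambda>q q'. ?p q q' * \<Gamma> q q'))"
  define \<sigma> where "\<sigma> = Re (form D r r ?d)"
  have hD: "psd D ?h" "psd D ?p" using pt by (auto intro!: psd_reindex[OF h] psd_reindex[OF p])
  have Hw0: "0 \<le> Hw" "0 \<le> Pg"
    unfolding Hw_def Pg_def using hD w \<Gamma> by (auto intro!: form_nonneg[OF D] psd_mult)
  have g_eq: "g = \<sigma> + Hw + Pg"
    unfolding g_def \<sigma>_def Hw_def Pg_def plus_complex.sel(1)[symmetric] form_add[symmetric]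
    using data by (intro arg_cong[of _ _ Re] form_cong) simp
  have balance: "form D ?ur r w + form D ?vr r \<Gamma> = form D r r w + form D r r \<Gamma>"
  proof -
    have "(\<Sum>q'\<in>D. cnj (r q') * (\<Sum>q\<in>D. r q * cnj ((1 - h z (pt q)) * w q' q + (1 - p z (pt q)) * \<Gamma> q' q))) = 0"
      using r by simp
    also have "(\<Sum>q'\<in>D. cnj (r q') * (\<Sum>q\<in>D. r q * cnj ((1 - h z (pt q)) * w q' q + (1 - p z (pt q)) * \<Gamma> q' q))) =
      (\<Sum>q'\<in>D. \<Sum>q\<in>D. r q * cnj (r q') * ((1 - u q) * w q q' + (1 - v q) * \<Gamma> q q'))"
      unfolding sum_distrib_left
    proof (intro sum.cong refl, goal_cases)
      case (1 q' q)
      have "cnj (h z (pt q)) = u q" "cnj (p z (pt q)) = v q"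
        using psd_hermitian[OF h z(1) pt[OF 1(2)]] psd_hermitian[OF p z(1) pt[OF 1(2)]] by (auto simp: u_def v_def)
      moreover have "cnj (w q' q) = w q q'" "cnj (\<Gamma> q' q) = \<Gamma> q q'"
        using psd_hermitian[OF w 1(1,2)] psd_hermitian[OF \<Gamma> 1(1,2)] by auto
      ultimately show ?case by (simp add: mult_ac)
    qed
    also have "\<dots> = (\<Sum>q\<in>D. \<Sum>q'\<in>D. r q * cnj (r q') * ((1 - u q) * w q q' + (1 - v q) * \<Gamma> q q'))"
      by (rule sum.swap)
    also have "\<dots> = form D r r w + form D r r \<Gamma> - (form D ?ur r w + form D ?vr r \<Gamma>)"
      by (simp add: form_def algebra_simps sum_subtractf sum.distrib)
    finally show ?thesis by simp
  qed
  have "Re (form D ?ur r w) + Re (form D ?vr r \<Gamma>) = g"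
    using arg_cong[OF balance, of Re] by (simp add: g_def)
  then have "g \<le> Re (form D ?ur ?ur w) + Re (form D ?vr ?vr \<Gamma>)"
    using form_polarization[OF D w, of u r] form_polarization[OF D \<Gamma>, of v r] unfolding g_def by linarith
  also have "Re (form D ?ur ?ur w) \<le> \<rho> * Hw"
    unfolding Hw_def u_def by (rule weighted_form_bound[OF h w D pt z(1) \<rho>(3)])
  also have "Re (form D ?vr ?vr \<Gamma>) \<le> \<rho> * Pg"
    unfolding Pg_def v_def by (rule weighted_form_bound[OF p \<Gamma> D pt z(1) \<rho>(4)])
  finally have gle: "g \<le> \<rho> * (Hw + Pg)" by (simp add: algebra_simps)
  have l: "(cmod (\<Sum>q\<in>D. if lab q = a then r q else 0))\<^sup>2 \<le> \<sigma>"
  proof -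
    let ?e = "\<lambda>q. if lab q = a then 1 else (0::complex)"
    have "psd D (\<lambda>q q'. if lab q = lab q' \<and> lab q \<noteq> a then 1 else (0::complex))"
      by (rule psd_reindex[OF psd_delta_except]) auto
    then have "0 \<le> Re (form D r r (\<lambda>q q'. if lab q = lab q' \<and> lab q \<noteq> a then 1 else 0))"
      by (rule form_nonneg[OF D])
    also have "form D r r (\<lambda>q q'. if lab q = lab q' \<and> lab q \<noteq> a then 1 else 0) =
        form D r r (\<lambda>q q'. 1 * ?d q q' - ?e q * cnj (?e q'))"
      by (intro form_cong) auto
    also have "\<dots> = 1 * form D r r ?d - of_real ((cmod (\<Sum>q\<in>D. r q * ?e q))\<^sup>2)"
      unfolding form_def by (rule quadratic_form_minus_rank_one)
    also have "(\<Sum>q\<in>D. r q * ?e q) = (\<Sum>q\<in>D. if lab q = a then r q else 0)"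
      by (intro sum.cong refl) simp
    finally show ?thesis by (simp add: \<sigma>_def)
  qed
  have "\<rho> * (Hw + Pg) \<le> 1 * (Hw + Pg)" using \<rho> Hw0 by (intro mult_right_mono) auto
  then have "\<sigma> \<le> 0" using gle g_eq by simp
  then have "(cmod (\<Sum>q\<in>D. if lab q = a then r q else 0))\<^sup>2 \<le> 0" using l by linarith
  then have "(\<Sum>q\<in>D. if lab q = a then r q else 0) = 0" by simp
  moreover have "(\<Sum>q\<in>D. r q * cnj (if a = lab q then 1 else 0)) = (\<Sum>q\<in>D. if lab q = a then r q else 0)"
    by (intro sum.cong refl) auto
  ultimately show "(\<Sum>q\<in>D. r q * cnj (if a = lab q then 1 else 0)) = 0" by simp
qed

section \<open>Complete Pick pairs from factorizations\<close>

lemma mult_adjoint_entry: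
  assumes "A \<in> carrier_mat N N" "B \<in> carrier_mat N N" "a < N" "b < N"
  shows "(A * mat_adjoint B) $$ (a, b) = (\<Sum>c<N. A $$ (a, c) * cnj (B $$ (b, c)))"
  using assms by (auto simp: mat_adjoint_def scalar_prod_def mat_of_rows_def lessThan_atLeast0 intro!: sum.cong)

lemma block_index_less: "i < n \<Longrightarrow> a < N \<Longrightarrow> i * N + a < n * (N::nat)"
  by (metis add.commute add_less_cancel_left less_le_trans mult.commute mult_Suc_right mult_le_mono2 Suc_leI)

lemma pick_matrix_entry:
  assumes "i < n" "j < n" "a < N" "b < N" "W i \<in> carrier_mat N N" "W j \<in> carrier_mat N N"
  shows "pick_matrix k l n N z W $$ (i * N + a, j * N + b) =
    (if a = b then l (z i) (z j) else 0) - k (z i) (z j) * (\<Sum>c<N. W i $$ (a, c) * cnj (W j $$ (b, c)))"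
proof -
  have d: "(i * N + a) div N = i" "(i * N + a) mod N = a" "(j * N + b) div N = j" "(j * N + b) mod N = b"
    using assms by auto
  have "dim_row (W i * mat_adjoint (W j)) = N" "dim_col (W i * mat_adjoint (W j)) = N"
    using assms(5,6) by (auto simp: mat_adjoint_def)
  then show ?thesis
    using block_index_less[OF assms(1,3)] block_index_less[OF assms(2,4)] assms
    by (simp add: pick_matrix_def Let_def d mult_adjoint_entry del: index_mult_mat(1))
qed

lemma psd_of_pick_matrix:
  assumes pos: "pos_semidef (pick_matrix k l n N z W)" and W: "\<And>i. i < n \<Longrightarrow> W i \<in> carrier_mat N N"
  shows "psd ({..<n} \<times> {..<N}) (\<lambda>p q. (if snd p = snd q then l (z (fst p)) (z (fst q)) else 0) -
    k (z (fst p)) (z (fst q)) * (\<Sum>c<N. W (fst p) $$ (snd p, c) * cnj (W (fst q) $$ (snd q, c))))"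
proof -
  let ?P = "pick_matrix k l n N z W"
  have "?P = mat (n * N) (n * N) (\<lambda>(i, j). ?P $$ (i, j))"
    unfolding pick_matrix_def by (rule eq_matI) auto
  then have "psd {..<n * N} (\<lambda>i j. ?P $$ (i, j))"
    using pos pos_semidef_iff_psd[of "n * N" "\<lambda>(i, j). ?P $$ (i, j)"] by simp
  then have "psd ({..<n} \<times> {..<N}) (\<lambda>p q. ?P $$ (fst p * N + snd p, fst q * N + snd q))"
    by (rule psd_reindex) (auto intro: block_index_less)
  then show ?thesis
    by (rule psd_cong_imp) (auto simp: pick_matrix_entry W)
qed

text \<open>Positivity of the Pick matrix forces equal targets at repeated nodes, because the first
  kernel does not vanish on the diagonal.\<close>

lemma equal_targets_at_equal_nodes:
  assumes pick: "pos_semidef (pick_matrix k l n N z W)"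
    and W: "\<And>i. i < n \<Longrightarrow> W i \<in> carrier_mat N N"
    and ij: "i < n" "j < n" "z i = z j" and k: "0 < Re (k (z i) (z i))" "Im (k (z i) (z i)) = 0"
  shows "W i = W j"
proof (rule eq_matI)
  have pos: "psd ({..<n} \<times> {..<N}) (\<lambda>p q. (if snd p = snd q then l (z (fst p)) (z (fst q)) else 0) -
      k (z (fst p)) (z (fst q)) * (\<Sum>c<N. W (fst p) $$ (snd p, c) * cnj (W (fst q) $$ (snd q, c))))"
    by (intro psd_of_pick_matrix pick W)
  fix a b assume "a < dim_row (W j)" "b < dim_col (W j)"
  then have ab: "a < N" "b < N" using W[OF ij(2)] by auto
  let ?D = "\<lambda>c. W i $$ (a, c) - W j $$ (a, c)"
  have "0 \<le> 1 * cnj 1 * ((if a = a then l (z i) (z i) else 0) - k (z i) (z i) * (\<Sum>c<N. W i $$ (a, c) * cnj (W i $$ (a, c)))) +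
     1 * cnj (-1) * ((if a = a then l (z i) (z j) else 0) - k (z i) (z j) * (\<Sum>c<N. W i $$ (a, c) * cnj (W j $$ (a, c)))) +
     (-1) * cnj 1 * ((if a = a then l (z j) (z i) else 0) - k (z j) (z i) * (\<Sum>c<N. W j $$ (a, c) * cnj (W i $$ (a, c)))) +
     (-1) * cnj (-1) * ((if a = a then l (z j) (z j) else 0) - k (z j) (z j) * (\<Sum>c<N. W j $$ (a, c) * cnj (W j $$ (a, c))))"
    using psd_two_points[OF pos, of "(i, a)" "(j, a)" 1 "-1"] ij ab unfolding fst_conv snd_conv by simp
  also have "\<dots> = - k (z i) (z i) * (\<Sum>c<N. ?D c * cnj (?D c))"
    unfolding ij(3)[symmetric] by (simp add: algebra_simps sum.distrib sum_subtractf)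
  also have "(\<Sum>c<N. ?D c * cnj (?D c)) = of_real (\<Sum>c<N. (cmod (?D c))\<^sup>2)"
    unfolding of_real_sum complex_norm_square ..
  finally have "0 \<le> - (Re (k (z i) (z i)) * (\<Sum>c<N. (cmod (?D c))\<^sup>2))"
    using k(2) by (simp add: less_eq_complex_def)
  moreover have nn: "0 \<le> (\<Sum>c<N. (cmod (?D c))\<^sup>2)" by (intro sum_nonneg) simp
  ultimately have "(\<Sum>c<N. (cmod (?D c))\<^sup>2) = 0"
    using k(1) mult_pos_pos[of "Re (k (z i) (z i))" "\<Sum>c<N. (cmod (?D c))\<^sup>2"] by linarith
  then have "(cmod (?D b))\<^sup>2 = 0" using ab sum_nonneg_eq_0_iff[of "{..<N}" "\<lambda>c. (cmod (?D c))\<^sup>2"] by simp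
  then show "W i $$ (a, b) = W j $$ (a, b)" by simp
qed (use W[OF ij(1)] W[OF ij(2)] in auto)

lemma sum_indicator_mult:
  assumes "finite D" "q \<in> D" shows "(\<Sum>p\<in>D. (if p = q then 1 else 0) * f p) = (f q :: complex)"
proof -
  have "(\<Sum>p\<in>D. (if p = q then 1 else 0) * f p) = (\<Sum>p\<in>D. if p = q then f p else 0)"
    by (intro sum.cong) auto
  then show ?thesis using assms by simp
qed

text \<open>Divided by \<open>s\<close>, positivity of the Pick matrix of \<open>(k, s)\<close> becomes the identity
  \<open>w + \<Gamma> = I + h w + p \<Gamma>\<close> between Gram kernels, where \<open>w = W W*\<close> and \<open>\<Gamma>\<close> is the Pick matrix. Each row of \<open>\<Phi> (x)\<close> at
  a new point \<open>x\<close> is a combination, with coefficients \<open>\<xi>\<close> solving the extension equation, of the rows of the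
  \<open>W i\<close>; at a node the coefficients are those of the prescribed row. Projecting orthogonally onto the data
  then gives the positivity of \<open>I - (1 - h) \<Phi> \<Phi>* - (1 - p) \<Gamma>'\<close>, with \<open>\<Gamma>'\<close> the same combination of \<open>\<Gamma>\<close>. Its
  product with \<open>s = 1 / (1 - p)\<close> is \<open>s I - k \<Phi> \<Phi>* - \<Gamma>'\<close>, and \<open>\<Gamma>'\<close> is positive, so \<open>\<Phi>\<close> is a contractive multiplier.\<close>

lemma complete_pick_pairI:
  fixes X :: "'a set"
  assumes X: "X \<noteq> {}" and p: "psd X p" "\<And>x. x \<in> X \<Longrightarrow> Re (p x x) < 1"
    and h: "psd X h" "\<And>x. x \<in> X \<Longrightarrow> Re (h x x) < 1"
    and s: "\<And>x y. x \<in> X \<Longrightarrow> y \<in> X \<Longrightarrow> s x y = 1 / (1 - p x y)"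
    and k: "psd X k" "\<And>x y. x \<in> X \<Longrightarrow> y \<in> X \<Longrightarrow> k x y = (1 - h x y) * s x y"
  shows "complete_pick_pair X k s"
proof -
  have ps: "psd X s" using psd_cong_imp[OF psd_geometric[OF p]] s by blast
  have sp: "s x y * (1 - p x y) = 1" if "x \<in> X" "y \<in> X" for x y
    using s[OF that] psd_less_one[OF p that] by auto
  have kpos: "0 < Re (k x x)" "Im (k x x) = 0" if x: "x \<in> X" for x
  proof -
    have "k x x = of_real ((1 - Re (h x x)) / (1 - Re (p x x)))"
      using k(2)[OF x x] s[OF x x] psd_diagonal_real(1)[OF h(1) x] psd_diagonal_real(1)[OF p(1) x]
      by (metis of_real_1 of_real_diff of_real_divide times_divide_eq_right mult.right_neutral)
    then show "0 < Re (k x x)" "Im (k x x) = 0" using p(2)[OF x] h(2)[OF x] by auto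
  qed
  have "\<exists>\<Phi> \<in> Mult X k s N. mult_norm X k s N \<Phi> \<le> 1 \<and> (\<forall>i<n. \<Phi> (z i) = W i)"
    if zW: "\<forall>i<n. z i \<in> X \<and> W i \<in> carrier_mat N N" and pick: "pos_semidef (pick_matrix k s n N z W)"
    for n N :: nat and z :: "nat \<Rightarrow> 'a" and W
  proof -
    have z: "\<And>i. i < n \<Longrightarrow> z i \<in> X" and W: "\<And>i. i < n \<Longrightarrow> W i \<in> carrier_mat N N" using zW by auto
    define D where "D = {..<n} \<times> {..<N}"
    define pt where "pt = (\<lambda>q::nat \<times> nat. z (fst q))"
    define v where "v = (\<lambda>(q::nat \<times> nat) c. W (fst q) $$ (snd q, c))"
    define w where "w = (\<lambda>q q'. \<Sum>c<N. v q c * cnj (v q' c))"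
    define \<Gamma> where "\<Gamma> = (\<lambda>q q'. (if snd q = snd q' then s (pt q) (pt q') else 0) - k (pt q) (pt q') * w q q')"
    have D: "finite D" "\<And>q. q \<in> D \<Longrightarrow> pt q \<in> X" using z by (auto simp: D_def pt_def)
    have pw: "psd D w" unfolding w_def by (intro psd_sum psd_rank_one)
    have p\<Gamma>: "psd D \<Gamma>"
      unfolding D_def \<Gamma>_def w_def v_def pt_def by (rule psd_of_pick_matrix[OF pick W])
    have data: "w q q' + \<Gamma> q q' = (if snd q = snd q' then 1 else 0) +
      h (pt q) (pt q') * w q q' + p (pt q) (pt q') * \<Gamma> q q'" if q: "q \<in> D" "q' \<in> D" for q q'
    proof -
      let ?x = "pt q" and ?y = "pt q'"
      let ?d = "if snd q = snd q' then 1 else (0::complex)"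
      have "\<Gamma> q q' = s ?x ?y * (?d - (1 - h ?x ?y) * w q q')"
        by (simp add: \<Gamma>_def k(2)[OF D(2)[OF q(1)] D(2)[OF q(2)]] algebra_simps)
      then have "(1 - p ?x ?y) * \<Gamma> q q' = (s ?x ?y * (1 - p ?x ?y)) * (?d - (1 - h ?x ?y) * w q q')"
        by (simp add: mult_ac)
      then have "(1 - p ?x ?y) * \<Gamma> q q' = ?d - (1 - h ?x ?y) * w q q'"
        unfolding sp[OF D(2)[OF q(1)] D(2)[OF q(2)]] by simp
      then show ?thesis by (simp add: algebra_simps)
    qed
    define node where "node x = (SOME i. i < n \<and> z i = x)" for x
    have node: "node (z i) < n" "z (node (z i)) = z i" if "i < n" for i
      using someI[of "\<lambda>j. j < n \<and> z j = z i" i] that by (auto simp: node_def)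
    define solves where "solves y \<xi> \<longleftrightarrow> (\<forall>q\<in>D. (\<Sum>q'\<in>D. \<xi> q' * ((1 - h (fst y) (pt q)) * w q' q + (1 - p (fst y) (pt q)) * \<Gamma> q' q)) =
        (if snd y = snd q then 1 else 0))" for y :: "'a \<times> nat" and \<xi>
    define at_node where "at_node y = (\<lambda>q'. if q' = (node (fst y), snd y) then 1 else (0::complex))" for y :: "'a \<times> nat"
    have ex: "\<exists>\<xi>. solves y \<xi> \<and> (fst y \<in> z ` {..<n} \<longrightarrow> \<xi> = at_node y)" if y: "y \<in> X \<times> {..<N}" for y
    proof (cases "fst y \<in> z ` {..<n}")
      case True
      then have nx: "node (fst y) < n" "z (node (fst y)) = fst y" using node by auto
      then have m: "(node (fst y), snd y) \<in> D" using y by (auto simp: D_def)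
      have "solves y (at_node y)"
        unfolding solves_def at_node_def
      proof
        fix q assume "q \<in> D"
        then show "(\<Sum>q'\<in>D. (if q' = (node (fst y), snd y) then 1 else 0) *
            ((1 - h (fst y) (pt q)) * w q' q + (1 - p (fst y) (pt q)) * \<Gamma> q' q)) = (if snd y = snd q then 1 else 0)"
          unfolding sum_indicator_mult[OF D(1) m]
          using data[OF m, of q] nx(2) by (simp add: pt_def algebra_simps)
      qed
      then show ?thesis by (intro exI[of _ "at_node y"]) simp
    next
      case False
      have "fst y \<in> X" using y by auto
      then have "\<exists>\<xi>. solves y \<xi>"
        unfolding solves_def
        by (intro extension_equation_solvable[OF h(1) p(1) D pw p\<Gamma>] h(2) p(2) data)
      then show ?thesis using False by simp
    qed
    define \<xi> where "\<xi> y = (SOME \<xi>. solves y \<xi> \<and> (fst y \<in> z ` {..<n} \<longrightarrow> \<xi> = at_node y))" for y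
    note \<xi>_spec = someI_ex[OF ex, folded \<xi>_def]
    have \<xi>: "(\<Sum>q'\<in>D. \<xi> y q' * ((1 - h (fst y) (pt q)) * w q' q + (1 - p (fst y) (pt q)) * \<Gamma> q' q)) =
        (if snd y = snd q then 1 else 0)" if "y \<in> X \<times> {..<N}" "q \<in> D" for y q
      using \<xi>_spec[OF that(1)] that(2) unfolding solves_def by simp
    have \<xi>_node: "\<xi> y = (\<lambda>q'. if q' = (node (fst y), snd y) then 1 else 0)"
      if "y \<in> X \<times> {..<N}" "fst y \<in> z ` {..<n}" for y
      using \<xi>_spec[OF that(1)] that(2) unfolding at_node_def by simp
    define U where "U y c = (\<Sum>q\<in>D. \<xi> y q * v q c)" for y c
    define \<Phi> where "\<Phi> x = mat N N (\<lambda>(a, c). U (x, a) c)" for x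
    (* Inl y is a row of Phi, at a point that may itself be a node; Inr q is a row of the data.
       Xi holds coordinates with respect to the data. *)
    define P where "P e = (case e of Inl y \<Rightarrow> fst y | Inr q \<Rightarrow> pt q)" for e :: "('a \<times> nat) + (nat \<times> nat)"
    define lab where "lab e = (case e of Inl y \<Rightarrow> snd y | Inr q \<Rightarrow> snd q)" for e :: "('a \<times> nat) + (nat \<times> nat)"
    define \<Xi> where "\<Xi> e = (case e of Inl y \<Rightarrow> \<xi> y | Inr q \<Rightarrow> (\<lambda>q'. if q' = q then 1 else 0))" for e
    define S where "S = Inl ` (X \<times> {..<N}) \<union> Inr ` D"
    define V where "V e e' M = (\<Sum>q\<in>D. \<Sum>q'\<in>D. \<Xi> e q * cnj (\<Xi> e' q') * M q q')"
      for e e' and M :: "nat \<times> nat \<Rightarrow> nat \<times> nat \<Rightarrow> complex"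
    define K where "K e e' = (if lab e = lab e' then 1 else 0) + h (P e) (P e') * V e e' w + p (P e) (P e') * V e e' \<Gamma>" for e e'
    have PS: "P ` S \<subseteq> X" using D(2) by (auto simp: S_def P_def)
    have pV: "psd S (\<lambda>e e'. V e e' M)" if "psd D M" for M
      unfolding V_def by (rule psd_combination[OF that D(1), where g = "\<lambda>e q. q"]) auto
    have pK: "psd S K"
    proof -
      have "psd S (\<lambda>e e'. if lab e = lab e' \<and> lab e \<noteq> N then 1 else (0::complex))"
        by (rule psd_reindex[OF psd_delta_except]) auto
      then have "psd S (\<lambda>e e'. if lab e = lab e' then 1 else (0::complex))"
        by (rule psd_cong_imp) (auto simp: S_def lab_def D_def)
      then show ?thesis unfolding K_def
        by (intro psd_add psd_mult pV pw p\<Gamma> psd_reindex[OF h(1) PS] psd_reindex[OF p(1) PS])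
    qed
    have V_data: "V e (Inr q) M = (\<Sum>q'\<in>D. \<Xi> e q' * M q' q)" if "q \<in> D" for e q M
    proof -
      have "(\<Sum>q''\<in>D. \<Xi> e q' * cnj (\<Xi> (Inr q) q'') * M q' q'') = \<Xi> e q' * M q' q" for q'
      proof -
        have "(\<Sum>q''\<in>D. \<Xi> e q' * cnj (\<Xi> (Inr q) q'') * M q' q'') =
          (\<Sum>q''\<in>D. (if q'' = q then 1 else 0) * (\<Xi> e q' * M q' q''))"
          by (intro sum.cong) (auto simp: \<Xi>_def)
        then show ?thesis using sum_indicator_mult[OF D(1) that] by simp
      qed
      then show ?thesis by (simp add: V_def)
    qed
    have V_data2: "V (Inr q') (Inr q) M = M q' q" if "q' \<in> D" "q \<in> D" for q q' M
      unfolding V_data[OF that(2)] using sum_indicator_mult[OF D(1) that(1), of "\<lambda>p. M p q"] by (simp add: \<Xi>_def)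
    have KD: "K (Inr q') (Inr q) = w q' q + \<Gamma> q' q" if "q' \<in> D" "q \<in> D" for q q'
      using data[OF that] by (simp add: K_def V_data2[OF that] P_def lab_def)
    have "psd (Inl ` (X \<times> {..<N})) (\<lambda>e e'. K e e' -
        (\<Sum>i\<in>Inr ` D. \<Sum>j\<in>Inr ` D. \<Xi> e (projr i) * cnj (\<Xi> e' (projr j)) * K i j))"
    proof (rule psd_minus_projection[OF pK])
      fix e i :: "('a \<times> nat) + (nat \<times> nat)"
      assume "e \<in> Inl ` (X \<times> {..<N})" "i \<in> Inr ` D"
      then obtain y q where y: "y \<in> X \<times> {..<N}" "e = Inl y" and q: "q \<in> D" "i = Inr q" by blast
      have "(\<Sum>q'\<in>D. \<xi> y q' * (w q' q + \<Gamma> q' q)) =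
        (\<Sum>q'\<in>D. \<xi> y q' * ((1 - h (fst y) (pt q)) * w q' q + (1 - p (fst y) (pt q)) * \<Gamma> q' q)) +
        h (fst y) (pt q) * (\<Sum>q'\<in>D. \<xi> y q' * w q' q) + p (fst y) (pt q) * (\<Sum>q'\<in>D. \<xi> y q' * \<Gamma> q' q)"
        by (simp add: algebra_simps sum_distrib_left sum.distrib sum_subtractf)
      also have "\<dots> = K e i"
        unfolding \<xi>[OF y(1) q(1)] by (simp add: y q K_def V_data lab_def P_def \<Xi>_def)
      finally show "K e i = (\<Sum>j\<in>Inr ` D. \<Xi> e (projr j) * K j i)"
        using q by (simp add: sum.reindex KD y \<Xi>_def)
    qed (auto simp: S_def D(1))
    then have "psd (X \<times> {..<N}) (\<lambda>y y'. K (Inl y) (Inl y') -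
        (\<Sum>i\<in>Inr ` D. \<Sum>j\<in>Inr ` D. \<Xi> (Inl y) (projr i) * cnj (\<Xi> (Inl y') (projr j)) * K i j))"
      by (rule psd_reindex) auto
    then have res: "psd (X \<times> {..<N}) (\<lambda>y y'. (if snd y = snd y' then 1 else 0) -
        (1 - h (fst y) (fst y')) * V (Inl y) (Inl y') w - (1 - p (fst y) (fst y')) * V (Inl y) (Inl y') \<Gamma>)"
    proof (rule psd_cong_imp)
      fix y y'
      have "(\<Sum>i\<in>Inr ` D. \<Sum>j\<in>Inr ` D. \<Xi> (Inl y) (projr i) * cnj (\<Xi> (Inl y') (projr j)) * K i j) =
        (\<Sum>q\<in>D. \<Sum>q'\<in>D. \<Xi> (Inl y) q * cnj (\<Xi> (Inl y') q') * (w q q' + \<Gamma> q q'))"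
        by (simp add: sum.reindex KD)
      also have "\<dots> = V (Inl y) (Inl y') w + V (Inl y) (Inl y') \<Gamma>"
        by (simp add: V_def distrib_left sum.distrib)
      finally show "(if snd y = snd y' then 1 else 0) -
        (1 - h (fst y) (fst y')) * V (Inl y) (Inl y') w - (1 - p (fst y) (fst y')) * V (Inl y) (Inl y') \<Gamma> =
        K (Inl y) (Inl y') - (\<Sum>i\<in>Inr ` D. \<Sum>j\<in>Inr ` D. \<Xi> (Inl y) (projr i) * cnj (\<Xi> (Inl y') (projr j)) * K i j)"
        by (simp add: K_def P_def lab_def algebra_simps)
    qed
    have Vw: "V (Inl y) (Inl y') w = (\<Sum>c<N. U y c * cnj (U y' c))" for y y'
    proof -
      have "(\<Sum>c<N. U y c * cnj (U y' c)) = (\<Sum>c<N. \<Sum>q\<in>D. \<Sum>q'\<in>D. (\<xi> y q * v q c) * cnj (\<xi> y' q' * v q' c))"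
        by (simp add: U_def sum_product)
      also have "\<dots> = (\<Sum>q\<in>D. \<Sum>c<N. \<Sum>q'\<in>D. (\<xi> y q * v q c) * cnj (\<xi> y' q' * v q' c))" by (rule sum.swap)
      also have "\<dots> = (\<Sum>q\<in>D. \<Sum>q'\<in>D. \<Sum>c<N. (\<xi> y q * v q c) * cnj (\<xi> y' q' * v q' c))"
        by (intro sum.cong refl sum.swap)
      also have "\<dots> = V (Inl y) (Inl y') w"
        unfolding V_def w_def sum_distrib_left by (intro sum.cong refl) (simp add: \<Xi>_def)
      finally show ?thesis ..
    qed
    have "psd (X \<times> {..<N}) (\<lambda>y y'. s (fst y) (fst y') * ((if snd y = snd y' then 1 else 0) -
        (1 - h (fst y) (fst y')) * V (Inl y) (Inl y') w - (1 - p (fst y) (fst y')) * V (Inl y) (Inl y') \<Gamma>)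
        + V (Inl y) (Inl y') \<Gamma>)"
    proof (intro psd_add psd_mult res)
      show "psd (X \<times> {..<N}) (\<lambda>y y'. s (fst y) (fst y'))" by (rule psd_reindex[OF ps]) auto
      show "psd (X \<times> {..<N}) (\<lambda>y y'. V (Inl y) (Inl y') \<Gamma>)"
        by (rule psd_reindex[OF pV[OF p\<Gamma>]]) (auto simp: S_def)
    qed
    then have fin: "psd (X \<times> {..<N}) (\<lambda>y y'. (if snd y = snd y' then s (fst y) (fst y') else 0) -
      k (fst y) (fst y') * (\<Sum>c<N. \<Phi> (fst y) $$ (snd y, c) * cnj (\<Phi> (fst y') $$ (snd y', c))))"
    proof (rule psd_cong_imp)
      fix y y' assume y: "y \<in> X \<times> {..<N}" "y' \<in> X \<times> {..<N}"
      then have yX: "fst y \<in> X" "fst y' \<in> X" "snd y < N" "snd y' < N" by auto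
      let ?s = "s (fst y) (fst y')" and ?p = "p (fst y) (fst y')" and ?h = "h (fst y) (fst y')"
      let ?d = "if snd y = snd y' then 1 else (0::complex)"
      have "(\<Sum>c<N. \<Phi> (fst y) $$ (snd y, c) * cnj (\<Phi> (fst y') $$ (snd y', c))) = V (Inl y) (Inl y') w"
        unfolding Vw using yX by (intro sum.cong refl) (simp add: \<Phi>_def)
      moreover have "?s * (?d - (1 - ?h) * V (Inl y) (Inl y') w - (1 - ?p) * V (Inl y) (Inl y') \<Gamma>) + V (Inl y) (Inl y') \<Gamma> =
        ?s * ?d - (1 - ?h) * ?s * V (Inl y) (Inl y') w - (?s * (1 - ?p)) * V (Inl y) (Inl y') \<Gamma> + V (Inl y) (Inl y') \<Gamma>"
        by (simp add: algebra_simps)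
      ultimately show "(if snd y = snd y' then ?s else 0) -
        k (fst y) (fst y') * (\<Sum>c<N. \<Phi> (fst y) $$ (snd y, c) * cnj (\<Phi> (fst y') $$ (snd y', c))) =
        ?s * (?d - (1 - ?h) * V (Inl y) (Inl y') w - (1 - ?p) * V (Inl y) (Inl y') \<Gamma>) + V (Inl y) (Inl y') \<Gamma>"
        using k(2)[OF yX(1,2)] sp[OF yX(1,2)] by simp
    qed
    have "\<Phi> (z i) = W i" if i: "i < n" for i
    proof -
      have eqW: "W (node (z i)) = W i"
      proof (rule equal_targets_at_equal_nodes[OF pick W])
        show "0 < Re (k (z (node (z i))) (z (node (z i))))" "Im (k (z (node (z i))) (z (node (z i)))) = 0"
          using kpos z node[OF i] i by auto
      qed (use node[OF i] i in auto)
      have "U (z i, a) c = W i $$ (a, c)" if "a < N" for a c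
      proof -
        have "(node (z i), a) \<in> D" using node[OF i] that by (simp add: D_def)
        then have "U (z i, a) c = v (node (z i), a) c"
          unfolding U_def using \<xi>_node[of "(z i, a)"] z[OF i] i that
          by (simp add: sum_indicator_mult[OF D(1), where f = "\<lambda>q. v q c"])
        then show ?thesis by (simp add: v_def eqW)
      qed
      then show ?thesis using W[OF i] by (intro eq_matI) (auto simp: \<Phi>_def)
    qed
    moreover have "\<Phi> \<in> Mult X k s N" "mult_norm X k s N \<Phi> \<le> 1"
      by (rule contractive_multiplierI[OF k(1) ps _ fin], simp add: \<Phi>_def)+
    ultimately show ?thesis by blast
  qed
  then show ?thesis
    unfolding complete_pick_pair_def kernel_on_iff_psd using X k(1) ps by blast
qed

section \<open>A necessary condition for complete Pick kernels\<close>

lemma scalar_pick_extension: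
  fixes n :: nat
  assumes t: "complete_pick_kernel X t" and n: "n \<ge> 1" and z: "\<And>i. i < n \<Longrightarrow> z i \<in> X"
    and pos: "psd {..<n} (\<lambda>i j. t (z i) (z j) - t (z i) (z j) * (w i * cnj (w j)))"
  obtains \<phi> where "\<And>i. i < n \<Longrightarrow> \<phi> (z i) = w i" "psd X (\<lambda>x y. t x y - \<phi> x * cnj (\<phi> y) * t x y)"
proof -
  have pt: "psd X t" using t by (simp add: complete_pick_kernel_def complete_pick_pair_def kernel_on_iff_psd)
  define W where "W i = mat 1 1 (\<lambda>_. w i)" for i
  have W: "W i \<in> carrier_mat 1 1" for i by (simp add: W_def)
  have "(W i * mat_adjoint (W j)) $$ (0, 0) = w i * cnj (w j)" for i j
    using mult_adjoint_entry[OF W[of i] W[of j], of 0 0] by (simp add: W_def)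
  moreover have "dim_row (W i * mat_adjoint (W j)) = 1" "dim_col (W i * mat_adjoint (W j)) = 1" for i j
    by (auto simp: W_def mat_adjoint_def)
  ultimately have "pick_matrix t t n 1 z W =
      mat n n (\<lambda>(i, j). t (z i) (z j) - t (z i) (z j) * (w i * cnj (w j)))"
    unfolding pick_matrix_def by (intro eq_matI) (auto simp: Let_def simp del: index_mult_mat)
  then have "pos_semidef (pick_matrix t t n 1 z W)"
    using pos pos_semidef_iff_psd[of n "\<lambda>(i, j). t (z i) (z j) - t (z i) (z j) * (w i * cnj (w j))"] by simp
  then obtain \<Phi> where \<Phi>: "\<Phi> \<in> Mult X t t 1" "mult_norm X t t 1 \<Phi> \<le> 1" "\<And>i. i < n \<Longrightarrow> \<Phi> (z i) = W i"
    using t n z W unfolding complete_pick_kernel_def complete_pick_pair_def by (metis order_refl)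
  show ?thesis
  proof
    show "\<Phi> (z i) $$ (0, 0) = w i" if "i < n" for i using \<Phi>(3)[OF that] by (simp add: W_def)
    show "psd X (\<lambda>x y. t x y - \<Phi> x $$ (0, 0) * cnj (\<Phi> y $$ (0, 0)) * t x y)"
      by (rule contractive_scalar_multiplierD[OF pt pt \<Phi>(1,2)])
  qed
qed

text \<open>The three-point case of the necessity half of the McCullough--Quiggin theorem. On the nodes \<open>e\<close>, \<open>a\<close> the
  targets \<open>0\<close> and \<open>sqrt (F a a)\<close> turn the Pick matrix into the rank one matrix \<open>t x e t e y / t e e\<close>. A positive
  extension of a rank one matrix is determined in its off-diagonal entries, so the value of the
  interpolating multiplier at the third point \<open>b\<close> has to reproduce \<open>F a b\<close>, and its diagonal entry does not
  exceed \<open>F b b\<close>.\<close>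

lemma complete_pick_kernel_necessary:
  assumes t: "complete_pick_kernel X t" and X: "e \<in> X" "a \<in> X" "b \<in> X" "a \<noteq> b"
    and nz: "\<And>x y. x \<in> X \<Longrightarrow> y \<in> X \<Longrightarrow> t x y \<noteq> 0"
  shows "psd {a, b} (\<lambda>x y. 1 - t x e * t e y / (t x y * t e e))"
proof -
  have pt: "psd X t" using t by (simp add: complete_pick_kernel_def complete_pick_pair_def kernel_on_iff_psd)
  define F where "F x y = 1 - t x e * t e y / (t x y * t e e)" for x y
  have F_diag: "F x x = of_real (1 - (cmod (t x e))\<^sup>2 / (Re (t x x) * Re (t e e)))" if "x \<in> X" for x
  proof -
    have "t x e * t e x = of_real ((cmod (t x e))\<^sup>2)"
      by (simp only: complex_norm_square psd_hermitian[OF pt that X(1)])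
    then show ?thesis
      using psd_diagonal_real(1)[OF pt that] psd_diagonal_real(1)[OF pt X(1)]
      by (metis F_def of_real_1 of_real_diff of_real_divide of_real_mult)
  qed
  have pos: "0 < Re (t x x)" if "x \<in> X" for x
    using psd_diagonal_real[OF pt that] nz[OF that that] by (metis of_real_0 order_le_less)
  have Faa: "0 \<le> Re (F a a)"
    using psd_Cauchy_Schwarz[OF pt X(2,1)] pos[OF X(2)] pos[OF X(1)] by (simp add: F_diag[OF X(2)])
  define w where "w i = (if i = (0::nat) then 0 else complex_of_real (sqrt (Re (F a a))))" for i
  define z where "z i = (if i = (0::nat) then e else a)" for i
  have zX: "z i \<in> X" for i using X by (simp add: z_def)
  have ww: "w i * cnj (w j) = (if i = 0 \<or> j = 0 then 0 else F a a)" for i j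
  proof -
    have "complex_of_real (sqrt (Re (F a a))) * of_real (sqrt (Re (F a a))) = F a a"
      using Faa F_diag[OF X(2)] by (simp flip: of_real_mult)
    then show ?thesis by (auto simp: w_def)
  qed
  have "psd {..<2} (\<lambda>i j. t (z i) (z j) - t (z i) (z j) * (w i * cnj (w j)))"
  proof (rule psd_cong_imp[OF psd_rank_one[of _ "\<lambda>i. t (z i) e / of_real (sqrt (Re (t e e)))"]])
    fix i j
    have "complex_of_real (sqrt (Re (t e e))) * of_real (sqrt (Re (t e e))) = t e e"
      using psd_diagonal_real[OF pt X(1)] by (simp flip: of_real_mult)
    then have "t (z i) e / of_real (sqrt (Re (t e e))) * cnj (t (z j) e / of_real (sqrt (Re (t e e)))) =
      t (z i) e * t e (z j) / t e e"
      using psd_hermitian[OF pt zX[of j] X(1)] by simp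
    moreover have "t (z i) (z j) - t (z i) (z j) * (w i * cnj (w j)) = t (z i) e * t e (z j) / t e e"
      unfolding ww F_def using nz[OF X(1,1)] nz[OF X(2,2)] by (auto simp: z_def field_simps)
    ultimately show "t (z i) (z j) - t (z i) (z j) * (w i * cnj (w j)) =
      t (z i) e / of_real (sqrt (Re (t e e))) * cnj (t (z j) e / of_real (sqrt (Re (t e e))))" by simp
  qed
  then obtain \<phi> where \<phi>: "\<And>i. i < 2 \<Longrightarrow> \<phi> (z i) = w i" "psd X (\<lambda>x y. t x y - \<phi> x * cnj (\<phi> y) * t x y)"
    using scalar_pick_extension[OF t, of 2 z w] zX by auto
  have \<phi>e: "\<phi> e = 0" and \<phi>a: "\<phi> a * cnj (\<phi> a) = F a a"
    using \<phi>(1)[of 0] \<phi>(1)[of 1] ww[of 1 1] by (auto simp: z_def w_def)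
  define M where "M x y = t x y - \<phi> x * cnj (\<phi> y) * t x y - t x e * t e y / t e e" for x y
  have M: "psd X M"
    using psd_Schur_complement[OF \<phi>(2) X(1)] nz[OF X(1,1)] by (simp add: \<phi>e M_def[abs_def])
  have MF: "M x y = t x y * (F x y - \<phi> x * cnj (\<phi> y))" if "x \<in> X" "y \<in> X" for x y
    using nz[OF that] nz[OF X(1,1)] by (simp add: M_def F_def field_simps)
  have "M a a = 0" using MF[OF X(2,2)] \<phi>a by simp
  then have "M a b = 0" using psd_Cauchy_Schwarz[OF M X(2,3)] by simp
  then have Fab: "F a b = \<phi> a * cnj (\<phi> b)" using MF[OF X(2,3)] nz[OF X(2,3)] by simp
  have "F b a = cnj (F a b)"
    using psd_hermitian[OF pt X(2,3)] psd_hermitian[OF pt X(2,1)] psd_hermitian[OF pt X(3,1)] psd_hermitian[OF pt X(1,1)]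
    by (simp add: F_def)
  then have Fba: "F b a = \<phi> b * cnj (\<phi> a)" by (simp add: Fab)
  define \<delta> where "\<delta> = Re (F b b) - (cmod (\<phi> b))\<^sup>2"
  have Fbb: "F b b = \<phi> b * cnj (\<phi> b) + of_real \<delta>"
    using F_diag[OF X(3)] unfolding complex_norm_square[symmetric] \<delta>_def by simp
  have "0 \<le> Re (M b b)" by (rule psd_diagonal_real(2)[OF M X(3)])
  also have "M b b = of_real (Re (t b b) * \<delta>)"
    using MF[OF X(3,3)] Fbb psd_diagonal_real(1)[OF pt X(3)] by simp
  finally have \<delta>: "0 \<le> \<delta>" using pos[OF X(3)] by (simp add: zero_le_mult_iff)
  have "psd {a, b} F"
  proof (rule psd_cong_imp[OF psd_add[OF psd_rank_one[of _ \<phi>]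
          psd_scale[OF psd_rank_one[of _ "\<lambda>x. if x = b then 1 else 0"] \<delta>]]])
    fix x y assume "x \<in> {a, b}" "y \<in> {a, b}"
    then show "F x y = \<phi> x * cnj (\<phi> y) + of_real \<delta> * ((if x = b then 1 else 0) * cnj (if y = b then 1 else 0))"
      using X(4) \<phi>a Fab Fba Fbb by auto
  qed
  then show ?thesis by (simp add: F_def[abs_def])
qed

text \<open>After normalisation at \<open>e\<close> the section at \<open>e\<close> is the constant one, and the Schur complement subtracts it.\<close>

lemma psd_normalized_minus_one:
  assumes g: "psd X g" and e: "e \<in> X" and nz: "\<And>x. x \<in> X \<Longrightarrow> g x e \<noteq> 0"
  shows "psd X (\<lambda>x y. g x y * g e e / (g x e * g e y) - 1)"
proof -
  have ge: "g e e = of_real (Re (g e e))" "0 \<le> Re (g e e)" "g e e \<noteq> 0"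
    using psd_diagonal_real[OF g e] nz[OF e] by auto
  have "psd X (\<lambda>x y. of_real (sqrt (Re (g e e))) / g x e * cnj (of_real (sqrt (Re (g e e))) / g y e) *
      (g x y - g x e * g e y / g e e))"
    by (intro psd_rescale psd_Schur_complement g e ge(3))
  then show ?thesis
  proof (rule psd_cong_imp)
    fix x y assume xy: "x \<in> X" "y \<in> X"
    have "complex_of_real (sqrt (Re (g e e))) * of_real (sqrt (Re (g e e))) = g e e"
      using ge by (simp flip: of_real_mult)
    then have eq: "of_real (sqrt (Re (g e e))) / g x e * cnj (of_real (sqrt (Re (g e e))) / g y e) = g e e / (g x e * g e y)"
      using psd_hermitian[OF g xy(2) e] by simp
    have "g e y \<noteq> 0" using nz[OF xy(2)] psd_hermitian[OF g xy(2) e] by auto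
    then show "g x y * g e e / (g x e * g e y) - 1 =
      of_real (sqrt (Re (g e e))) / g x e * cnj (of_real (sqrt (Re (g e e))) / g y e) * (g x y - g x e * g e y / g e e)"
      unfolding eq using nz[OF xy(1)] ge(3) by (simp add: field_simps)
  qed
qed

section \<open>Complete Pick kernels above the Bergman kernel\<close>

text \<open>The two-point consequence of positivity of \<open>1 / (1 - h)\<close>, by the inequality of the means.\<close>

lemma one_minus_psd_reverse_Cauchy_Schwarz:
  assumes h: "psd X h" and x: "x \<in> X" "y \<in> X" and "Re (h x x) \<le> 1" "Re (h y y) \<le> 1"
  shows "(1 - Re (h x x)) * (1 - Re (h y y)) \<le> (cmod (1 - h x y))\<^sup>2"
proof -
  define a where "a = Re (h x x)"
  define d where "d = Re (h y y)"
  have ad: "0 \<le> a" "0 \<le> d" "a \<le> 1" "d \<le> 1" using assms psd_diagonal_real(2)[OF h] by (auto simp: a_def d_def)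
  have "cmod (h x y) \<le> sqrt (a * d)"
    using psd_Cauchy_Schwarz[OF h x] by (intro real_le_rsqrt) (simp add: a_def d_def)
  moreover have "1 - cmod (h x y) \<le> cmod (1 - h x y)" using norm_triangle_ineq2[of 1 "h x y"] by simp
  moreover have s1: "sqrt (a * d) \<le> 1" using ad by (simp add: mult_le_one)
  ultimately have "(1 - sqrt (a * d))\<^sup>2 \<le> (cmod (1 - h x y))\<^sup>2" by (intro power_mono) auto
  moreover have "(1 - a) * (1 - d) \<le> (1 - sqrt (a * d))\<^sup>2"
  proof -
    have "2 * sqrt (a * d) \<le> a + d" using arith_geo_mean_sqrt[OF ad(1,2)] by simp
    then show ?thesis using ad by (simp add: power2_eq_square algebra_simps)
  qed
  ultimately show ?thesis unfolding a_def d_def by linarith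
qed

text \<open>With \<open>x = z cnj w\<close>, the coefficients make \<open>psi psi* - 2 x + x\<^sup>2\<close> a rank one kernel \<open>chi chi*\<close>: its coefficient
  matrix with respect to \<open>z\<close> and \<open>z\<^sup>2\<close> has determinant zero.\<close>

definition psi :: "real \<Rightarrow> complex \<Rightarrow> complex" where
  "psi c z = of_real (sqrt (2 * (1 + c\<^sup>2))) * z + of_real c * z\<^sup>2"

definition chi :: "real \<Rightarrow> complex \<Rightarrow> complex" where
  "chi c z = of_real (sqrt 2 * c) * z + of_real (sqrt (1 + c\<^sup>2)) * z\<^sup>2"

text \<open>The pullback of the Szego kernel along \<open>psi c\<close>. The value \<open>c = 0\<close> gives \<open>1 / (1 - 2 x)\<close>.\<close>

definition pullback_kernel :: "real \<Rightarrow> complex \<Rightarrow> complex \<Rightarrow> complex" where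
  "pullback_kernel c z w = 1 / (1 - psi c z * cnj (psi c w))"

abbreviation \<D> :: "complex set" where "\<D> \<equiv> ball 0 (1/4)"

lemma psi_chi_identity:
  "chi c z * cnj (chi c w) = psi c z * cnj (psi c w) - 2 * (z * cnj w) + (z * cnj w)\<^sup>2"
proof -
  define q where "q = complex_of_real (sqrt 2)"
  define d where "d = complex_of_real (sqrt (1 + c\<^sup>2))"
  define C where "C = complex_of_real c"
  have q: "q * q = 2" by (simp add: q_def flip: of_real_mult)
  have d: "d * d = 1 + C * C" by (simp add: d_def C_def power2_eq_square flip: of_real_mult)
  have "psi c z = q * d * z + C * z\<^sup>2" "chi c z = q * C * z + d * z\<^sup>2" for z
    unfolding psi_def chi_def q_def d_def C_def real_sqrt_mult of_real_mult by simp_all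
  moreover have "cnj q = q" "cnj d = d" "cnj C = C" by (simp_all add: q_def d_def C_def)
  ultimately have "chi c z * cnj (chi c w) - psi c z * cnj (psi c w) =
      (q * q) * (C * C - d * d) * (z * cnj w) + (d * d - C * C) * (z * cnj w)\<^sup>2"
    by (simp add: algebra_simps power2_eq_square)
  then show ?thesis unfolding q d by (simp add: algebra_simps)
qed

lemma psi_less_one:
  assumes "c \<in> {0..1}" "z \<in> \<D>" shows "cmod (psi c z) < 1"
proof -
  have z: "cmod z < 1/4" using assms by simp
  have "c\<^sup>2 \<le> 1\<^sup>2" using assms by (intro power_mono) auto
  then have "sqrt (2 * (1 + c\<^sup>2)) \<le> 2" by (intro real_le_lsqrt) auto
  then have "cmod (of_real (sqrt (2 * (1 + c\<^sup>2))) * z) \<le> 2 * (1/4)"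
    using z unfolding norm_mult norm_of_real by (intro mult_mono) (auto simp: add_nonneg_nonneg)
  moreover have "cmod (of_real c * z\<^sup>2) \<le> 1 * (1/4)\<^sup>2"
    using z assms unfolding norm_mult norm_of_real norm_power by (intro mult_mono power_mono) auto
  ultimately show ?thesis
    unfolding psi_def using norm_triangle_ineq[of "of_real (sqrt (2 * (1 + c\<^sup>2))) * z" "of_real c * z\<^sup>2"]
    by (simp add: power2_eq_square)
qed

lemma Re_mult_cnj: "Re (u * cnj u) = (cmod u)\<^sup>2"
  by (simp only: complex_norm_square[symmetric] Re_complex_of_real)

lemma psd_bergman: "psd \<D> bergman"
proof -
  have "psd \<D> (\<lambda>z w. 1 / (1 - z * cnj w))"
  proof (rule psd_geometric[OF psd_rank_one[of \<D> "\<lambda>z. z"]])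
    fix z assume "z \<in> \<D>"
    then show "Re (z * cnj z) < 1" unfolding Re_mult_cnj using power_less_one_iff[of "cmod z" 2] by simp
  qed
  from psd_mult[OF this this] show ?thesis
    by (rule psd_cong_imp) (simp add: bergman_def power2_eq_square)
qed

lemma bergman_nonzero: assumes "z \<in> \<D>" "w \<in> \<D>" shows "1 - z * cnj w \<noteq> 0" "bergman z w \<noteq> 0"
proof -
  have "cmod z * cmod w \<le> cmod z * 1" using assms by (intro mult_left_mono) auto
  then have "cmod (z * cnj w) < 1" using assms by (simp add: norm_mult)
  then show "1 - z * cnj w \<noteq> 0" by auto
  then show "bergman z w \<noteq> 0" by (simp add: bergman_def)
qed

lemma psd_chi: "psd \<D> (\<lambda>z w. bergman z w * (chi c z * cnj (chi c w)))"
  by (intro psd_mult psd_bergman psd_rank_one)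

lemma psi_diag_less_one: "c \<in> {0..1} \<Longrightarrow> z \<in> \<D> \<Longrightarrow> Re (psi c z * cnj (psi c z)) < 1"
  unfolding Re_mult_cnj using power_less_one_iff[of "cmod (psi c z)" 2] psi_less_one[of c z] by simp

lemma one_minus_psi_nonzero:
  assumes "c \<in> {0..1}" "z \<in> \<D>" "w \<in> \<D>" shows "1 - psi c z * cnj (psi c w) \<noteq> 0"
  using psd_less_one[OF psd_rank_one[of \<D> "psi c"] psi_diag_less_one[OF assms(1)] assms(2,3)] by auto

text \<open>Multiplied by \<open>(1 - x)\<^sup>2\<close>, the factor \<open>1 - bergman chi chi*\<close> becomes \<open>1 - 2 x + x\<^sup>2 - chi chi* = 1 - psi psi*\<close>.\<close>

lemma bergman_factorization:
  assumes "c \<in> {0..1}" "z \<in> \<D>" "w \<in> \<D>"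
  shows "bergman z w = (1 - bergman z w * (chi c z * cnj (chi c w))) * pullback_kernel c z w"
proof -
  let ?x = "z * cnj w" and ?f = "psi c z * cnj (psi c w)"
  have nz: "1 - ?x \<noteq> 0" "1 - ?f \<noteq> 0"
    using bergman_nonzero[OF assms(2,3)] one_minus_psi_nonzero[OF assms] by auto
  have "1 - bergman z w * (chi c z * cnj (chi c w)) = ((1 - ?x)\<^sup>2 - (?f - 2 * ?x + ?x\<^sup>2)) / (1 - ?x)\<^sup>2"
    unfolding psi_chi_identity bergman_def using nz(1) by (simp add: diff_divide_distrib)
  also have "(1 - ?x)\<^sup>2 - (?f - 2 * ?x + ?x\<^sup>2) = 1 - ?f" by (simp add: power2_eq_square algebra_simps)
  finally show ?thesis using nz by (simp add: bergman_def pullback_kernel_def)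
qed

lemma pullback_complete_pick:
  assumes "c \<in> {0..1}" shows "complete_pick_kernel \<D> (pullback_kernel c)"
  unfolding complete_pick_kernel_def
proof (rule complete_pick_pairI[where p = "\<lambda>z w. psi c z * cnj (psi c w)" and h = "\<lambda>_ _. 0"])
  show "psd \<D> (pullback_kernel c)"
    using psd_geometric[OF psd_rank_one psi_diag_less_one[OF assms]] by (rule psd_cong_imp) (auto simp: pullback_kernel_def)
qed (use psi_diag_less_one[OF assms] in \<open>auto simp: pullback_kernel_def psd_zero psd_rank_one simp del: Re_mult_cnj\<close>)

lemma bergman_pullback_complete_pick_pair:
  assumes c: "c \<in> {0..1}" shows "complete_pick_pair \<D> bergman (pullback_kernel c)"
proof (rule complete_pick_pairI[where p = "\<lambda>z w. psi c z * cnj (psi c w)"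
      and h = "\<lambda>z w. bergman z w * (chi c z * cnj (chi c w))"])
  fix z assume z: "z \<in> \<D>"
  let ?h = "bergman z z * (chi c z * cnj (chi c z))"
  have f: "psi c z * cnj (psi c z) = of_real ((cmod (psi c z))\<^sup>2)" by (simp only: complex_norm_square)
  have b: "bergman z z = of_real (1 / (1 - (cmod z)\<^sup>2)\<^sup>2)"
    unfolding bergman_def complex_norm_square[symmetric] by simp
  have l: "(cmod (psi c z))\<^sup>2 < 1" using psi_diag_less_one[OF c z] unfolding Re_mult_cnj .
  have "1 - ?h = bergman z z * (1 - psi c z * cnj (psi c z))"
    using bergman_factorization[OF c z z] one_minus_psi_nonzero[OF c z z] by (simp add: pullback_kernel_def field_simps)
  then have "1 - ?h = of_real (1 / (1 - (cmod z)\<^sup>2)\<^sup>2 * (1 - (cmod (psi c z))\<^sup>2))"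
    unfolding f b by simp
  then have "1 - Re ?h = 1 / (1 - (cmod z)\<^sup>2)\<^sup>2 * (1 - (cmod (psi c z))\<^sup>2)"
    by (metis Re_complex_of_real minus_complex.sel(1) one_complex.sel(1))
  moreover have "0 < 1 / (1 - (cmod z)\<^sup>2)\<^sup>2 * (1 - (cmod (psi c z))\<^sup>2)"
    using l power_less_one_iff[of "cmod z" 2] z by (intro mult_pos_pos) auto
  ultimately show "Re ?h < 1" by linarith
next
  show "bergman z w = (1 - bergman z w * (chi c z * cnj (chi c w))) * pullback_kernel c z w"
    if "z \<in> \<D>" "w \<in> \<D>" for z w by (rule bergman_factorization[OF c that])
qed (use psi_diag_less_one[OF c] psd_bergman psd_chi in \<open>auto simp: pullback_kernel_def psd_rank_one\<close>)

lemma psi_at_zero [simp]: "psi c 0 = 0"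
  by (simp add: psi_def)

lemma pullback_at_reals:
  "pullback_kernel c (of_real x) (of_real y) = of_real (1 / (1 -
     (sqrt (2 * (1 + c\<^sup>2)) * x + c * x\<^sup>2) * (sqrt (2 * (1 + c\<^sup>2)) * y + c * y\<^sup>2)))"
proof -
  have "psi c (of_real x) = of_real (sqrt (2 * (1 + c\<^sup>2)) * x + c * x\<^sup>2)" for x
    by (simp add: psi_def)
  then show ?thesis by (simp only: pullback_kernel_def complex_cnj_complex_of_real of_real_mult of_real_diff of_real_divide of_real_1)
qed

text \<open>\<open>A\<close>, \<open>B\<close>, \<open>C\<close> are the real parts of \<open>f (\<tau>, \<tau>)\<close>, \<open>f (-\<tau>, -\<tau>)\<close> and \<open>f (\<tau>, -\<tau>)\<close> at \<open>\<tau> = 1/100\<close>, where \<open>f = 1 - 1/t\<close> for the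
  certificate \<open>t\<close> normalised at \<open>0\<close>. By \<open>L\<close> and \<open>U\<close> the remainders \<open>P\<close>, \<open>Q\<close>, \<open>S\<close> in a comparison of \<open>f\<close> with \<open>2 x\<close> are at most about
  \<open>\<tau>\<^sup>4\<close> in absolute value, and \<open>N\<close>, the positivity of \<open>f\<close> on even functions, bounds \<open>P + Q + 2 S\<close> from above by a
  quantity of higher order. The right-hand side of \<open>R\<close> is then negative, of size about \<open>3.6 \<tau>\<^sup>4\<close>.\<close>

lemma three_point_inequalities_incompatible:
  fixes A B C :: real
  assumes N: "0 \<le> A + B + 2 * C"
    and L: "1 - (9999 / 10000)\<^sup>2 \<le> A" "1 - (9999 / 10000)\<^sup>2 \<le> B"
    and U: "0 \<le> 5000 / 4999 * (1 - A) - 1" "0 \<le> 5000 / 4999 * (1 - B) - 1"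
      "(5000 / 5001 * (1 - C) - 1)\<^sup>2 \<le> (5000 / 4999 * (1 - A) - 1) * (5000 / 4999 * (1 - B) - 1)"
    and R: "0 \<le> (95 / 100)\<^sup>2 * (1 / (1 - (1001 / 70000)\<^sup>2) * (1 - A) - 1)
      + 2 * (95 / 100 * (105 / 100)) * (1 / (1 + 1001 / 70000 * (999 / 70000)) * (1 - C) - 1)
      + (105 / 100)\<^sup>2 * (1 / (1 - (999 / 70000)\<^sup>2) * (1 - B) - 1)"
  shows False
proof -
  define P where "P = 5000 / 4999 * (1 - A) - 1"
  define Q where "Q = 5000 / 4999 * (1 - B) - 1"
  define S where "S = 5000 / 5001 * (1 - C) - 1"
  have e: "A = 1 - 4999 / 5000 * (P + 1)" "B = 1 - 4999 / 5000 * (Q + 1)" "C = 1 - 5001 / 5000 * (S + 1)"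
    by (simp_all add: P_def Q_def S_def field_simps)
  define u :: real where "u = 1 / 99980000"
  have PQ: "0 \<le> P" "0 \<le> Q" "P \<le> u" "Q \<le> u"
    using U(1,2) L by (simp_all add: P_def Q_def u_def power2_eq_square)
  have "S\<^sup>2 \<le> P * Q" using U(3) by (simp add: P_def Q_def S_def)
  also have "\<dots> \<le> u * u" using PQ by (intro mult_mono) (auto simp: u_def)
  finally have "\<bar>S\<bar> \<le> \<bar>u\<bar>" by (simp add: abs_le_square_iff power2_eq_square)
  then have S: "- u \<le> S" "S \<le> u" by (auto simp: u_def)
  show False using N PQ S R unfolding e u_def by (simp add: power2_eq_square field_simps)
qed

text \<open>No regularity of \<open>t\<close> is known, so second order Taylor coefficients are replaced by values at \<open>0\<close> and \<open>\<plusminus> 1/100\<close>.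
  The coefficients \<open>95/100\<close> and \<open>105/100\<close> are \<open>1 \<minusplus> 5 \<tau>\<close>: they combine the odd and the even part of the values at \<open>\<plusminus> \<tau>\<close> so
  as to approximate a vector on which the second order coefficient matrix of
  \<open>(psi psi* - 2 x) / (1 - psi psi*)\<close>, with \<open>psi\<close> taken at \<open>c = 1/7\<close>, is negative. The parameter \<open>1/7\<close> is one for which \<open>sqrt (2 (1 + c\<^sup>2))\<close> is rational.\<close>

lemma no_common_certificate:
  assumes t: "complete_pick_kernel \<D> t" and h: "psd \<D> h"
    and bt: "\<And>z w. z \<in> \<D> \<Longrightarrow> w \<in> \<D> \<Longrightarrow> bergman z w = (1 - h z w) * t z w"
    and g: "\<And>c. c \<in> {0..1} \<Longrightarrow> \<exists>g. psd \<D> g \<and> (\<forall>z\<in>\<D>. \<forall>w\<in>\<D>. pullback_kernel c z w = t z w * g z w)"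
  shows False
proof -
  have pt: "psd \<D> t" using t by (simp add: complete_pick_kernel_def complete_pick_pair_def kernel_on_iff_psd)
  have nz: "t z w \<noteq> 0" "1 - h z w \<noteq> 0" if "z \<in> \<D>" "w \<in> \<D>" for z w
    using bt[OF that] bergman_nonzero(2)[OF that] by auto
  have zero: "0 \<in> \<D>" by simp
  define F where "F x y = 1 - t x 0 * t 0 y / (t x y * t 0 0)" for x y
  define a :: complex where "a = of_real (1 / 100)"
  define b :: complex where "b = of_real (- (1 / 100))"
  have ab: "a \<in> \<D>" "b \<in> \<D>" "a \<noteq> b" by (simp_all add: a_def b_def)
  have ab2: "a \<in> {a, b}" "b \<in> {a, b}" by simp_all
  have pF: "psd {a, b} F"
    using complete_pick_kernel_necessary[OF t zero ab nz(1)] by (simp add: F_def[abs_def])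
  have quotient: "psd \<D> (\<lambda>x y. pullback_kernel c x y * (1 - F x y) - 1)" if c: "c \<in> {0..1}" for c
  proof -
    obtain g where g: "psd \<D> g" "\<And>z w. z \<in> \<D> \<Longrightarrow> w \<in> \<D> \<Longrightarrow> pullback_kernel c z w = t z w * g z w"
      using g[OF c] by blast
    have s0: "pullback_kernel c x 0 = 1" "pullback_kernel c 0 x = 1" for x by (simp_all add: pullback_kernel_def)
    have g0: "g x 0 = 1 / t x 0" "g 0 x = 1 / t 0 x" if "x \<in> \<D>" for x
      using g(2)[OF that zero] g(2)[OF zero that] nz(1)[OF that zero] nz(1)[OF zero that]
      by (auto simp: s0 field_simps)
    have "psd \<D> (\<lambda>x y. g x y * g 0 0 / (g x 0 * g 0 y) - 1)"
      by (rule psd_normalized_minus_one[OF g(1) zero]) (use g0 nz(1) zero in auto)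
    then show ?thesis
    proof (rule psd_cong_imp)
      fix x y assume xy: "x \<in> \<D>" "y \<in> \<D>"
      show "pullback_kernel c x y * (1 - F x y) - 1 = g x y * g 0 0 / (g x 0 * g 0 y) - 1"
        unfolding g(2)[OF xy] g0(1)[OF xy(1)] g0(2)[OF xy(2)] g0(1)[OF zero] F_def
        using nz(1)[OF xy] by simp
    qed
  qed
  (* the normalised t is at least the Bergman kernel on the diagonal *)
  have lower: "1 - (1 - (cmod z)\<^sup>2)\<^sup>2 \<le> Re (F z z)" if z: "z \<in> \<D>" for z
  proof -
    have bz: "bergman z z = of_real (1 / (1 - (cmod z)\<^sup>2)\<^sup>2)" "bergman z 0 = 1" "bergman 0 0 = 1"
      unfolding bergman_def complex_norm_square[symmetric] by simp_all
    have q: "0 < (1 - (cmod z)\<^sup>2)\<^sup>2" using z power_less_one_iff[of "cmod z" 2] by auto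
    have tz: "t z z = of_real (Re (t z z))" "t 0 0 = of_real (Re (t 0 0))"
      using psd_diagonal_real(1)[OF pt z] psd_diagonal_real(1)[OF pt zero] by auto
    have tp: "0 < Re (t z z)" "0 < Re (t 0 0)"
      using psd_diagonal_real[OF pt z] psd_diagonal_real[OF pt zero] nz(1)[OF z z] nz(1)[OF zero zero]
      by (metis of_real_0 order_le_less)+
    have hz: "h z z = of_real (Re (h z z))" "h 0 0 = of_real (Re (h 0 0))"
      using psd_diagonal_real(1)[OF h z] psd_diagonal_real(1)[OF h zero] by auto
    have "complex_of_real (1 / (1 - (cmod z)\<^sup>2)\<^sup>2) = of_real ((1 - Re (h z z)) * Re (t z z))"
      using bt[OF z z] tz(1) hz(1) bz(1) by (metis of_real_1 of_real_diff of_real_mult)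
    then have 1: "(1 - Re (h z z)) * Re (t z z) = 1 / (1 - (cmod z)\<^sup>2)\<^sup>2" by (simp only: of_real_eq_iff)
    have "complex_of_real 1 = of_real ((1 - Re (h 0 0)) * Re (t 0 0))"
      using bt[OF zero zero] tz(2) hz(2) bz(3) by (metis of_real_1 of_real_diff of_real_mult)
    then have 2: "(1 - Re (h 0 0)) * Re (t 0 0) = 1" by (simp only: of_real_eq_iff)
    have "cmod ((1 - h z 0) * t z 0) = 1" using bt[OF z zero] bz(2) by simp
    then have 3: "cmod (1 - h z 0) * cmod (t z 0) = 1" by (simp only: norm_mult)
    have hp: "0 < 1 - Re (h z z)" "0 < 1 - Re (h 0 0)"
    proof -
      have "0 < (1 - Re (h z z)) * Re (t z z)" "0 < (1 - Re (h 0 0)) * Re (t 0 0)"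
        unfolding 1 2 using q by simp_all
      then show "0 < 1 - Re (h z z)" "0 < 1 - Re (h 0 0)" using tp by (blast intro: zero_less_mult_pos2)+
    qed
    have "(1 - Re (h z z)) * (1 - Re (h 0 0)) \<le> (cmod (1 - h z 0))\<^sup>2"
      using hp by (intro one_minus_psd_reverse_Cauchy_Schwarz[OF h z zero]) auto
    then have "(1 - Re (h z z)) * (1 - Re (h 0 0)) * (cmod (t z 0))\<^sup>2 \<le> (cmod (1 - h z 0))\<^sup>2 * (cmod (t z 0))\<^sup>2"
      by (intro mult_right_mono) auto
    also have "\<dots> = 1" using 3 by (simp flip: power_mult_distrib)
    finally have "(1 - Re (h z z)) * (1 - Re (h 0 0)) * (cmod (t z 0))\<^sup>2 \<le> 1" .
    then have "((1 - Re (h z z)) * (1 - Re (h 0 0)) * (cmod (t z 0))\<^sup>2) * (Re (t z z) * Re (t 0 0)) \<le> 1 * (Re (t z z) * Re (t 0 0))"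
      using tp by (intro mult_right_mono) auto
    also have "((1 - Re (h z z)) * (1 - Re (h 0 0)) * (cmod (t z 0))\<^sup>2) * (Re (t z z) * Re (t 0 0)) =
        ((1 - Re (h z z)) * Re (t z z)) * ((1 - Re (h 0 0)) * Re (t 0 0)) * (cmod (t z 0))\<^sup>2"
      by (simp only: mult_ac)
    finally have "(cmod (t z 0))\<^sup>2 / (1 - (cmod z)\<^sup>2)\<^sup>2 \<le> Re (t z z) * Re (t 0 0)"
      unfolding 1 2 by simp
    then have le: "(cmod (t z 0))\<^sup>2 / (Re (t z z) * Re (t 0 0)) \<le> (1 - (cmod z)\<^sup>2)\<^sup>2"
      using q tp by (simp add: field_simps)
    have "t z 0 * t 0 z = of_real ((cmod (t z 0))\<^sup>2)"
      by (simp only: complex_norm_square psd_hermitian[OF pt z zero])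
    then have "F z z = of_real (1 - (cmod (t z 0))\<^sup>2 / (Re (t z z) * Re (t 0 0)))"
      using tz by (metis F_def of_real_1 of_real_diff of_real_divide of_real_mult)
    then show ?thesis using le by simp
  qed
  have Re_nonneg: "0 \<le> Re w" if "0 \<le> w" for w using that by (simp add: less_eq_complex_def)
  define A where "A = Re (F a a)"
  define B where "B = Re (F b b)"
  define C where "C = Re (F a b)"
  have Fba: "F b a = cnj (F a b)" by (rule psd_hermitian[OF pF ab2])
  have Fr: "Re (F b a) = C" by (simp add: Fba C_def)
  have N: "0 \<le> A + B + 2 * C"
    using psd_two_points[OF pF ab2, of 1 1] Fr by (simp add: less_eq_complex_def A_def B_def C_def)
  have L: "1 - (9999 / 10000)\<^sup>2 \<le> A" "1 - (9999 / 10000)\<^sup>2 \<le> B"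
    using lower[OF ab(1)] lower[OF ab(2)] by (simp_all add: A_def B_def a_def b_def power2_eq_square)
  have s0: "pullback_kernel 0 a a = of_real (5000 / 4999)" "pullback_kernel 0 b b = of_real (5000 / 4999)"
    "pullback_kernel 0 a b = of_real (5000 / 5001)"
    unfolding a_def b_def pullback_at_reals by (simp_all add: power2_eq_square mult_ac)
  have sq: "sqrt (2 * (1 + (1 / 7)\<^sup>2)) = 10 / 7" by (rule real_sqrt_unique) (simp_all add: power2_eq_square)
  have s1: "pullback_kernel (1/7) a a = of_real (1 / (1 - (1001 / 70000)\<^sup>2))"
    "pullback_kernel (1/7) b b = of_real (1 / (1 - (999 / 70000)\<^sup>2))"
    "pullback_kernel (1/7) a b = of_real (1 / (1 + 1001 / 70000 * (999 / 70000)))"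
    "pullback_kernel (1/7) b a = of_real (1 / (1 + 1001 / 70000 * (999 / 70000)))"
    unfolding a_def b_def pullback_at_reals sq by (simp_all add: power2_eq_square)
  have U: "0 \<le> 5000 / 4999 * (1 - A) - 1" "0 \<le> 5000 / 4999 * (1 - B) - 1"
    using psd_diagonal_real(2)[OF quotient[of 0] ab(1)] psd_diagonal_real(2)[OF quotient[of 0] ab(2)]
    by (simp_all add: s0 A_def B_def)
  have "(Re (pullback_kernel 0 a b * (1 - F a b) - 1))\<^sup>2 \<le> (cmod (pullback_kernel 0 a b * (1 - F a b) - 1))\<^sup>2"
    using abs_Re_le_cmod by (metis abs_le_square_iff abs_norm_cancel)
  also have "\<dots> \<le> Re (pullback_kernel 0 a a * (1 - F a a) - 1) * Re (pullback_kernel 0 b b * (1 - F b b) - 1)"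
    by (rule psd_Cauchy_Schwarz[OF quotient ab(1,2)]) simp
  finally have U3: "(5000 / 5001 * (1 - C) - 1)\<^sup>2 \<le> (5000 / 4999 * (1 - A) - 1) * (5000 / 4999 * (1 - B) - 1)"
    by (simp add: s0 A_def B_def C_def)
  have "0 \<le> Re (of_real (95 / 100) * cnj (of_real (95 / 100)) * (pullback_kernel (1/7) a a * (1 - F a a) - 1)
      + of_real (95 / 100) * cnj (of_real (105 / 100)) * (pullback_kernel (1/7) a b * (1 - F a b) - 1)
      + of_real (105 / 100) * cnj (of_real (95 / 100)) * (pullback_kernel (1/7) b a * (1 - F b a) - 1)
      + of_real (105 / 100) * cnj (of_real (105 / 100)) * (pullback_kernel (1/7) b b * (1 - F b b) - 1))"
    by (rule Re_nonneg, rule psd_two_points[OF quotient ab(1,2)]) simp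
  then have R: "0 \<le> (95 / 100)\<^sup>2 * (1 / (1 - (1001 / 70000)\<^sup>2) * (1 - A) - 1)
      + 2 * (95 / 100 * (105 / 100)) * (1 / (1 + 1001 / 70000 * (999 / 70000)) * (1 - C) - 1)
      + (105 / 100)\<^sup>2 * (1 / (1 - (999 / 70000)\<^sup>2) * (1 - B) - 1)"
    unfolding s1 by (simp add: Fr A_def[symmetric] B_def[symmetric] C_def[symmetric] power2_eq_square)
  show False by (rule three_point_inequalities_incompatible[OF N L U U3 R])
qed

lemma pullback_kernels_distinct:
  assumes "\<alpha> \<in> {0..1}" "\<beta> \<in> {0..1}" "\<alpha> \<noteq> \<beta>"
  shows "\<exists>z\<in>\<D>. \<exists>w\<in>\<D>. pullback_kernel \<alpha> z w \<noteq> pullback_kernel \<beta> z w"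
proof -
  define f :: "real \<Rightarrow> real" where "f c = sqrt (2 * (1 + c\<^sup>2)) * (1/8) + c * (1/8)\<^sup>2" for c
  have mono: "0 < f c" "c < d \<Longrightarrow> f c < f d" if "0 \<le> c" for c d
  proof -
    show "0 < f c" unfolding f_def using that by (intro add_pos_nonneg mult_pos_pos) (auto simp: add_pos_nonneg)
    assume "c < d"
    then have "c\<^sup>2 \<le> d\<^sup>2" using that by (intro power_mono) auto
    then show "f c < f d" unfolding f_def using \<open>c < d\<close> by (intro add_le_less_mono mult_right_mono) auto
  qed
  have z: "of_real (1/8) \<in> \<D>" by simp
  have ne: "f \<alpha> \<noteq> f \<beta>" using mono(2)[of \<alpha> \<beta>] mono(2)[of \<beta> \<alpha>] assms by (cases "\<alpha> < \<beta>") auto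
  have "pullback_kernel \<alpha> (of_real (1/8)) (of_real (1/8)) \<noteq> pullback_kernel \<beta> (of_real (1/8)) (of_real (1/8))"
  proof
    assume "pullback_kernel \<alpha> (of_real (1/8)) (of_real (1/8)) = pullback_kernel \<beta> (of_real (1/8)) (of_real (1/8))"
    then have "1 / (1 - f \<alpha> * f \<alpha>) = 1 / (1 - f \<beta> * f \<beta>)"
      unfolding pullback_at_reals f_def[symmetric] by (simp only: of_real_eq_iff)
    then have "f \<alpha> * f \<alpha> = f \<beta> * f \<beta>" by simp
    then show False using ne mono(1)[of \<alpha>] mono(1)[of \<beta>] assms by (simp add: square_eq_iff)
  qed
  then show ?thesis using z by blast
qed

theorem theorem1p8:
  shows "\<exists>(r::real) (\<Lambda>::real set) (s :: real \<Rightarrow> complex \<Rightarrow> complex \<Rightarrow> complex).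
    0 < r \<and> r < 1 \<and>
    is_interval \<Lambda> \<and> infinite \<Lambda> \<and>
    (\<forall>\<alpha>\<in>\<Lambda>. \<forall>\<beta>\<in>\<Lambda>. \<alpha> \<noteq> \<beta> \<longrightarrow>
       (\<exists>z\<in>ball 0 r. \<exists>w\<in>ball 0 r. s \<alpha> z w \<noteq> s \<beta> z w)) \<and>
    (\<forall>\<alpha>\<in>\<Lambda>. complete_pick_kernel (ball 0 r) (s \<alpha>)) \<and>
    (\<forall>\<alpha>\<in>\<Lambda>. \<exists>h. kernel_on (ball 0 r) h \<and>
       (\<forall>z\<in>ball 0 r. \<forall>w\<in>ball 0 r. bergman z w = (1 - h z w) * s \<alpha> z w)) \<and>
    \<not> (\<exists>t. complete_pick_kernel (ball 0 r) t \<and>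
         (\<exists>h. kernel_on (ball 0 r) h \<and>
            (\<forall>z\<in>ball 0 r. \<forall>w\<in>ball 0 r. bergman z w = (1 - h z w) * t z w)) \<and>
         (\<forall>\<alpha>\<in>\<Lambda>. \<exists>g. kernel_on (ball 0 r) g \<and>
            (\<forall>z\<in>ball 0 r. \<forall>w\<in>ball 0 r. s \<alpha> z w = t z w * g z w))) \<and>
    (\<forall>\<alpha>\<in>\<Lambda>. complete_pick_pair (ball 0 r) bergman (s \<alpha>)) \<and>
    \<not> (\<exists>t. kernel_on (ball 0 r) t \<and>
         (\<forall>\<alpha>\<in>\<Lambda>. strong_shimorin_certificate (ball 0 r) bergman (s \<alpha>) t))"
proof (intro exI[of _ "1/4 :: real"] exI[of _ "{0..1} :: real set"] exI[of _ pullback_kernel] conjI ballI impI)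
  show "\<exists>z\<in>\<D>. \<exists>w\<in>\<D>. pullback_kernel \<alpha> z w \<noteq> pullback_kernel \<beta> z w"
    if "\<alpha> \<in> {0..1}" "\<beta> \<in> {0..1}" "\<alpha> \<noteq> \<beta>" for \<alpha> \<beta>
    by (rule pullback_kernels_distinct[OF that])
  show "complete_pick_kernel \<D> (pullback_kernel \<alpha>)" if "\<alpha> \<in> {0..1}" for \<alpha>
    by (rule pullback_complete_pick[OF that])
  show "\<exists>h. kernel_on \<D> h \<and> (\<forall>z\<in>\<D>. \<forall>w\<in>\<D>. bergman z w = (1 - h z w) * pullback_kernel \<alpha> z w)"
    if "\<alpha> \<in> {0..1}" for \<alpha>
    using psd_chi[of \<alpha>] bergman_factorization[OF that]
    by (intro exI[of _ "\<lambda>z w. bergman z w * (chi \<alpha> z * cnj (chi \<alpha> w))"]) (auto simp: kernel_on_iff_psd)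
  show "complete_pick_pair \<D> bergman (pullback_kernel \<alpha>)" if "\<alpha> \<in> {0..1}" for \<alpha>
    by (rule bergman_pullback_complete_pick_pair[OF that])
  show "\<not> (\<exists>t. complete_pick_kernel \<D> t \<and>
         (\<exists>h. kernel_on \<D> h \<and> (\<forall>z\<in>\<D>. \<forall>w\<in>\<D>. bergman z w = (1 - h z w) * t z w)) \<and>
         (\<forall>\<alpha>\<in>{0..1}. \<exists>g. kernel_on \<D> g \<and> (\<forall>z\<in>\<D>. \<forall>w\<in>\<D>. pullback_kernel \<alpha> z w = t z w * g z w)))"
  proof (intro notI, elim exE conjE)
    fix t h assume t: "complete_pick_kernel \<D> t" and h: "kernel_on \<D> h"
      "\<forall>z\<in>\<D>. \<forall>w\<in>\<D>. bergman z w = (1 - h z w) * t z w"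
      and g: "\<forall>\<alpha>\<in>{0..1}. \<exists>g. kernel_on \<D> g \<and> (\<forall>z\<in>\<D>. \<forall>w\<in>\<D>. pullback_kernel \<alpha> z w = t z w * g z w)"
    show False
    proof (rule no_common_certificate[OF t])
      show "psd \<D> h" using h(1) by (simp add: kernel_on_iff_psd)
      show "bergman z w = (1 - h z w) * t z w" if "z \<in> \<D>" "w \<in> \<D>" for z w using h(2) that by blast
      show "\<exists>g. psd \<D> g \<and> (\<forall>z\<in>\<D>. \<forall>w\<in>\<D>. pullback_kernel c z w = t z w * g z w)" if "c \<in> {0..1}" for c
        using bspec[OF g that] by (auto simp: kernel_on_iff_psd)
    qed
  qed
  show "\<not> (\<exists>t. kernel_on \<D> t \<and>
         (\<forall>\<alpha>\<in>{0..1}. strong_shimorin_certificate \<D> bergman (pullback_kernel \<alpha>) t))"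
  proof
    assume "\<exists>t. kernel_on \<D> t \<and> (\<forall>\<alpha>\<in>{0..1}. strong_shimorin_certificate \<D> bergman (pullback_kernel \<alpha>) t)"
    then obtain t where t: "\<And>\<alpha>. \<alpha> \<in> {0..1} \<Longrightarrow> strong_shimorin_certificate \<D> bergman (pullback_kernel \<alpha>) t" by blast
    obtain h where h: "kernel_on \<D> h" "\<forall>z\<in>\<D>. \<forall>w\<in>\<D>. bergman z w = (1 - h z w) * t z w"
      using t[of 0] unfolding strong_shimorin_certificate_def by auto
    show False
    proof (rule no_common_certificate)
      show "complete_pick_kernel \<D> t" using t[of 0] by (simp add: strong_shimorin_certificate_def)
      show "psd \<D> h" using h(1) by (simp add: kernel_on_iff_psd)
      show "bergman z w = (1 - h z w) * t z w" if "z \<in> \<D>" "w \<in> \<D>" for z w using h(2) that by blast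
      fix c :: real assume c: "c \<in> {0..1}"
      obtain h g where "kernel_on \<D> g" "\<forall>z\<in>\<D>. \<forall>w\<in>\<D>. pullback_kernel c z w = t z w * g z w"
        using t[OF c] unfolding strong_shimorin_certificate_def by (elim conjE exE)
      then show "\<exists>g. psd \<D> g \<and> (\<forall>z\<in>\<D>. \<forall>w\<in>\<D>. pullback_kernel c z w = t z w * g z w)"
        by (auto simp: kernel_on_iff_psd)
    qed
  qed
qed (auto simp: is_interval_def infinite_Icc_iff)

end
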